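(* Under the standing setting with (A2), (A3), for every $\boldsymbol\sigma\in\mathfrak S$ the operator $G_{\boldsymbol\sigma}\in\mathcal L(W_T(V,V')\times W_T(V,V'),\,V'_T\times H\times V'_T\times H)$ is invertible, and there exists a constant $c_{\mathcal G}(T)>0$, independent of $\boldsymbol\sigma$ and depending continuously and monotonically increasingly on $T$, such that $$\|G_{\boldsymbol\sigma}^{-1}\|_{\mathcal L(V'_T\times H\times V'_T\times H,\;W_T(V,V')\times W_T(V,V'))}\le c_{\mathcal G}(T)\qquad\forall\boldsymbol\sigma\in\mathfrak S.$$
   Context: Standing setting: $V\subset H\subset V'$ is a Gelfand triple of separable real Hilbert spaces ($V$ continuously and densely embedded in $H$, $H$ identified with its dual), with constants $c_V,c_H$ such that $\|v\|_H\le c_V\|v\|_V$ and $\|v\|_{V'}\le c_H\|v\|_H$. $U$ is a finite-dimensional Hilbert space, $B\in\mathcal L(U,H)$, $Q,P\in\mathcal L(H)$, $T>0$ fixed. For a Banach space $X$ write $X_T:=L^2(0,T;X)$, and $W_T(V,V'):=\{w\in V_T:\dot w\in V'_T\}$ with norm $\|w\|^2_{W_T(V,V')}=\|w\|^2_{V_T}+\|\dot w\|^2_{V'_T}$ (it embeds continuously into $C([0,T];H)$); product spaces carry the Euclidean product norm. The parameter set is $\mathfrak S=[-1/2,1/2]^{\mathbb N}$. For every $\boldsymbol\sigma\in\mathfrak S$, $\mathcal A_{\boldsymbol\sigma}\in\mathcal L(V,V')$ is given by $\langle\mathcal A_{\boldsymbol\sigma}v,w\rangle_{V',V}=-a(\boldsymbol\sigma;v,w)$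 for a bilinear form $a(\boldsymbol\sigma;\cdot,\cdot)$ on $V$, and: (A2) there exist $\rho\in\mathbb R$, $\theta>0$ with $a(\boldsymbol\sigma;v,v)+\rho\|v\|_H^2\ge\theta\|v\|_V^2$ for all $v\in V$, $\boldsymbol\sigma\in\mathfrak S$; (A3) $\|\mathcal A_{\boldsymbol\sigma}\|_{\mathcal L(V,V')}\le C_{\mathcal A}$ for all $\boldsymbol\sigma$. The saddle-point operator is $$G_{\boldsymbol\sigma}(w_1,w_2):=\big(\dot w_1-\mathcal A_{\boldsymbol\sigma}w_1-BB^*w_2,\ w_1(0),\ Q^*Qw_1-\dot w_2-\mathcal A_{\boldsymbol\sigma}^*w_2,\ P^*Pw_1(T)+w_2(T)\big)\in V'_T\times H\times V'_T\times H .$$ *)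

theory Defs
  imports "HOL-Analysis.Analysis"
begin

definition Sfrak :: "(nat \<Rightarrow> real) set" where
  "Sfrak = {\<sigma>. \<forall>i. \<sigma> i \<in> {-1/2..1/2}}"

(* Bochner space L^2(0,T;X): (strongly = Borel, X separable) measurable functions
   with finite square integral; elements are compared almost everywhere. *)
definition L2sp :: "real \<Rightarrow> (real \<Rightarrow> 'a::real_normed_vector) set" where
  "L2sp T = {f. f \<in> borel_measurable (lebesgue_on {0..T}) \<and>
      (\<integral>\<^sup>+ t. ennreal ((norm (f t))\<^sup>2) \<partial>lebesgue_on {0..T}) < \<infinity>}"

definition L2nrm :: "real \<Rightarrow> (real \<Rightarrow> 'a::real_normed_vector) \<Rightarrow> real" where
  "L2nrm T f = sqrt (enn2real (\<integral>\<^sup>+ t. ennreal ((norm (f t))\<^sup>2) \<partial>lebesgue_on {0..T}))"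

definition hdual :: "('v::real_normed_vector \<Rightarrow> 'h::real_inner) \<Rightarrow> 'h \<Rightarrow> ('v \<Rightarrow>\<^sub>L real)" where
  "hdual \<iota> h = Blinfun (\<lambda>v. inner h (\<iota> v))"

definition testfun :: "real \<Rightarrow> (real \<Rightarrow> real) \<Rightarrow> bool" where
  "testfun T \<phi> \<longleftrightarrow> \<phi> differentiable_on UNIV \<and> continuous_on UNIV (deriv \<phi>) \<and>
     (\<exists>a b. 0 < a \<and> b < T \<and> (\<forall>t. t \<notin> {a..b} \<longrightarrow> \<phi> t = 0))"

(* d is the weak (distributional, V'-valued) derivative of the V-valued function w,
   where V is identified with a subspace of V' through H *)
definition is_wderiv :: "('v::real_normed_vector \<Rightarrow> 'h::real_inner) \<Rightarrow> real \<Rightarrow> (real \<Rightarrow> 'v)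
      \<Rightarrow> (real \<Rightarrow> ('v \<Rightarrow>\<^sub>L real)) \<Rightarrow> bool" where
  "is_wderiv \<iota> T w d \<longleftrightarrow> (\<forall>\<phi> v. testfun T \<phi> \<longrightarrow>
      (\<integral>t. inner (\<iota> (w t)) (\<iota> v) * deriv \<phi> t \<partial>lebesgue_on {0..T})
        = - (\<integral>t. blinfun_apply (d t) v * \<phi> t \<partial>lebesgue_on {0..T}))"

definition WT :: "('v::real_normed_vector \<Rightarrow> 'h::real_inner) \<Rightarrow> real \<Rightarrow> (real \<Rightarrow> 'v) set" where
  "WT \<iota> T = {w. w \<in> L2sp T \<and> (\<exists>d \<in> L2sp T. is_wderiv \<iota> T w d)}"

definition wderiv :: "('v::real_normed_vector \<Rightarrow> 'h::real_inner) \<Rightarrow> real \<Rightarrow> (real \<Rightarrow> 'v)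
      \<Rightarrow> real \<Rightarrow> ('v \<Rightarrow>\<^sub>L real)" where
  "wderiv \<iota> T w = (SOME d. d \<in> L2sp T \<and> is_wderiv \<iota> T w d)"

definition WTnrm :: "('v::real_normed_vector \<Rightarrow> 'h::real_inner) \<Rightarrow> real \<Rightarrow> (real \<Rightarrow> 'v) \<Rightarrow> real" where
  "WTnrm \<iota> T w = sqrt ((L2nrm T w)\<^sup>2 + (L2nrm T (wderiv \<iota> T w))\<^sup>2)"

(* point value in H of the continuous representative (W_T \<subseteq> C([0,T];H)) *)
definition hval :: "('v::real_normed_vector \<Rightarrow> 'h::real_inner) \<Rightarrow> real \<Rightarrow> (real \<Rightarrow> 'v) \<Rightarrow> real \<Rightarrow> 'h" where
  "hval \<iota> T w = (SOME u. continuous_on {0..T} u \<and>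
      (AE s in lebesgue_on {0..T}. u s = \<iota> (w s)))"

definition Aop :: "((nat \<Rightarrow> real) \<Rightarrow> 'v \<Rightarrow> 'v \<Rightarrow> real) \<Rightarrow> (nat \<Rightarrow> real) \<Rightarrow> 'v \<Rightarrow> ('v::real_normed_vector \<Rightarrow>\<^sub>L real)" where
  "Aop a \<sigma> v = Blinfun (\<lambda>w. - a \<sigma> v w)"

definition Aadj :: "((nat \<Rightarrow> real) \<Rightarrow> 'v \<Rightarrow> 'v \<Rightarrow> real) \<Rightarrow> (nat \<Rightarrow> real) \<Rightarrow> 'v \<Rightarrow> ('v::real_normed_vector \<Rightarrow>\<^sub>L real)" where
  "Aadj a \<sigma> v = Blinfun (\<lambda>w. - a \<sigma> w v)"

definition Gop :: "('v::real_normed_vector \<Rightarrow> 'h::real_inner) \<Rightarrow> ('u::real_inner \<Rightarrow> 'h) \<Rightarrow> ('h \<Rightarrow> 'h) \<Rightarrow> ('h \<Rightarrow> 'h)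
     \<Rightarrow> ((nat \<Rightarrow> real) \<Rightarrow> 'v \<Rightarrow> 'v \<Rightarrow> real) \<Rightarrow> real \<Rightarrow> (nat \<Rightarrow> real)
     \<Rightarrow> (real \<Rightarrow> 'v) \<Rightarrow> (real \<Rightarrow> 'v)
     \<Rightarrow> (real \<Rightarrow> ('v \<Rightarrow>\<^sub>L real)) \<times> 'h \<times> (real \<Rightarrow> ('v \<Rightarrow>\<^sub>L real)) \<times> 'h" where
  "Gop \<iota> B Q P a T \<sigma> w1 w2 =
     ((\<lambda>t. wderiv \<iota> T w1 t - Aop a \<sigma> (w1 t) - hdual \<iota> (B (adjoint B (\<iota> (w2 t))))),
      hval \<iota> T w1 0,
      (\<lambda>t. hdual \<iota> (adjoint Q (Q (\<iota> (w1 t)))) - wderiv \<iota> T w2 t - Aadj a \<sigma> (w2 t)),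
      adjoint P (P (hval \<iota> T w1 T)) + hval \<iota> T w2 T)"

definition Geq :: "real \<Rightarrow> (real \<Rightarrow> 'a) \<times> 'h \<times> (real \<Rightarrow> 'a) \<times> 'h
     \<Rightarrow> (real \<Rightarrow> 'a) \<times> 'h \<times> (real \<Rightarrow> 'a) \<times> 'h \<Rightarrow> bool" where
  "Geq T x y \<longleftrightarrow> (case x of (f, y0, g, yT) \<Rightarrow> case y of (f', y0', g', yT') \<Rightarrow>
      (AE t in lebesgue_on {0..T}. f t = f' t) \<and> y0 = y0' \<and>
      (AE t in lebesgue_on {0..T}. g t = g' t) \<and> yT = yT')"

definition Dnrm :: "real \<Rightarrow> (real \<Rightarrow> 'a::real_normed_vector) \<times> 'h::real_normed_vector \<times> (real \<Rightarrow> 'a) \<times> 'h \<Rightarrow> real" where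
  "Dnrm T x = (case x of (f, y0, g, yT) \<Rightarrow>
      sqrt ((L2nrm T f)\<^sup>2 + (norm y0)\<^sup>2 + (L2nrm T g)\<^sup>2 + (norm yT)\<^sup>2))"

end

(*
  The Riesz isomorphism V' = V turns everything into statements about V-valued
  functions: with K = iota^* iota, the pair (w, w') lies in W_T iff K w is a primitive of the Riesz
  representative of w'.  The resolvents (K + epsilon)^(-1) regularise this relation and yield the
  embedding into C([0,T];H) together with the integration by parts formula.

  A priori bound: testing the state equation with w2 and the adjoint equation with w1 cancels the
  A-terms and gives |P w1(T)|^2 + int |B^* w2|^2 + int |Q w1|^2 <= 4 D Y, where D is the norm of the
  data and Y that of the solution.  The energy estimates (Gronwall) for the two equations bound Y^2 by
  c (D^2 + |P w1(T)|^2 + int |B^* w2|^2 + int |Q w1|^2), hence Y <= 6 c D with c = const * exp ((2 rho + 1) T).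

  Existence: interchanging the two components turns G into its own formal adjoint, so the a priori
  bound makes the data functional continuous on the range of G; its Riesz representative is a solution.
*)

theory Submission
  imports Defs
begin

text \<open>The constant must increase with T, which rules out bounding end values through the trace
  map from W_T to C([0,T];H), whose squared norm is bounded only by \<open>ci^2 / T + 1\<close>. So
  the unknown \<open>Ysq\<close> contains the end values w1(T) and w2(0) next to the W_T norms, and
  the energy estimates bound them directly. The same two traces are paired with the data in the
  existence proof, so one estimate serves both halves of the theorem. Functions in L^2(0,T;V) are
  compared only almost everywhere and do not form a Hilbert space as a type. Riesz' theorem is
  therefore proved once for a semi-inner product on an arbitrary index set, without completeness, by
  following a minimizing sequence of the quadratic functional; each use takes the limit in a
  complete space that fits. It yields representatives of functionals on V, membership in H, the
  resolvents, density of the range of K, and the very weak solution. Uniformity in \<sigma> needs no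
  separate argument: every constant is built from bounds shared by all \<sigma>.\<close>

section \<open>Riesz representation and resolvents in a Gelfand triple\<close>

text \<open>Minimizing J replaces the projection theorem. Members of \<open>S\<close> are mere
  indices: \<open>lin\<close> provides their linear combinations as seen through \<open>ip\<close>
  and \<open>l\<close>, so \<open>S\<close> needs no vector space structure and \<open>ip\<close>
  may be degenerate. The limit of the sequence is left to each application, which takes it in a
  complete space into which \<open>S\<close> maps.\<close>

lemma riesz_minimizing_sequence:
  fixes S :: "'i set" and ip :: "'i \<Rightarrow> 'i \<Rightarrow> real" and l :: "'i \<Rightarrow> real"
  assumes ne: "S \<noteq> {}"
    and lin: "\<And>x y c d. x \<in> S \<Longrightarrow> y \<in> S \<Longrightarrow>
      \<exists>z\<in>S. l z = c * l x + d * l y \<and> (\<forall>u\<in>S. ip z u = c * ip x u + d * ip y u)"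
    and sym: "\<And>x y. x \<in> S \<Longrightarrow> y \<in> S \<Longrightarrow> ip x y = ip y x"
    and pos: "\<And>x. x \<in> S \<Longrightarrow> 0 \<le> ip x x"
    and bdd: "\<And>x. x \<in> S \<Longrightarrow> \<bar>l x\<bar> \<le> C * sqrt (ip x x)"
  obtains s :: "nat \<Rightarrow> 'i" where "\<And>n. s n \<in> S"
    "\<And>e. e > 0 \<Longrightarrow> \<exists>N. \<forall>m\<ge>N. \<forall>n\<ge>N. ip (s m) (s m) - 2 * ip (s m) (s n) + ip (s n) (s n) < e"
    "\<And>x. x \<in> S \<Longrightarrow> (\<lambda>n. ip (s n) x) \<longlonglongrightarrow> l x"
proof -
  define J where "J x = ip x x - 2 * l x" for x
  have Jlb: "- C\<^sup>2 \<le> J x" if "x \<in> S" for x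
  proof -
    have "2 * l x \<le> 2 * (C * sqrt (ip x x))" using bdd[OF that] by linarith
    moreover have "0 \<le> (sqrt (ip x x) - C)\<^sup>2" by simp
    moreover have "(sqrt (ip x x) - C)\<^sup>2 = ip x x - 2 * (C * sqrt (ip x x)) + C\<^sup>2"
      using pos[OF that] by (simp add: power2_diff)
    ultimately show ?thesis unfolding J_def by linarith
  qed
  define m where "m = Inf (J ` S)"
  have bb: "bdd_below (J ` S)" using Jlb by (auto intro!: bdd_belowI[of _ "- C\<^sup>2"])
  have mle: "m \<le> J x" if "x \<in> S" for x
    unfolding m_def using bb that by (auto intro: cInf_lower)
  have "\<exists>x\<in>S. J x < m + 1 / real (Suc n)" for n
  proof -
    have "Inf (J ` S) < m + 1 / real (Suc n)" unfolding m_def by simp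
    then show ?thesis using cInf_less_iff[of "J ` S"] ne bb by auto
  qed
  then obtain s where s: "\<And>n. s n \<in> S" and sJ: "\<And>n. J (s n) < m + 1 / real (Suc n)" by metis
  \<comment> \<open>Parallelogram identity: J at the midpoint z is at least m, so near-minimizers
    are close to each other.\<close>
  have dist_le: "ip x x - 2 * ip x y + ip y y \<le> 2 * (J x - m) + 2 * (J y - m)"
    if x: "x \<in> S" and y: "y \<in> S" for x y
  proof -
    obtain z where z: "z \<in> S" "l z = 1/2 * l x + 1/2 * l y"
      "\<And>u. u \<in> S \<Longrightarrow> ip z u = 1/2 * ip x u + 1/2 * ip y u"
      using lin[OF x y, of "1/2" "1/2"] by blast
    have "ip z z = 1/2 * ip z x + 1/2 * ip z y"
      using z(3)[OF z(1)] sym[OF x z(1)] sym[OF y z(1)] by simp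
    also have "\<dots> = 1/4 * (ip x x + 2 * ip x y + ip y y)"
      using z(3)[OF x] z(3)[OF y] sym[OF x y] by (simp only:) (simp add: add_divide_distrib)
    finally have "J z = 1/4 * (ip x x + 2 * ip x y + ip y y) - (l x + l y)"
      unfolding J_def z(2) by simp
    with mle[OF z(1)] show ?thesis unfolding J_def by (simp add: algebra_simps)
  qed
  have small: "\<exists>N. \<forall>n\<ge>N. J (s n) - m < e" if "e > 0" for e
  proof -
    obtain N where N: "1 / real (Suc N) < e"
      using nat_approx_posE[OF \<open>e > 0\<close>] by blast
    have "J (s n) - m < e" if "n \<ge> N" for n
    proof -
      have "1 / real (Suc n) \<le> 1 / real (Suc N)" using that by (simp add: frac_le)
      then show ?thesis using sJ[of n] N by linarith
    qed
    then show ?thesis by blast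
  qed
  have cauchy: "\<exists>N. \<forall>m\<ge>N. \<forall>n\<ge>N. ip (s m) (s m) - 2 * ip (s m) (s n) + ip (s n) (s n) < e"
    if "e > 0" for e
  proof -
    obtain N where N: "\<And>n. n \<ge> N \<Longrightarrow> J (s n) - m < e/4"
      using small[of "e/4"] \<open>e > 0\<close> by auto
    have "ip (s p) (s p) - 2 * ip (s p) (s n) + ip (s n) (s n) < e" if "p \<ge> N" "n \<ge> N" for p n
      using dist_le[OF s[of p] s[of n]] N[OF that(1)] N[OF that(2)] by argo
    then show ?thesis by blast
  qed
  have conv: "(\<lambda>n. ip (s n) x) \<longlonglongrightarrow> l x" if x: "x \<in> S" for x
  proof -
    \<comment> \<open>The summand 1 keeps \<open>P\<close> positive when x is a null vector of
      \<open>ip\<close>.\<close>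
    define P where "P = ip x x + 1"
    have P: "P > 0" "ip x x \<le> P" unfolding P_def using pos[OF x] by auto
    have key: "(ip (s n) x - l x)\<^sup>2 \<le> P * (J (s n) - m)" for n
    proof -
      define \<delta> where "\<delta> = ip (s n) x - l x"
      \<comment> \<open>The step that minimizes the upper bound 2 * c * \<delta> + c^2 * P for the
        change of J along x; it shows that near the minimum the first variation \<delta> is
        small.\<close>
      define c where "c = - \<delta> / P"
      obtain z where z: "z \<in> S" "l z = 1 * l (s n) + c * l x"
        "\<And>u. u \<in> S \<Longrightarrow> ip z u = 1 * ip (s n) u + c * ip x u"
        using lin[OF s[of n] x, of 1 c] by blast
      have "ip z z = ip z (s n) + c * ip z x"
        using z(3)[OF z(1)] sym[OF s[of n] z(1)] sym[OF x z(1)] by simp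
      also have "\<dots> = ip (s n) (s n) + 2 * c * ip (s n) x + c\<^sup>2 * ip x x"
        using z(3)[OF x] z(3)[OF s[of n]] sym[OF x s[of n]] by (simp add: power2_eq_square algebra_simps)
      finally have "J z = J (s n) + 2 * c * \<delta> + c\<^sup>2 * ip x x"
        unfolding J_def z(2) \<delta>_def by (simp add: algebra_simps)
      moreover have "c\<^sup>2 * ip x x \<le> c\<^sup>2 * P" using P by (intro mult_left_mono) auto
      moreover have "2 * c * \<delta> + c\<^sup>2 * P = - \<delta>\<^sup>2 / P"
        unfolding c_def using P by (simp add: field_simps power2_eq_square)
      ultimately have "\<delta>\<^sup>2 / P \<le> J (s n) - m" using mle[OF z(1)] by linarith
      then show ?thesis using P unfolding \<delta>_def by (simp add: field_simps)
    qed
    show ?thesis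
    proof (rule LIMSEQ_I)
      fix r :: real assume r: "r > 0"
      obtain N where N: "\<And>n. n \<ge> N \<Longrightarrow> J (s n) - m < r\<^sup>2 / P"
        using small[of "r\<^sup>2 / P"] r P by auto
      have "norm (ip (s n) x - l x) < r" if "n \<ge> N" for n
      proof -
        have "P * (J (s n) - m) < P * (r\<^sup>2 / P)"
          by (rule mult_strict_left_mono[OF N[OF that] P(1)])
        then have "\<bar>ip (s n) x - l x\<bar>\<^sup>2 < r\<^sup>2" using le_less_trans[OF key[of n]] P by simp
        then show ?thesis using r power2_less_imp_less[of "\<bar>ip (s n) x - l x\<bar>" r] by simp
      qed
      then show "\<exists>no. \<forall>n\<ge>no. norm (ip (s n) x - l x) < r" by blast
    qed
  qed
  show ?thesis using that[OF s cauchy conv] by blast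
qed

lemma norm_diff_sq: "(norm (x - y))\<^sup>2 = inner x x - 2 * inner x y + inner y y"
  for x y :: "'a::real_inner"
  by (simp add: power2_norm_eq_inner inner_diff_left inner_diff_right inner_commute)

lemma convergent_of_norm_sq_Cauchy:
  fixes s :: "nat \<Rightarrow> 'a::{real_normed_vector,complete_space}"
  assumes "\<And>e. e > 0 \<Longrightarrow> \<exists>N. \<forall>m\<ge>N. \<forall>n\<ge>N. (norm (s m - s n))\<^sup>2 < e"
  obtains v where "s \<longlonglongrightarrow> v"
proof -
  have "Cauchy s"
  proof (rule CauchyI)
    fix e :: real assume "e > 0"
    then obtain N where "\<forall>m\<ge>N. \<forall>n\<ge>N. (norm (s m - s n))\<^sup>2 < e\<^sup>2"
      using assms[of "e\<^sup>2"] by auto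
    then show "\<exists>M. \<forall>m\<ge>M. \<forall>n\<ge>M. norm (s m - s n) < e"
      using \<open>e > 0\<close> by (meson less_eq_real_def power_less_imp_less_base)
  qed
  then show ?thesis using that Cauchy_convergent_iff convergent_def
    by (metis Cauchy_convergent)
qed

lemma riesz_representation:
  fixes l :: "'a::{real_inner,complete_space} \<Rightarrow> real"
  assumes "bounded_linear l"
  shows "\<exists>v. \<forall>x. l x = inner x v"
proof -
  interpret l: bounded_linear l by fact
  obtain C where C: "\<And>x. norm (l x) \<le> norm x * C" using l.bounded by blast
  obtain s where s: "\<And>e. e > 0 \<Longrightarrow> \<exists>N. \<forall>m\<ge>N. \<forall>n\<ge>N. inner (s m) (s m) - 2 * inner (s m) (s n) + inner (s n) (s n) < e"
    "\<And>x. (\<lambda>n. inner (s n) x) \<longlonglongrightarrow> l x"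
  proof (rule riesz_minimizing_sequence[where S="UNIV::'a set" and l=l and ip=inner and C=C])
    show "\<exists>z\<in>UNIV. l z = c * l x + d * l y \<and> (\<forall>u\<in>UNIV. inner z u = c * inner x u + d * inner y u)" for x y c d
      by (rule bexI[of _ "c *\<^sub>R x + d *\<^sub>R y"]) (auto simp: l.add l.scaleR inner_add_left)
    show "\<bar>l x\<bar> \<le> C * sqrt (inner x x)" for x
      using C[of x] by (simp add: norm_eq_sqrt_inner mult.commute)
  qed (auto simp: inner_commute)
  obtain v where v: "s \<longlonglongrightarrow> v"
    by (rule convergent_of_norm_sq_Cauchy[of s]) (use s(1) in \<open>auto simp: norm_diff_sq\<close>)
  have "l x = inner x v" for x
    using LIMSEQ_unique[OF s(2) tendsto_inner[OF v tendsto_const]] by (simp add: inner_commute)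
  then show ?thesis by blast
qed

text \<open>\<open>adjoint\<close> is a choice operator; only once Riesz' theorem provides a witness
  does it satisfy its defining equation.\<close>

lemma adjoint_inner:
  fixes f :: "'a::{real_inner,complete_space} \<Rightarrow> 'b::real_inner"
  assumes "bounded_linear f"
  shows "inner (f x) y = inner x (adjoint f y)"
proof -
  have "\<exists>v. \<forall>x. inner (f x) y = inner x v" for y
    by (intro riesz_representation bounded_linear_inner_left_comp assms)
  then obtain g where "\<forall>x y. inner (f x) y = inner x (g y)" by metis
  then have "\<forall>x y. inner (f x) y = inner x (adjoint f y)"
    unfolding adjoint_def by (rule someI[where P="\<lambda>g. \<forall>x y. inner (f x) y = inner x (g y)"])
  then show ?thesis by blast
qed

lemma norm_le_of_inner_le:
  fixes v :: "'a::real_inner"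
  assumes "\<And>x. inner x v \<le> c * norm x" "0 \<le> c"
  shows "norm v \<le> c"
  using assms(1)[of v] assms(2)
  by (cases "v = 0") (simp_all add: power2_norm_eq_inner[symmetric] power2_eq_square)

lemma norm_adjoint_le:
  fixes f :: "'a::{real_inner,complete_space} \<Rightarrow> 'b::real_inner"
  assumes f: "bounded_linear f" and c: "0 \<le> c" "\<And>x. norm (f x) \<le> c * norm x"
  shows "norm (adjoint f y) \<le> c * norm y"
proof (rule norm_le_of_inner_le)
  fix x
  have "inner x (adjoint f y) = inner (f x) y" by (simp add: adjoint_inner[OF f])
  also have "\<dots> \<le> norm (f x) * norm y" by (rule norm_cauchy_schwarz)
  also have "\<dots> \<le> (c * norm x) * norm y" using c(2) by (intro mult_right_mono) auto
  finally show "inner x (adjoint f y) \<le> c * norm y * norm x" by (simp add: mult_ac)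
qed (use c in auto)

lemma bounded_linear_nonneg_bound:
  assumes "bounded_linear f"
  obtains c where "0 \<le> c" "\<And>x. norm (f x) \<le> c * norm x"
  using bounded_linear.nonneg_bounded[OF assms] by (metis mult.commute)

lemma bounded_linear_adjoint:
  fixes f :: "'a::{real_inner,complete_space} \<Rightarrow> 'b::real_inner"
  assumes f: "bounded_linear f"
  shows "bounded_linear (adjoint f)"
proof -
  obtain c where c: "0 \<le> c" "\<And>x. norm (f x) \<le> c * norm x"
    by (rule bounded_linear_nonneg_bound[OF f]) blast
  show ?thesis
  proof (rule bounded_linear_intro[where K=c])
    fix y z and r :: real
    show "adjoint f (y + z) = adjoint f y + adjoint f z"
      by (rule vector_eq_ldot[THEN iffD1])
        (simp add: inner_add_right flip: adjoint_inner[OF f])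
    show "adjoint f (r *\<^sub>R y) = r *\<^sub>R adjoint f y"
      by (rule vector_eq_ldot[THEN iffD1]) (simp flip: adjoint_inner[OF f])
    show "norm (adjoint f y) \<le> norm y * c"
      using norm_adjoint_le[OF f c, of y] by (simp add: mult.commute)
  qed
qed

text \<open>The adjoint of a functional maps the reals to V; its value at 1 is the representing
  vector.\<close>

definition riesz :: "('v::{real_inner,complete_space} \<Rightarrow>\<^sub>L real) \<Rightarrow> 'v" where
  "riesz F = adjoint (blinfun_apply F) 1"

lemma inner_riesz: "inner v (riesz F) = blinfun_apply F v" "inner (riesz F) v = blinfun_apply F v"
  using adjoint_inner[of "blinfun_apply F" v 1]
  by (auto simp: riesz_def blinfun.bounded_linear_right inner_commute)

lemma riesz_eqI: "(\<And>v. blinfun_apply F v = inner v x) \<Longrightarrow> riesz F = x"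
  by (rule vector_eq_ldot[THEN iffD1]) (simp add: inner_riesz)

lemma riesz_add: "riesz (F + G) = riesz F + riesz G"
  and riesz_diff: "riesz (F - G) = riesz F - riesz G"
  and riesz_scaleR: "riesz (c *\<^sub>R F) = c *\<^sub>R riesz F"
  by (rule riesz_eqI, simp add: inner_riesz inner_add_right inner_diff_right blinfun.add_left blinfun.diff_left blinfun.scaleR_left)+

lemma norm_riesz: "norm (riesz F) = norm F"
proof (rule antisym)
  show "norm (riesz F) \<le> norm F"
  proof (rule norm_le_of_inner_le)
    show "inner x (riesz F) \<le> norm F * norm x" for x
      using norm_blinfun[of F x] by (simp add: inner_riesz)
  qed simp
  show "norm F \<le> norm (riesz F)"
    by (rule norm_blinfun_bound) (simp_all add: Cauchy_Schwarz_ineq2 flip: inner_riesz(2))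
qed

lemma bounded_linear_riesz: "bounded_linear riesz"
  by (rule bounded_linear_intro[where K=1]) (simp_all add: riesz_add riesz_scaleR norm_riesz)

definition unriesz :: "'v::{real_inner,complete_space} \<Rightarrow> ('v \<Rightarrow>\<^sub>L real)" where
  "unriesz x = Blinfun (\<lambda>v. inner v x)"

lemma unriesz_apply: "blinfun_apply (unriesz x) v = inner v x"
  unfolding unriesz_def by (simp add: bounded_linear_Blinfun_apply bounded_linear_inner_left)

lemma riesz_unriesz [simp]: "riesz (unriesz x) = x"
  by (rule riesz_eqI) (simp add: unriesz_apply)

lemma unriesz_riesz [simp]: "unriesz (riesz F) = F"
  by (rule blinfun_eqI) (simp add: unriesz_apply inner_riesz)

lemma riesz_inj: "riesz F = riesz G \<longleftrightarrow> F = G"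
  by (metis unriesz_riesz)

lemma bounded_linear_unriesz: "bounded_linear (unriesz :: 'v::{real_inner,complete_space} \<Rightarrow> _)"
proof (rule bounded_linear_intro[where K=1])
  show "norm (unriesz x) \<le> norm x * 1" for x :: 'v using norm_riesz[of "unriesz x"] by simp
qed (auto intro!: blinfun_eqI simp: unriesz_apply inner_add_right blinfun.add_left blinfun.scaleR_left)

section \<open>Gelfand triples and the resolvents of the embedding operator\<close>

locale gelfand =
  fixes \<iota> :: "'v::{real_inner,complete_space,second_countable_topology} \<Rightarrow> 'h::{real_inner,complete_space,second_countable_topology}"
  assumes bl: "bounded_linear \<iota>" and inj: "inj \<iota>" and dense: "closure (range \<iota>) = UNIV"
begin

text \<open>With V' identified with V by \<open>riesz\<close>, \<open>istar\<close> is the embedding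
  of H into V', and \<open>K\<close> below is the embedding of V into V'.\<close>

definition istar :: "'h \<Rightarrow> 'v" where "istar = adjoint \<iota>"

definition K :: "'v \<Rightarrow> 'v" where "K v = istar (\<iota> v)"

lemma istar_inner: "inner v (istar h) = inner (\<iota> v) h" "inner (istar h) v = inner (\<iota> v) h"
  unfolding istar_def using adjoint_inner[OF bl] by (metis inner_commute)+

lemma bl_istar: "bounded_linear istar"
  unfolding istar_def by (rule bounded_linear_adjoint[OF bl])

lemma bl_K: "bounded_linear K"
  unfolding K_def by (rule bounded_linear_compose[OF bl_istar bl])

lemma K_inner: "inner v (K w) = inner (\<iota> v) (\<iota> w)" "inner (K w) v = inner (\<iota> w) (\<iota> v)"
  unfolding K_def by (simp_all add: istar_inner inner_commute)

lemma iota_approx: "e > 0 \<Longrightarrow> \<exists>v. norm (\<iota> v - h) < e"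
proof -
  assume "e > 0"
  have "h \<in> closure (range \<iota>)" using dense by simp
  then show ?thesis using \<open>e > 0\<close> unfolding closure_approachable dist_norm by blast
qed

lemma inner_iota_eq0:
  assumes "\<And>v. inner (\<iota> v) h = 0" shows "h = 0"
proof (rule ccontr)
  assume "h \<noteq> 0"
  then obtain v where v: "norm (\<iota> v - h) < norm h" using iota_approx[of "norm h" h] by auto
  have "(norm h)\<^sup>2 = inner (h - \<iota> v) h"
    using assms[of v] by (simp add: power2_norm_eq_inner inner_diff_left)
  also have "\<dots> \<le> norm (\<iota> v - h) * norm h"
    by (metis norm_cauchy_schwarz norm_minus_commute)
  also have "\<dots> < norm h * norm h" using v \<open>h \<noteq> 0\<close> by simp
  finally show False by (simp add: power2_eq_square)
qed

lemma istar_inj: "istar g = istar h \<Longrightarrow> g = h"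
  using inner_iota_eq0[of "g - h"] by (metis eq_iff_diff_eq_0 inner_diff_right istar_inner(1))

lemma K_inj0: "K v = 0 \<Longrightarrow> v = 0"
proof -
  assume "K v = 0"
  then have "\<iota> v = 0" using K_inner(1)[of v v] by simp
  then show "v = 0" using inj bl by (metis bounded_linear.axioms(1) injD linear_0)
qed

text \<open>Criterion for a vector of V, read as a functional, to come from H. Minimizing over V
  with the inner product of H gives a sequence whose images under \<iota> converge in H, although
  the sequence itself need not converge in V.\<close>

lemma iota_represent:
  assumes k: "\<And>v. \<bar>inner v k\<bar> \<le> C * norm (\<iota> v)"
  shows "\<exists>h. istar h = k"
proof -
  interpret bounded_linear \<iota> by (rule bl)
  obtain s where s: "\<And>e. e > 0 \<Longrightarrow> \<exists>N. \<forall>m\<ge>N. \<forall>n\<ge>N. inner (\<iota> (s m)) (\<iota> (s m)) - 2 * inner (\<iota> (s m)) (\<iota> (s n)) + inner (\<iota> (s n)) (\<iota> (s n)) < e"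
    "\<And>x. (\<lambda>n. inner (\<iota> (s n)) (\<iota> x)) \<longlonglongrightarrow> inner x k"
  proof (rule riesz_minimizing_sequence[where S="UNIV::'v set" and l="\<lambda>x. inner x k" and ip="\<lambda>x y. inner (\<iota> x) (\<iota> y)" and C=C])
    show "\<exists>z\<in>UNIV. inner z k = c * inner x k + d * inner y k \<and> (\<forall>u\<in>UNIV. inner (\<iota> z) (\<iota> u) = c * inner (\<iota> x) (\<iota> u) + d * inner (\<iota> y) (\<iota> u))" for x y c d
      by (rule bexI[of _ "c *\<^sub>R x + d *\<^sub>R y"]) (auto simp: add scaleR inner_add_left)
    show "\<bar>inner x k\<bar> \<le> C * sqrt (inner (\<iota> x) (\<iota> x))" for x
      using k[of x] by (simp add: norm_eq_sqrt_inner)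
  qed (auto simp: inner_commute)
  obtain h where v: "(\<lambda>n. \<iota> (s n)) \<longlonglongrightarrow> h"
    by (rule convergent_of_norm_sq_Cauchy[of "\<lambda>n. \<iota> (s n)"]) (use s(1) in \<open>auto simp: norm_diff_sq\<close>)
  have "inner x (istar h) = inner x k" for x
    using LIMSEQ_unique[OF s(2)[of x] tendsto_inner[OF v tendsto_const]] by (simp add: inner_commute istar_inner)
  then show ?thesis using vector_eq_ldot by blast
qed

text \<open>Riesz' theorem for the inner product (\<iota> u, \<iota> v) + \<epsilon> (u, v), which
  is equivalent to that of V because \<epsilon> is positive.\<close>

lemma resolvent_exists:
  assumes "\<epsilon> > 0"
  shows "\<exists>z. K z + \<epsilon> *\<^sub>R z = x"
proof -
  interpret bounded_linear \<iota> by (rule bl)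
  define ip where "ip u v = inner (\<iota> u) (\<iota> v) + \<epsilon> * inner u v" for u v
  obtain s where s: "\<And>e. e > 0 \<Longrightarrow> \<exists>N. \<forall>m\<ge>N. \<forall>n\<ge>N. ip (s m) (s m) - 2 * ip (s m) (s n) + ip (s n) (s n) < e"
    "\<And>y. (\<lambda>n. ip (s n) y) \<longlonglongrightarrow> inner y x"
  proof (rule riesz_minimizing_sequence[where S="UNIV::'v set" and l="\<lambda>y. inner y x" and ip=ip and C="norm x / sqrt \<epsilon>"])
    show "\<exists>z\<in>UNIV. inner z x = c * inner p x + d * inner y x \<and> (\<forall>u\<in>UNIV. ip z u = c * ip p u + d * ip y u)" for p y c d
      by (rule bexI[of _ "c *\<^sub>R p + d *\<^sub>R y"]) (auto simp: ip_def add scaleR inner_add_left algebra_simps)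
    show "\<bar>inner y x\<bar> \<le> norm x / sqrt \<epsilon> * sqrt (ip y y)" for y
    proof -
      have "\<bar>inner y x\<bar> \<le> norm x * norm y" using Cauchy_Schwarz_ineq2[of y x] by (simp add: mult.commute)
      also have "\<dots> = norm x / sqrt \<epsilon> * sqrt (\<epsilon> * inner y y)"
        using assms by (simp add: real_sqrt_mult norm_eq_sqrt_inner)
      also have "\<dots> \<le> norm x / sqrt \<epsilon> * sqrt (ip y y)"
        unfolding ip_def using assms by (intro mult_left_mono) auto
      finally show ?thesis .
    qed
    show "0 \<le> ip y y" for y unfolding ip_def using assms by simp
  qed (auto simp: ip_def inner_commute)
  obtain z where z: "s \<longlonglongrightarrow> z"
  proof (rule convergent_of_norm_sq_Cauchy[of s])
    fix e :: real assume "e > 0"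
    then obtain N where N: "\<forall>m\<ge>N. \<forall>n\<ge>N. ip (s m) (s m) - 2 * ip (s m) (s n) + ip (s n) (s n) < \<epsilon> * e"
      using s(1)[of "\<epsilon> * e"] assms by auto
    have "(norm (s m - s n))\<^sup>2 < e" if "m \<ge> N" "n \<ge> N" for m n
    proof -
      have "ip (s m) (s m) - 2 * ip (s m) (s n) + ip (s n) (s n)
        = (norm (\<iota> (s m) - \<iota> (s n)))\<^sup>2 + \<epsilon> * (norm (s m - s n))\<^sup>2"
        unfolding ip_def norm_diff_sq by (simp add: algebra_simps)
      then have "\<epsilon> * (norm (s m - s n))\<^sup>2 \<le> ip (s m) (s m) - 2 * ip (s m) (s n) + ip (s n) (s n)" by simp
      also have "\<dots> < \<epsilon> * e" using N that by blast
      finally show ?thesis using assms by simp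
    qed
    then show "\<exists>N. \<forall>m\<ge>N. \<forall>n\<ge>N. (norm (s m - s n))\<^sup>2 < e" by blast
  qed
  have "inner y (K z + \<epsilon> *\<^sub>R z) = inner y x" for y
  proof -
    have "(\<lambda>n. ip (s n) y) \<longlonglongrightarrow> inner (\<iota> z) (\<iota> y) + \<epsilon> * inner z y"
      unfolding ip_def by (intro tendsto_intros z tendsto)
    then show ?thesis using LIMSEQ_unique[OF s(2)[of y]]
      by (simp add: inner_add_right K_inner inner_commute)
  qed
  then show ?thesis using vector_eq_ldot by blast
qed

definition Jr :: "real \<Rightarrow> 'v \<Rightarrow> 'v" where
  "Jr \<epsilon> x = (SOME z. K z + \<epsilon> *\<^sub>R z = x)"

context
  fixes \<epsilon> :: real assumes eps: "\<epsilon> > 0"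
begin

lemma Jr: "K (Jr \<epsilon> x) + \<epsilon> *\<^sub>R Jr \<epsilon> x = x"
  unfolding Jr_def by (rule someI_ex[OF resolvent_exists[OF eps]])

lemma Jr_unique: assumes "K z + \<epsilon> *\<^sub>R z = x" shows "z = Jr \<epsilon> x"
proof -
  interpret bounded_linear K by (rule bl_K)
  define y where "y = z - Jr \<epsilon> x"
  have "K y + \<epsilon> *\<^sub>R y = (K z + \<epsilon> *\<^sub>R z) - (K (Jr \<epsilon> x) + \<epsilon> *\<^sub>R Jr \<epsilon> x)"
    unfolding y_def by (simp add: diff algebra_simps)
  then have "K y + \<epsilon> *\<^sub>R y = 0" using Jr[of x] assms by simp
  then have "inner (K y) y + \<epsilon> * inner y y = 0"
    by (metis inner_add_left inner_scaleR_left inner_zero_left)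
  moreover have "0 \<le> inner (K y) y" by (simp add: K_inner)
  moreover have "0 \<le> \<epsilon> * inner y y" using eps by simp
  ultimately have "\<epsilon> * inner y y = 0" by linarith
  then have "y = 0" using eps by simp
  then show ?thesis unfolding y_def by simp
qed

lemma Jr_energy: "inner x (Jr \<epsilon> x) = (norm (\<iota> (Jr \<epsilon> x)))\<^sup>2 + \<epsilon> * (norm (Jr \<epsilon> x))\<^sup>2"
proof -
  have "inner x (Jr \<epsilon> x) = inner (K (Jr \<epsilon> x) + \<epsilon> *\<^sub>R Jr \<epsilon> x) (Jr \<epsilon> x)" by (simp only: Jr)
  then show ?thesis by (simp add: inner_add_left K_inner power2_norm_eq_inner)
qed

lemma Jr_norm: "\<epsilon> * norm (Jr \<epsilon> x) \<le> norm x"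
proof (cases "Jr \<epsilon> x = 0")
  case False
  have "\<epsilon> * (norm (Jr \<epsilon> x))\<^sup>2 \<le> inner x (Jr \<epsilon> x)" by (simp add: Jr_energy)
  also have "\<dots> \<le> norm x * norm (Jr \<epsilon> x)" by (rule norm_cauchy_schwarz)
  finally have "(\<epsilon> * norm (Jr \<epsilon> x)) * norm (Jr \<epsilon> x) \<le> norm x * norm (Jr \<epsilon> x)"
    by (simp add: power2_eq_square mult.assoc)
  then show ?thesis using False by simp
qed simp

lemma bl_Jr: "bounded_linear (Jr \<epsilon>)"
proof -
  interpret bounded_linear K by (rule bl_K)
  show ?thesis
  proof (rule bounded_linear_intro[where K="1/\<epsilon>"])
    fix x y and r :: real
    show "Jr \<epsilon> (x + y) = Jr \<epsilon> x + Jr \<epsilon> y"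
      by (rule Jr_unique[symmetric]) (use Jr[of x] Jr[of y] in \<open>simp add: add algebra_simps\<close>)
    show "Jr \<epsilon> (r *\<^sub>R x) = r *\<^sub>R Jr \<epsilon> x"
      by (rule Jr_unique[symmetric]) (metis Jr scaleR scaleR_left_commute scaleR_right_distrib)
    show "norm (Jr \<epsilon> x) \<le> norm x * (1 / \<epsilon>)"
      using Jr_norm[of x] eps by (simp add: field_simps)
  qed
qed

lemma Jr_sym: "inner x (Jr \<epsilon> y) = inner (Jr \<epsilon> x) y"
proof -
  have "inner x (Jr \<epsilon> y) = inner (K (Jr \<epsilon> x) + \<epsilon> *\<^sub>R Jr \<epsilon> x) (Jr \<epsilon> y)" by (simp only: Jr)
  also have "\<dots> = inner (Jr \<epsilon> x) (K (Jr \<epsilon> y) + \<epsilon> *\<^sub>R Jr \<epsilon> y)"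
    by (simp add: inner_add_left inner_add_right K_inner)
  finally show ?thesis by (simp only: Jr)
qed

lemma Jr_K: "Jr \<epsilon> (K x) = x - \<epsilon> *\<^sub>R Jr \<epsilon> x"
proof -
  interpret bounded_linear K by (rule bl_K)
  have "K (x - \<epsilon> *\<^sub>R Jr \<epsilon> x) + \<epsilon> *\<^sub>R (x - \<epsilon> *\<^sub>R Jr \<epsilon> x)
    = K x + \<epsilon> *\<^sub>R x - \<epsilon> *\<^sub>R (K (Jr \<epsilon> x) + \<epsilon> *\<^sub>R Jr \<epsilon> x)"
    by (simp add: diff scaleR algebra_simps)
  then have "K (x - \<epsilon> *\<^sub>R Jr \<epsilon> x) + \<epsilon> *\<^sub>R (x - \<epsilon> *\<^sub>R Jr \<epsilon> x) = K x"
    by (simp only: Jr) simp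
  then show ?thesis using Jr_unique by metis
qed

text \<open>The operator 1 - \<epsilon> \<open>Jr \<epsilon>\<close> is a contraction because K is
  symmetric and nonnegative. This bound, uniform in \<epsilon>, supplies the integrable majorants
  when \<epsilon> tends to 0.\<close>

lemma Jr_K_norm: "norm (Jr \<epsilon> (K x)) \<le> norm x"
proof -
  have "(norm (Jr \<epsilon> (K x)))\<^sup>2 = (norm x)\<^sup>2 - 2 * \<epsilon> * inner x (Jr \<epsilon> x) + \<epsilon>\<^sup>2 * (norm (Jr \<epsilon> x))\<^sup>2"
    unfolding Jr_K norm_diff_sq by (simp add: power2_norm_eq_inner) (simp add: power2_eq_square)
  also have "\<dots> \<le> (norm x)\<^sup>2 - \<epsilon> * inner x (Jr \<epsilon> x)"
  proof -
    have "\<epsilon> * (\<epsilon> * (norm (Jr \<epsilon> x))\<^sup>2) \<le> \<epsilon> * inner x (Jr \<epsilon> x)"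
      using eps by (intro mult_left_mono) (simp_all add: Jr_energy)
    then show ?thesis by (simp add: power2_eq_square algebra_simps)
  qed
  also have "\<dots> \<le> (norm x)\<^sup>2"
    using eps by (simp add: Jr_energy)
  finally show ?thesis by (rule power2_le_imp_le) simp
qed

text \<open>Counterpart in H: with M the composition of \<open>istar\<close> and \<iota> as a map on
  H, the operator is M times the inverse of M + \<epsilon>, again a contraction.\<close>

lemma iota_Jr_istar_norm: "norm (\<iota> (Jr \<epsilon> (istar h))) \<le> norm h"
proof (cases "\<iota> (Jr \<epsilon> (istar h)) = 0")
  case False
  have "(norm (\<iota> (Jr \<epsilon> (istar h))))\<^sup>2 \<le> inner (istar h) (Jr \<epsilon> (istar h))"
    using eps by (simp add: Jr_energy)
  also have "\<dots> = inner (\<iota> (Jr \<epsilon> (istar h))) h" by (simp add: istar_inner)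
  also have "\<dots> \<le> norm (\<iota> (Jr \<epsilon> (istar h))) * norm h" by (rule norm_cauchy_schwarz)
  finally show ?thesis using False by (simp add: power2_eq_square)
qed simp

end

text \<open>A symmetric injective operator has dense range: the difference of x and the limit of its
  best approximations from the range is orthogonal to the range, hence in the kernel of K.\<close>

lemma K_dense:
  assumes "e > 0" shows "\<exists>y. norm (K y - x) < e"
proof -
  interpret bounded_linear K by (rule bl_K)
  obtain s where s: "\<And>e. e > 0 \<Longrightarrow> \<exists>N. \<forall>m\<ge>N. \<forall>n\<ge>N. inner (K (s m)) (K (s m)) - 2 * inner (K (s m)) (K (s n)) + inner (K (s n)) (K (s n)) < e"
    "\<And>y. (\<lambda>n. inner (K (s n)) (K y)) \<longlonglongrightarrow> inner x (K y)"
  proof (rule riesz_minimizing_sequence[where S="UNIV::'v set" and l="\<lambda>y. inner x (K y)" and ip="\<lambda>x y. inner (K x) (K y)" and C="norm x"])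
    show "\<exists>z\<in>UNIV. inner x (K z) = c * inner x (K p) + d * inner x (K y) \<and> (\<forall>u\<in>UNIV. inner (K z) (K u) = c * inner (K p) (K u) + d * inner (K y) (K u))" for p y c d
      by (rule bexI[of _ "c *\<^sub>R p + d *\<^sub>R y"]) (auto simp: add scaleR inner_add_left inner_add_right)
    show "\<bar>inner x (K y)\<bar> \<le> norm x * sqrt (inner (K y) (K y))" for y
      using Cauchy_Schwarz_ineq2[of x "K y"] by (simp add: norm_eq_sqrt_inner)
  qed (auto simp: inner_commute)
  obtain v where v: "(\<lambda>n. K (s n)) \<longlonglongrightarrow> v"
    by (rule convergent_of_norm_sq_Cauchy[of "\<lambda>n. K (s n)"]) (use s(1) in \<open>auto simp: norm_diff_sq\<close>)
  have "inner v (K y) = inner x (K y)" for y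
    using LIMSEQ_unique[OF s(2)[of y] tendsto_inner[OF v tendsto_const]] by simp
  then have "inner y (K (v - x)) = 0" for y by (simp add: diff inner_diff_right K_inner inner_commute)
      (metis K_inner(2) inner_commute)
  then have "K (v - x) = 0" using vector_eq_ldot inner_zero_right by metis
  then have "v = x" using K_inj0[of "v - x"] by simp
  then have "\<exists>N. norm (K (s N) - x) < e" using v \<open>e > 0\<close> unfolding LIMSEQ_iff by blast
  then show ?thesis by blast
qed

text \<open>On the range of K the quantity is at most \<epsilon> times a fixed norm by
  \<open>Jr_K_norm\<close>; density and the uniform bound \<open>Jr_norm\<close> carry the
  convergence over to every x.\<close>

lemma eps_Jr_tendsto:
  assumes e: "\<And>n. \<epsilon> n > 0" "\<epsilon> \<longlonglongrightarrow> 0"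
  shows "(\<lambda>n. \<epsilon> n *\<^sub>R Jr (\<epsilon> n) x) \<longlonglongrightarrow> 0"
proof (rule LIMSEQ_I)
  fix r :: real assume "r > 0"
  then obtain y where y: "norm (K y - x) < r/2" using K_dense[of "r/2" x] by auto
  \<comment> \<open>The constant makes the contribution of y at most r/4, the approximation error
    being below r/2; the summand 1 covers y = 0.\<close>
  have "\<exists>N. \<forall>n\<ge>N. norm (\<epsilon> n - 0) < r / (4 * (norm y + 1))"
    using \<open>r > 0\<close> by (intro LIMSEQ_D[OF e(2)] divide_pos_pos) (auto intro: add_nonneg_pos)
  then obtain N where N: "\<And>n. n \<ge> N \<Longrightarrow> norm (\<epsilon> n - 0) < r / (4 * (norm y + 1))" by blast
  have "norm (\<epsilon> n *\<^sub>R Jr (\<epsilon> n) x - 0) < r" if "n \<ge> N" for n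
  proof -
    interpret J: bounded_linear "Jr (\<epsilon> n)" by (rule bl_Jr[OF e(1)])
    have "\<epsilon> n *\<^sub>R Jr (\<epsilon> n) x = \<epsilon> n *\<^sub>R Jr (\<epsilon> n) (x - K y) + \<epsilon> n *\<^sub>R Jr (\<epsilon> n) (K y)"
      by (simp add: J.diff scaleR_diff_right)
    also have "norm \<dots> \<le> norm (x - K y) + \<epsilon> n * norm y"
    proof (rule norm_triangle_mono)
      show "norm (\<epsilon> n *\<^sub>R Jr (\<epsilon> n) (x - K y)) \<le> norm (x - K y)"
        using Jr_norm[OF e(1)] e(1)[of n] by simp
      show "norm (\<epsilon> n *\<^sub>R Jr (\<epsilon> n) (K y)) \<le> \<epsilon> n * norm y"
        using Jr_K_norm[OF e(1)[of n], of y] e(1)[of n] by (simp add: mult_left_mono)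
    qed
    also have "\<dots> < r"
    proof -
      have "\<epsilon> n * norm y \<le> r / (4 * (norm y + 1)) * norm y"
        using N[OF that] e(1)[of n] by (intro mult_right_mono) auto
      also have "\<dots> = r/4 * (norm y / (norm y + 1))" by (simp add: field_simps)
      also have "\<dots> \<le> r/4 * 1" using \<open>r > 0\<close>
        by (intro mult_left_mono) (auto simp: divide_le_eq_1 add_nonneg_pos)
      finally show ?thesis using y \<open>r > 0\<close> by (simp add: norm_minus_commute)
    qed
    finally show ?thesis by simp
  qed
  then show "\<exists>no. \<forall>n\<ge>no. norm (\<epsilon> n *\<^sub>R Jr (\<epsilon> n) x - 0) < r" by blast
qed

lemma Jr_K_tendsto:
  assumes e: "\<And>n. \<epsilon> n > 0" "\<epsilon> \<longlonglongrightarrow> 0"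
  shows "(\<lambda>n. Jr (\<epsilon> n) (K x)) \<longlonglongrightarrow> x"
  using tendsto_diff[OF tendsto_const[of x] eps_Jr_tendsto[OF e, of x]] by (simp add: Jr_K[OF e(1)])

text \<open>For h in the range of \<iota> this follows from \<open>Jr_K_tendsto\<close>; density of
  that range and the contraction property handle the rest.\<close>

lemma iota_Jr_istar_tendsto:
  assumes e: "\<And>n. \<epsilon> n > 0" "\<epsilon> \<longlonglongrightarrow> 0"
  shows "(\<lambda>n. \<iota> (Jr (\<epsilon> n) (istar h))) \<longlonglongrightarrow> h"
proof (rule LIMSEQ_I)
  fix r :: real assume "r > 0"
  then obtain v where v: "norm (\<iota> v - h) < r/3" using iota_approx[of "r/3" h] by auto
  have "(\<lambda>n. \<iota> (Jr (\<epsilon> n) (K v))) \<longlonglongrightarrow> \<iota> v"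
    by (rule bounded_linear.tendsto[OF bl Jr_K_tendsto[OF e]])
  then obtain N where N: "\<And>n. n \<ge> N \<Longrightarrow> norm (\<iota> (Jr (\<epsilon> n) (K v)) - \<iota> v) < r/3"
    using \<open>r > 0\<close> LIMSEQ_D[of _ "\<iota> v" "r/3"] by (meson divide_pos_pos zero_less_numeral)
  have "norm (\<iota> (Jr (\<epsilon> n) (istar h)) - h) < r" if "n \<ge> N" for n
  proof -
    interpret J: bounded_linear "Jr (\<epsilon> n)" by (rule bl_Jr[OF e(1)])
    interpret I: bounded_linear \<iota> by (rule bl)
    interpret S: bounded_linear istar by (rule bl_istar)
    have "\<iota> (Jr (\<epsilon> n) (istar h)) - h
      = \<iota> (Jr (\<epsilon> n) (istar (h - \<iota> v))) + (\<iota> (Jr (\<epsilon> n) (K v)) - \<iota> v) + (\<iota> v - h)"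
      unfolding K_def by (simp add: J.diff I.diff S.diff)
    also have "norm \<dots> \<le> norm (\<iota> (Jr (\<epsilon> n) (istar (h - \<iota> v)))) + norm (\<iota> (Jr (\<epsilon> n) (K v)) - \<iota> v) + norm (\<iota> v - h)"
      by (intro norm_triangle_mono order_refl)
    also have "\<dots> < r"
      using iota_Jr_istar_norm[OF e(1)[of n], of "h - \<iota> v"] N[OF that] v norm_minus_commute[of h "\<iota> v"] by linarith
    finally show ?thesis .
  qed
  then show "\<exists>no. \<forall>n\<ge>no. norm (\<iota> (Jr (\<epsilon> n) (istar h)) - h) < r" by blast
qed

end

section \<open>The space \<open>L\<^sup>2(0,T)\<close>\<close>

abbreviation MT :: "real \<Rightarrow> real measure" where "MT T \<equiv> lebesgue_on {0..T}"

lemma finite_measure_MT: "finite_measure (MT T)"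
  by (rule finite_measure_lebesgue_on) simp

lemma MT_const_integrable [simp]: "integrable (MT T) (\<lambda>_. c :: real)"
  by (rule finite_measure.integrable_const[OF finite_measure_MT])

lemma continuous_on_measurable_MT: "continuous_on {0..T} f \<Longrightarrow> f \<in> borel_measurable (MT T)"
  by (rule continuous_imp_measurable_on_sets_lebesgue) auto

lemma bounded_linear_measurable: "bounded_linear f \<Longrightarrow> f \<in> borel_measurable borel"
  by (intro borel_measurable_continuous_onI linear_continuous_on)

lemma L2sp_iff:
  "f \<in> L2sp T \<longleftrightarrow> f \<in> borel_measurable (MT T) \<and> integrable (MT T) (\<lambda>t. (norm (f t))\<^sup>2)"
proof -
  have "integrable (MT T) (\<lambda>t. (norm (f t))\<^sup>2) \<longleftrightarrow> (\<integral>\<^sup>+ t. ennreal ((norm (f t))\<^sup>2) \<partial>MT T) < \<infinity>"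
    if "f \<in> borel_measurable (MT T)"
    using that by (subst integrable_iff_bounded) auto
  then show ?thesis unfolding L2sp_def by auto
qed

lemma L2spD: "f \<in> L2sp T \<Longrightarrow> f \<in> borel_measurable (MT T)"
  "f \<in> L2sp T \<Longrightarrow> integrable (MT T) (\<lambda>t. (norm (f t))\<^sup>2)"
  by (auto simp: L2sp_iff)

lemma L2nrm_nonneg [simp]: "0 \<le> L2nrm T f"
  unfolding L2nrm_def by simp

lemma L2nrm_sq: "f \<in> L2sp T \<Longrightarrow> (L2nrm T f)\<^sup>2 = (\<integral>t. (norm (f t))\<^sup>2 \<partial>MT T)"
  unfolding L2nrm_def by (simp add: nn_integral_eq_integral L2spD(2) integral_nonneg_AE)

lemma L2sp_bound:
  fixes f :: "real \<Rightarrow> 'a::real_normed_vector"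
  assumes "f \<in> borel_measurable (MT T)" "integrable (MT T) g" "AE t in MT T. (norm (f t))\<^sup>2 \<le> g t"
  shows "f \<in> L2sp T"
  unfolding L2sp_iff
  by (intro conjI assms(1) Bochner_Integration.integrable_bound[OF assms(2)])
     (use assms in \<open>auto intro: order_trans[OF _ abs_ge_self]\<close>)

lemma L2sp_norm_mult:
  assumes "f \<in> L2sp T" "g \<in> L2sp T"
  shows "integrable (MT T) (\<lambda>t. norm (f t) * norm (g t))"
proof (rule Bochner_Integration.integrable_bound[where f="\<lambda>t. (norm (f t))\<^sup>2 + (norm (g t))\<^sup>2"])
  show "AE t in MT T. norm (norm (f t) * norm (g t)) \<le> norm ((norm (f t))\<^sup>2 + (norm (g t))\<^sup>2)"
  proof (rule AE_I2)
    fix t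
    have "0 \<le> (norm (f t) - norm (g t))\<^sup>2" by simp
    then have "2 * (norm (f t) * norm (g t)) \<le> (norm (f t))\<^sup>2 + (norm (g t))\<^sup>2"
      by (simp add: power2_diff)
    moreover have "0 \<le> norm (f t) * norm (g t)" by simp
    ultimately have "norm (f t) * norm (g t) \<le> (norm (f t))\<^sup>2 + (norm (g t))\<^sup>2" by linarith
    then show "norm (norm (f t) * norm (g t)) \<le> norm ((norm (f t))\<^sup>2 + (norm (g t))\<^sup>2)"
      by simp
  qed
qed (use assms in \<open>auto simp: L2sp_iff\<close>)

lemma L2sp_inner:
  fixes f g :: "real \<Rightarrow> 'a::{real_inner,second_countable_topology}"
  assumes "f \<in> L2sp T" "g \<in> L2sp T"
  shows "integrable (MT T) (\<lambda>t. inner (f t) (g t))"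
  by (rule Bochner_Integration.integrable_bound[OF L2sp_norm_mult[OF assms]])
     (use assms in \<open>auto simp: L2sp_iff Cauchy_Schwarz_ineq2\<close>)

lemma L2sp_const [simp]: "(\<lambda>_. c) \<in> L2sp T"
  by (simp add: L2sp_iff)

lemma L2sp_norm_integrable: "f \<in> L2sp T \<Longrightarrow> integrable (MT T) (\<lambda>t. norm (f t))"
  using L2sp_norm_mult[of f T "\<lambda>_. 1::real"] by simp

lemma L2sp_inner_const:
  fixes f :: "real \<Rightarrow> 'a::{real_inner,second_countable_topology}"
  shows "f \<in> L2sp T \<Longrightarrow> integrable (MT T) (\<lambda>t. inner (f t) c)"
  by (rule L2sp_inner) auto

lemma sq_sum_le: "(norm (x + y))\<^sup>2 \<le> 2 * (norm x)\<^sup>2 + 2 * (norm y)\<^sup>2" for x y :: "'a::real_normed_vector"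
proof -
  have "(norm (x + y))\<^sup>2 \<le> (norm x + norm y)\<^sup>2" by (intro power_mono norm_triangle_ineq) auto
  also have "\<dots> \<le> 2 * (norm x)\<^sup>2 + 2 * (norm y)\<^sup>2"
    using zero_le_power2[of "norm x - norm y"] by (simp add: power2_diff power2_sum)
  finally show ?thesis .
qed

lemma L2sp_add:
  fixes f g :: "real \<Rightarrow> 'a::{real_normed_vector,second_countable_topology}"
  assumes "f \<in> L2sp T" "g \<in> L2sp T"
  shows "(\<lambda>t. f t + g t) \<in> L2sp T"
  by (rule L2sp_bound[where g="\<lambda>t. 2 * (norm (f t))\<^sup>2 + 2 * (norm (g t))\<^sup>2"])
     (use assms in \<open>auto simp: L2sp_iff sq_sum_le\<close>)

lemma L2sp_bl:
  assumes "f \<in> L2sp T" "bounded_linear A"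
  shows "(\<lambda>t. A (f t)) \<in> L2sp T"
proof -
  interpret bounded_linear A by fact
  obtain C where C: "\<And>x. norm (A x) \<le> norm x * C" using bounded by blast
  have [measurable]: "f \<in> borel_measurable (MT T)" "A \<in> borel_measurable borel"
    using L2spD(1)[OF assms(1)] bounded_linear_measurable[OF assms(2)] by auto
  show ?thesis
  proof (rule L2sp_bound[where g="\<lambda>t. (norm (f t))\<^sup>2 * C\<^sup>2"])
    show "AE t in MT T. (norm (A (f t)))\<^sup>2 \<le> (norm (f t))\<^sup>2 * C\<^sup>2"
      by (intro AE_I2) (metis C norm_ge_zero power_mono power_mult_distrib)
  qed (use L2spD(2)[OF assms(1)] in auto)
qed

lemma L2sp_uminus: "f \<in> L2sp T \<Longrightarrow> (\<lambda>t. - f t) \<in> L2sp T"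
  for f :: "real \<Rightarrow> 'a::{real_normed_vector,second_countable_topology}"
  by (rule L2sp_bl[where A=uminus]) (auto intro: bounded_linear_minus bounded_linear_ident)

lemma L2sp_diff:
  fixes f g :: "real \<Rightarrow> 'a::{real_normed_vector,second_countable_topology}"
  shows "f \<in> L2sp T \<Longrightarrow> g \<in> L2sp T \<Longrightarrow> (\<lambda>t. f t - g t) \<in> L2sp T"
  using L2sp_add[OF _ L2sp_uminus, of f T g] by simp

lemma L2sp_scaleR:
  fixes f :: "real \<Rightarrow> 'a::{real_normed_vector,second_countable_topology}"
  shows "f \<in> L2sp T \<Longrightarrow> (\<lambda>t. c *\<^sub>R f t) \<in> L2sp T"
  by (rule L2sp_bl) (auto intro: bounded_linear_scaleR_right)

lemma L2sp_continuous:
  assumes "continuous_on {0..T} (f :: real \<Rightarrow> 'a::real_normed_vector)" shows "f \<in> L2sp T"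
proof -
  have "compact (f ` {0..T})" using assms by (intro compact_continuous_image) auto
  then obtain B where B: "\<And>t. t \<in> {0..T} \<Longrightarrow> norm (f t) \<le> B"
    using compact_imp_bounded[of "f ` {0..T}"] unfolding bounded_iff by blast
  show ?thesis
    by (rule L2sp_bound[where g="\<lambda>_. B\<^sup>2"])
       (auto intro!: continuous_on_measurable_MT assms AE_I2 power_mono B)
qed

lemma L2nrm_cong_AE: "AE t in MT T. norm (f t) = norm (g t) \<Longrightarrow> L2nrm T f = L2nrm T g"
  unfolding L2nrm_def by (intro arg_cong[where f=sqrt] arg_cong[where f=enn2real] nn_integral_cong_AE) auto

lemma L2nrm_sq_bound:
  assumes "f \<in> L2sp T" "g \<in> L2sp T" "\<And>t. norm (g t) \<le> C * norm (f t)"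
  shows "(L2nrm T g)\<^sup>2 \<le> C\<^sup>2 * (L2nrm T f)\<^sup>2"
proof -
  have "(\<integral>t. (norm (g t))\<^sup>2 \<partial>MT T) \<le> (\<integral>t. C\<^sup>2 * (norm (f t))\<^sup>2 \<partial>MT T)"
  proof (rule integral_mono)
    show "(norm (g t))\<^sup>2 \<le> C\<^sup>2 * (norm (f t))\<^sup>2" for t
      using power_mono[OF assms(3)[of t], of 2] by (simp add: power_mult_distrib)
  qed (use assms in \<open>auto simp: L2sp_iff\<close>)
  then show ?thesis using assms by (simp add: L2nrm_sq)
qed

text \<open>The discriminant argument, applied to the nonnegative integral of (x |f| -
  |g|)^2.\<close>

lemma L2_norm_mult_le:
  fixes f :: "real \<Rightarrow> 'a::real_normed_vector" and g :: "real \<Rightarrow> 'b::real_normed_vector"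
  assumes f: "f \<in> L2sp T" and g: "g \<in> L2sp T"
  shows "(\<integral>t. norm (f t) * norm (g t) \<partial>MT T) \<le> L2nrm T f * L2nrm T g"
proof -
  let ?P = "\<integral>t. norm (f t) * norm (g t) \<partial>MT T"
  let ?A = "(L2nrm T f)\<^sup>2" and ?B = "(L2nrm T g)\<^sup>2"
  have quad: "0 \<le> x\<^sup>2 * ?A - 2 * x * ?P + ?B" for x
  proof -
    have "(\<integral>t. (x * norm (f t) - norm (g t))\<^sup>2 \<partial>MT T)
      = (\<integral>t. x\<^sup>2 * (norm (f t))\<^sup>2 - (2 * x) * (norm (f t) * norm (g t)) + (norm (g t))\<^sup>2 \<partial>MT T)"
      by (intro Bochner_Integration.integral_cong refl) (simp add: power2_diff power_mult_distrib)
    also have "\<dots> = x\<^sup>2 * ?A - 2 * x * ?P + ?B"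
      using L2spD(2)[OF f] L2spD(2)[OF g] L2sp_norm_mult[OF f g]
      by (simp add: L2nrm_sq[OF f] L2nrm_sq[OF g])
    finally have "(\<integral>t. (x * norm (f t) - norm (g t))\<^sup>2 \<partial>MT T) = x\<^sup>2 * ?A - 2 * x * ?P + ?B" .
    moreover have "0 \<le> (\<integral>t. (x * norm (f t) - norm (g t))\<^sup>2 \<partial>MT T)"
      by (rule integral_nonneg_AE) simp
    ultimately show ?thesis by simp
  qed
  have "?P\<^sup>2 \<le> ?A * ?B"
  proof (cases "?A = 0")
    case True
    have "?P = 0"
    proof (rule ccontr)
      assume "?P \<noteq> 0"
      \<comment> \<open>With \<open>?A = 0\<close> the quadratic is affine in x, and at this x it
        would equal -1.\<close>
      then have "2 * ((?B + 1) / (2 * ?P)) * ?P = ?B + 1" by simp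
      then show False using quad[of "(?B + 1) / (2 * ?P)"] unfolding True by simp
    qed
    then show ?thesis by simp
  next
    case False
    then have A: "?A > 0" by (simp add: le_less)
    have "0 \<le> (?P / ?A)\<^sup>2 * ?A - 2 * (?P / ?A) * ?P + ?B" by (rule quad)
    also have "\<dots> = ?B - ?P\<^sup>2 / ?A" using False by (simp add: field_simps power2_eq_square)
    finally show ?thesis using A by (simp add: field_simps)
  qed
  then have "?P\<^sup>2 \<le> (L2nrm T f * L2nrm T g)\<^sup>2" by (simp add: power_mult_distrib)
  then show ?thesis by (rule power2_le_imp_le) simp
qed

lemma L2_inner_le:
  fixes f g :: "real \<Rightarrow> 'a::{real_inner,second_countable_topology}"
  assumes f: "f \<in> L2sp T" and g: "g \<in> L2sp T"
  shows "\<bar>\<integral>t. inner (f t) (g t) \<partial>MT T\<bar> \<le> L2nrm T f * L2nrm T g"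
proof -
  have "norm (\<integral>t. inner (f t) (g t) \<partial>MT T) \<le> (\<integral>t. norm (inner (f t) (g t)) \<partial>MT T)"
    by (rule integral_norm_bound)
  also have "\<dots> \<le> (\<integral>t. norm (f t) * norm (g t) \<partial>MT T)"
    by (rule integral_mono) (use L2sp_inner[OF f g] L2sp_norm_mult[OF f g] in \<open>auto simp: Cauchy_Schwarz_ineq2\<close>)
  also have "\<dots> \<le> L2nrm T f * L2nrm T g" by (rule L2_norm_mult_le[OF f g])
  finally show ?thesis by simp
qed

lemma L2_norm_integral_le:
  assumes "f \<in> L2sp T" "0 \<le> T"
  shows "(\<integral>t. norm (f t) \<partial>MT T) \<le> L2nrm T f * sqrt T"
proof -
  have "(L2nrm T (\<lambda>_. 1::real))\<^sup>2 = T"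
    using assms(2) by (simp add: L2nrm_sq measure_restrict_space)
  then have "L2nrm T (\<lambda>_. 1::real) = sqrt T" by (metis L2nrm_nonneg real_sqrt_unique)
  then show ?thesis using L2_norm_mult_le[OF assms(1), of "\<lambda>_. 1::real"] by simp
qed

text \<open>The series of increments has finite integral, because [0,T] has finite measure and the
  L^2 bounds are geometric; so it converges absolutely almost everywhere.\<close>

lemma AE_bounded_sums_Cauchy:
  fixes s :: "nat \<Rightarrow> real \<Rightarrow> 'a::{real_normed_vector,complete_space,second_countable_topology}"
  assumes s: "\<And>n. s n \<in> L2sp T" and T: "0 \<le> T"
    and close: "\<And>n. L2nrm T (\<lambda>t. s (Suc n) t - s n t) \<le> (1/2)^n"
  shows "AE t in MT T. convergent (\<lambda>n. s n t)"
proof -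
  let ?d = "\<lambda>n t. norm (s (Suc n) t - s n t)"
  have L2: "(\<lambda>t. s (Suc n) t - s n t) \<in> L2sp T" for n by (intro L2sp_diff s)
  have [measurable]: "s n \<in> borel_measurable (MT T)" for n by (rule L2spD(1)[OF s])
  have bnd: "(\<integral>\<^sup>+ t. ennreal (?d n t) \<partial>MT T) \<le> ennreal ((1/2)^n * sqrt T)" for n
  proof -
    have "(\<integral>\<^sup>+ t. ennreal (?d n t) \<partial>MT T) = ennreal (\<integral>t. ?d n t \<partial>MT T)"
      by (rule nn_integral_eq_integral[OF L2sp_norm_integrable[OF L2]]) auto
    also have "\<dots> \<le> ennreal ((1/2)^n * sqrt T)"
      by (intro ennreal_leI order_trans[OF L2_norm_integral_le[OF L2 T]] mult_right_mono close) (use T in auto)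
    finally show ?thesis .
  qed
  have "(\<integral>\<^sup>+ t. (\<Sum>n. ennreal (?d n t)) \<partial>MT T) = (\<Sum>n. \<integral>\<^sup>+ t. ennreal (?d n t) \<partial>MT T)"
    by (rule nn_integral_suminf) auto
  also have "\<dots> \<le> (\<Sum>n. ennreal ((1/2)^n * sqrt T))"
    by (intro suminf_le bnd) auto
  also have "\<dots> < \<infinity>"
  proof -
    have "summable (\<lambda>n. (1/2)^n * sqrt T)" by (intro summable_mult2 summable_geometric) auto
    then show ?thesis using T by (simp add: suminf_ennreal2 ennreal_less_top)
  qed
  finally have "AE t in MT T. (\<Sum>n. ennreal (?d n t)) \<noteq> \<infinity>"
    by (intro nn_integral_PInf_AE) auto
  then show ?thesis
  proof eventually_elim
    case (elim t)
    then have sm: "summable (\<lambda>n. ?d n t)"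
      by (intro summable_suminf_not_top) auto
    have "Cauchy (\<lambda>n. s n t)"
    proof (rule CauchyI')
      fix e :: real assume "e > 0"
      then obtain N where N: "\<And>m n. m \<ge> N \<Longrightarrow> norm (sum (\<lambda>n. ?d n t) {m..<n}) < e"
        using sm unfolding summable_Cauchy by blast
      have "norm (s m t - s n t) < e" if "m \<ge> N" "n > m" for m n
      proof -
        have "s n t - s m t = (\<Sum>k=m..<n. s (Suc k) t - s k t)"
          using that sum_Suc_diff'[of m n "\<lambda>k. s k t"] by simp
        then have "norm (s n t - s m t) \<le> sum (\<lambda>n. ?d n t) {m..<n}" by (simp add: sum_norm_le)
        also have "\<dots> < e" using N[OF that(1), of n] by simp
        finally show ?thesis by (simp add: norm_minus_commute)
      qed
      then show "\<exists>M. \<forall>m\<ge>M. \<forall>n>m. dist (s m t) (s n t) < e" unfolding dist_norm by blast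
    qed
    then show ?case by (rule Cauchy_convergent)
  qed
qed

text \<open>Riesz-Fischer: a rapidly converging subsequence converges almost everywhere, and Fatou's
  lemma turns this into convergence of the whole sequence in mean square.\<close>

lemma L2sp_complete:
  fixes s :: "nat \<Rightarrow> real \<Rightarrow> 'a::{real_normed_vector,complete_space,second_countable_topology}"
  assumes s: "\<And>n. s n \<in> L2sp T" and T: "0 \<le> T"
    and C: "\<And>e. e > 0 \<Longrightarrow> \<exists>N. \<forall>m\<ge>N. \<forall>n\<ge>N. (L2nrm T (\<lambda>t. s m t - s n t))\<^sup>2 < e"
  obtains f where "f \<in> L2sp T" "(\<lambda>n. (L2nrm T (\<lambda>t. s n t - f t))\<^sup>2) \<longlonglongrightarrow> 0"
proof -
  have [measurable]: "s n \<in> borel_measurable (MT T)" for n by (rule L2spD(1)[OF s])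
  \<comment> \<open>Strictly increasing indices beyond which the tail has diameter below
    2^(-n).\<close>
  have "\<exists>r::nat\<Rightarrow>nat. \<forall>n. (\<forall>i\<ge>r n. \<forall>j\<ge>r n. (L2nrm T (\<lambda>t. s i t - s j t))\<^sup>2 < ((1/2)^n)\<^sup>2) \<and> r n < r (Suc n)"
  proof (rule dependent_nat_choice)
    show "\<exists>x. \<forall>i\<ge>x. \<forall>j\<ge>x. (L2nrm T (\<lambda>t. s i t - s j t))\<^sup>2 < ((1/2)^0)\<^sup>2"
      using C[of 1] by simp
    fix x n
    obtain N where N: "\<forall>m\<ge>N. \<forall>k\<ge>N. (L2nrm T (\<lambda>t. s m t - s k t))\<^sup>2 < ((1/2)^Suc n)\<^sup>2"
      using C[of "((1/2)^Suc n)\<^sup>2"] by auto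
    then show "\<exists>y. (\<forall>i\<ge>y. \<forall>j\<ge>y. (L2nrm T (\<lambda>t. s i t - s j t))\<^sup>2 < ((1/2)^Suc n)\<^sup>2) \<and> x < y"
      by (intro exI[of _ "max N (Suc x)"]) auto
  qed
  then obtain r where r: "\<And>n i j. i \<ge> r n \<Longrightarrow> j \<ge> r n \<Longrightarrow> (L2nrm T (\<lambda>t. s i t - s j t))\<^sup>2 < ((1/2)^n)\<^sup>2"
    and rS: "\<And>n. r n < r (Suc n)" by blast
  have mono: "strict_mono r" using rS by (simp add: strict_mono_Suc_iff)
  have "L2nrm T (\<lambda>t. s (r (Suc n)) t - s (r n) t) \<le> (1/2)^n" for n
  proof (rule power2_le_imp_le)
    show "(L2nrm T (\<lambda>t. s (r (Suc n)) t - s (r n) t))\<^sup>2 \<le> ((1/2)^n)\<^sup>2"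
      by (rule less_imp_le[OF r[OF less_imp_le[OF rS] order_refl]])
  qed simp
  then have AE: "AE t in MT T. convergent (\<lambda>n. s (r n) t)"
    by (intro AE_bounded_sums_Cauchy s T)
  obtain N where N: "{t \<in> space (MT T). \<not> convergent (\<lambda>n. s (r n) t)} \<subseteq> N" "N \<in> null_sets (MT T)"
    using AE by (auto elim!: AE_E simp: null_setsI)
  have [measurable]: "N \<in> sets (MT T)" using N(2) by auto
  \<comment> \<open>Setting the subsequence to 0 on the exceptional null set makes it converge
    everywhere, so that \<open>f\<close> is measurable as a pointwise limit.\<close>
  define g where "g n t = (if t \<in> {0..T} - N then s (r n) t else 0)" for n t
  define f where "f t = lim (\<lambda>n. g n t)" for t
  have conv: "(\<lambda>n. g n t) \<longlonglongrightarrow> f t" for t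
  proof -
    have "convergent (\<lambda>n. g n t)"
      using N(1) unfolding g_def by (cases "t \<in> {0..T} - N") (auto simp: convergent_const)
    then show ?thesis unfolding f_def by (simp add: convergent_LIMSEQ_iff)
  qed
  have eqg: "AE t in MT T. \<forall>n. s (r n) t = g n t"
    using AE_not_in[OF N(2)] AE_space by eventually_elim (simp add: g_def)
  have [measurable]: "g n \<in> borel_measurable (MT T)" for n
  proof (subst measurable_cong)
    show "g n t = (if t \<in> N then 0 else s (r n) t)" if "t \<in> space (MT T)" for t
      using that by (simp add: g_def)
  qed measurable
  have [measurable]: "f \<in> borel_measurable (MT T)"
    by (rule borel_measurable_LIMSEQ_metric[where f=g]) (auto intro: conv)
  \<comment> \<open>Fatou's lemma with \<open>s m\<close> fixed; only the second index runs along
    the subsequence.\<close>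
  have key: "(\<integral>\<^sup>+ t. ennreal ((norm (s m t - f t))\<^sup>2) \<partial>MT T) \<le> ennreal e"
    if e: "e > 0" and N: "\<And>m n. m \<ge> N \<Longrightarrow> n \<ge> N \<Longrightarrow> (L2nrm T (\<lambda>t. s m t - s n t))\<^sup>2 < e" and m: "m \<ge> N" for e N m
  proof -
    have "(\<integral>\<^sup>+ t. ennreal ((norm (s m t - f t))\<^sup>2) \<partial>MT T)
      = (\<integral>\<^sup>+ t. liminf (\<lambda>n. ennreal ((norm (s m t - g n t))\<^sup>2)) \<partial>MT T)"
    proof (intro nn_integral_cong)
      fix t
      have "(\<lambda>n. ennreal ((norm (s m t - g n t))\<^sup>2)) \<longlonglongrightarrow> ennreal ((norm (s m t - f t))\<^sup>2)"
        by (intro tendsto_ennrealI tendsto_intros conv)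
      then show "ennreal ((norm (s m t - f t))\<^sup>2) = liminf (\<lambda>n. ennreal ((norm (s m t - g n t))\<^sup>2))"
        by (rule lim_imp_Liminf[OF trivial_limit_sequentially, symmetric])
    qed
    also have "\<dots> \<le> liminf (\<lambda>n. \<integral>\<^sup>+ t. ennreal ((norm (s m t - g n t))\<^sup>2) \<partial>MT T)"
      by (rule nn_integral_liminf) auto
    also have "\<dots> \<le> ennreal e"
    proof -
      have "\<forall>\<^sub>F n in sequentially. (\<integral>\<^sup>+ t. ennreal ((norm (s m t - g n t))\<^sup>2) \<partial>MT T) \<le> ennreal e"
        unfolding eventually_sequentially
      proof (intro exI[of _ N] allI impI)
        fix n assume "n \<ge> N"
        then have "r n \<ge> N" using mono by (meson le_trans seq_suble)
        have "(\<integral>\<^sup>+ t. ennreal ((norm (s m t - g n t))\<^sup>2) \<partial>MT T) = (\<integral>\<^sup>+ t. ennreal ((norm (s m t - s (r n) t))\<^sup>2) \<partial>MT T)"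
          by (rule nn_integral_cong_AE) (use eqg in auto)
        also have "\<dots> = ennreal ((L2nrm T (\<lambda>t. s m t - s (r n) t))\<^sup>2)"
          by (simp add: L2nrm_sq L2sp_diff s nn_integral_eq_integral L2spD(2)[OF L2sp_diff[OF s s]])
        also have "\<dots> \<le> ennreal e" using N[OF m \<open>r n \<ge> N\<close>] by (intro ennreal_leI) auto
        finally show "(\<integral>\<^sup>+ t. ennreal ((norm (s m t - g n t))\<^sup>2) \<partial>MT T) \<le> ennreal e" .
      qed
      then have "liminf (\<lambda>n. \<integral>\<^sup>+ t. ennreal ((norm (s m t - g n t))\<^sup>2) \<partial>MT T) \<le> liminf (\<lambda>n. ennreal e)"
        by (rule Liminf_mono)
      then show ?thesis by (simp add: Liminf_const)
    qed
    finally show ?thesis .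
  qed
  obtain N0 where N0: "\<And>m n. m \<ge> N0 \<Longrightarrow> n \<ge> N0 \<Longrightarrow> (L2nrm T (\<lambda>t. s m t - s n t))\<^sup>2 < 1" using C[of 1] by auto
  \<comment> \<open>The case e = 1 puts s N0 - f into L^2, hence also f.\<close>
  have "(\<integral>\<^sup>+ t. ennreal ((norm (s N0 t - f t))\<^sup>2) \<partial>MT T) \<le> ennreal 1"
    by (rule key[OF _ N0]) auto
  then have "(\<lambda>t. s N0 t - f t) \<in> L2sp T" unfolding L2sp_def by (auto intro: le_less_trans)
  then have fL2: "f \<in> L2sp T" using L2sp_diff[OF s[of N0]] by force
  have "(\<lambda>n. (L2nrm T (\<lambda>t. s n t - f t))\<^sup>2) \<longlonglongrightarrow> 0"
  proof (rule LIMSEQ_I)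
    fix e :: real assume "e > 0"
    then obtain N where N: "\<And>m n. m \<ge> N \<Longrightarrow> n \<ge> N \<Longrightarrow> (L2nrm T (\<lambda>t. s m t - s n t))\<^sup>2 < e/2" using C[of "e/2"] by auto
    have "(L2nrm T (\<lambda>t. s n t - f t))\<^sup>2 \<le> e/2" if "n \<ge> N" for n
    proof -
      have "ennreal ((L2nrm T (\<lambda>t. s n t - f t))\<^sup>2) = (\<integral>\<^sup>+ t. ennreal ((norm (s n t - f t))\<^sup>2) \<partial>MT T)"
        by (simp add: L2nrm_sq L2sp_diff s fL2 nn_integral_eq_integral L2spD(2)[OF L2sp_diff[OF s fL2]])
      also have "\<dots> \<le> ennreal (e/2)" by (rule key[OF _ N that]) (use \<open>e > 0\<close> in auto)
      finally show ?thesis using \<open>e > 0\<close> by (simp add: ennreal_le_iff)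
    qed
    moreover have "e/2 < e" using \<open>e > 0\<close> by simp
    ultimately have "(L2nrm T (\<lambda>t. s n t - f t))\<^sup>2 < e" if "n \<ge> N" for n
      using that le_less_trans by blast
    then show "\<exists>no. \<forall>n\<ge>no. norm ((L2nrm T (\<lambda>t. s n t - f t))\<^sup>2 - 0) < e"
      by (intro exI[of _ N]) auto
  qed
  with fL2 show ?thesis by (rule that)
qed

lemma L2_inner_tendsto:
  fixes s :: "nat \<Rightarrow> real \<Rightarrow> 'a::{real_inner,second_countable_topology}"
  assumes s: "\<And>n. s n \<in> L2sp T" and f: "f \<in> L2sp T" and g: "g \<in> L2sp T"
    and lim: "(\<lambda>n. (L2nrm T (\<lambda>t. s n t - f t))\<^sup>2) \<longlonglongrightarrow> 0"
  shows "(\<lambda>n. \<integral>t. inner (s n t) (g t) \<partial>MT T) \<longlonglongrightarrow> (\<integral>t. inner (f t) (g t) \<partial>MT T)"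
proof -
  have l: "(\<lambda>n. L2nrm T (\<lambda>t. s n t - f t) * L2nrm T g) \<longlonglongrightarrow> 0"
    using tendsto_real_sqrt[OF lim] by (auto intro!: tendsto_mult_left_zero)
  have "(\<lambda>n. (\<integral>t. inner (s n t) (g t) \<partial>MT T) - (\<integral>t. inner (f t) (g t) \<partial>MT T)) \<longlonglongrightarrow> 0"
  proof (rule Lim_null_comparison[OF _ l], rule always_eventually, rule allI)
    fix n
    have "(\<integral>t. inner (s n t) (g t) \<partial>MT T) - (\<integral>t. inner (f t) (g t) \<partial>MT T)
      = (\<integral>t. inner (s n t - f t) (g t) \<partial>MT T)"
      by (simp add: inner_diff_left L2sp_inner s f g)
    then show "norm ((\<integral>t. inner (s n t) (g t) \<partial>MT T) - (\<integral>t. inner (f t) (g t) \<partial>MT T)) \<le> L2nrm T (\<lambda>t. s n t - f t) * L2nrm T g"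
      using L2_inner_le[OF L2sp_diff[OF s f] g] by simp
  qed
  then show ?thesis by (simp add: LIM_zero_iff)
qed

section \<open>Weak primitives and the product rule\<close>

text \<open>Half-open intervals split without overlap at an interior point, and they generate the
  Borel sets in \<open>AE_zero_of_Iint_zero\<close>.\<close>

definition Iint :: "real \<Rightarrow> (real \<Rightarrow> real) \<Rightarrow> real \<Rightarrow> real \<Rightarrow> real" where
  "Iint T f s t = (\<integral>r. indicator {s<..t} r * f r \<partial>MT T)"

lemma Ioc_sets_MT: "0 \<le> s \<Longrightarrow> t \<le> T \<Longrightarrow> {s<..t} \<in> sets (MT T)"
  by (auto simp: sets_restrict_space_iff)

lemma Ioc_integrable:
  "integrable (MT T) f \<Longrightarrow> 0 \<le> s \<Longrightarrow> t \<le> T \<Longrightarrow> integrable (MT T) (\<lambda>r. indicator {s<..t} r * (f r :: real))"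
  using integrable_mult_indicator[OF Ioc_sets_MT, of s t T f] by simp

lemma AE_MT_neq: "AE r in MT T. r \<noteq> c"
  by (subst AE_restrict_space_iff) (auto intro!: AE_I'[of "{c}"])

lemma Iint_cong_AE:
  assumes "AE r in MT T. s < r \<and> r \<le> t \<longrightarrow> f r = g r" "f \<in> borel_measurable (MT T)" "g \<in> borel_measurable (MT T)"
    "0 \<le> s" "t \<le> T"
  shows "Iint T f s t = Iint T g s t"
proof -
  note [measurable] = Ioc_sets_MT[OF assms(4,5)] assms(2,3)
  show ?thesis unfolding Iint_def
  proof (rule integral_cong_AE)
    show "AE r in MT T. indicat_real {s<..t} r * f r = indicat_real {s<..t} r * g r"
      using assms(1) by eventually_elim (auto simp: indicator_def)
  qed measurable
qed

lemma Iint_add: "integrable (MT T) f \<Longrightarrow> integrable (MT T) g \<Longrightarrow> 0 \<le> s \<Longrightarrow> t \<le> T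
   \<Longrightarrow> Iint T (\<lambda>r. f r + g r) s t = Iint T f s t + Iint T g s t"
  unfolding Iint_def by (simp add: distrib_left Ioc_integrable)

lemma Iint_diff: "integrable (MT T) f \<Longrightarrow> integrable (MT T) g \<Longrightarrow> 0 \<le> s \<Longrightarrow> t \<le> T
   \<Longrightarrow> Iint T (\<lambda>r. f r - g r) s t = Iint T f s t - Iint T g s t"
  unfolding Iint_def by (simp add: right_diff_distrib Ioc_integrable)

lemma Iint_cmult: "Iint T (\<lambda>r. c * f r) s t = c * Iint T f s t"
  unfolding Iint_def by (simp add: mult.left_commute)

lemma Iint_multc: "Iint T (\<lambda>r. f r * c) s t = Iint T f s t * c"
  using Iint_cmult[of T c f s t] by (simp add: mult.commute)

lemma Iint_mono: "integrable (MT T) f \<Longrightarrow> integrable (MT T) g \<Longrightarrow> 0 \<le> s \<Longrightarrow> t \<le> T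
   \<Longrightarrow> AE r in MT T. s < r \<and> r \<le> t \<longrightarrow> f r \<le> g r \<Longrightarrow> Iint T f s t \<le> Iint T g s t"
  unfolding Iint_def
  by (rule integral_mono_AE) (auto simp: Ioc_integrable elim!: eventually_mono split: split_indicator)

lemma Iint_nonneg: "(\<And>r. 0 \<le> f r) \<Longrightarrow> 0 \<le> Iint T f s t"
  unfolding Iint_def by (intro integral_nonneg_AE) auto

lemma Iint_abs: "\<bar>Iint T f s t\<bar> \<le> Iint T (\<lambda>r. \<bar>f r\<bar>) s t"
proof -
  have "norm (Iint T f s t) \<le> (\<integral>r. norm (indicator {s<..t} r * f r) \<partial>MT T)"
    unfolding Iint_def by (rule integral_norm_bound)
  also have "\<dots> = Iint T (\<lambda>r. \<bar>f r\<bar>) s t"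
    unfolding Iint_def by (intro Bochner_Integration.integral_cong refl) (simp add: abs_mult)
  finally show ?thesis by simp
qed

lemma Iint_split:
  assumes "integrable (MT T) f" "0 \<le> s" "s \<le> t" "t \<le> u" "u \<le> T"
  shows "Iint T f s u = Iint T f s t + Iint T f t u"
proof -
  have "Iint T f s u = (\<integral>r. indicator {s<..t} r * f r + indicator {t<..u} r * f r \<partial>MT T)"
    unfolding Iint_def by (intro Bochner_Integration.integral_cong refl) (use assms in \<open>auto simp: indicator_def\<close>)
  also have "\<dots> = Iint T f s t + Iint T f t u"
    unfolding Iint_def by (intro Bochner_Integration.integral_add Ioc_integrable) (use assms in auto)
  finally show ?thesis .
qed

lemma Iint_refl [simp]: "Iint T f s s = 0"
  unfolding Iint_def by simp

lemma Iint_full: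
  assumes "integrable (MT T) f" "0 \<le> T" shows "Iint T f 0 T = (\<integral>r. f r \<partial>MT T)"
  unfolding Iint_def
proof (rule integral_cong_AE)
  show "AE r in MT T. indicat_real {0<..T} r * f r = f r"
    using AE_MT_neq[of 0 T] AE_space by eventually_elim auto
qed (use assms Ioc_integrable[of T f 0 T] in auto)

lemma Iint_le_full:
  assumes "integrable (MT T) f" "\<And>r. 0 \<le> f r" "0 \<le> s" "t \<le> T"
  shows "Iint T f s t \<le> (\<integral>r. f r \<partial>MT T)"
  unfolding Iint_def by (rule integral_mono) (use assms in \<open>auto simp: Ioc_integrable split: split_indicator\<close>)

lemma Iint_continuous:
  assumes f: "integrable (MT T) f"
  shows "continuous_on {0..T} (\<lambda>t. Iint T f 0 t)"
  unfolding continuous_on_sequentially comp_def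
proof (intro allI impI ballI, elim conjE)
  fix x :: "nat \<Rightarrow> real" and a assume a: "a \<in> {0..T}" and x: "\<forall>n. x n \<in> {0..T}" "x \<longlonglongrightarrow> a"
  show "(\<lambda>n. Iint T f 0 (x n)) \<longlonglongrightarrow> Iint T f 0 a"
    unfolding Iint_def
  proof (rule integral_dominated_convergence[where w="\<lambda>r. norm (f r)"])
    show "AE r in MT T. (\<lambda>n. indicat_real {0<..x n} r * f r) \<longlonglongrightarrow> indicat_real {0<..a} r * f r"
      using AE_MT_neq[of a T]
    proof eventually_elim
      case (elim r)
      have "\<forall>\<^sub>F n in sequentially. indicat_real {0<..x n} r = indicat_real {0<..a} r"
      proof (cases "r < a")
        case True
        then show ?thesis by (intro eventually_mono[OF order_tendstoD(1)[OF x(2) True]]) (auto simp: indicator_def)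
      next
        case False
        then have "a < r" using elim by simp
        then show ?thesis
          by (intro eventually_mono[OF order_tendstoD(2)[OF x(2) \<open>a < r\<close>]]) (auto simp: indicator_def)
      qed
      then show ?case by (intro tendsto_eventually) (auto elim: eventually_mono)
    qed
    show "AE r in MT T. norm (indicat_real {0<..x n} r * f r) \<le> norm (f r)" for n
      by (rule AE_I2) (auto simp: indicator_def)
    show "(\<lambda>r. indicat_real {0<..x n} r * f r) \<in> borel_measurable (MT T)" for n
      using Ioc_integrable[OF f, of 0 "x n"] x(1) by auto
    show "(\<lambda>r. indicat_real {0<..a} r * f r) \<in> borel_measurable (MT T)"
      using Ioc_integrable[OF f, of 0 a] a by auto
  qed (use f in auto)
qed

text \<open>Types of class \<open>{real_inner, complete_space}\<close> need not be of class \<open>banach\<close>, so Bochner integrals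
  of vector-valued functions are unavailable; primitives are therefore taken in the weak sense.\<close>

definition prim :: "real \<Rightarrow> (real \<Rightarrow> 'a::real_inner) \<Rightarrow> (real \<Rightarrow> 'a) \<Rightarrow> bool" where
  "prim T k g \<longleftrightarrow> g \<in> borel_measurable (MT T) \<and> integrable (MT T) (\<lambda>r. norm (g r)) \<and>
     (\<forall>t\<in>{0..T}. \<forall>v. inner (k t) v = inner (k 0) v + Iint T (\<lambda>r. inner (g r) v) 0 t)"

lemma integrable_inner_const:
  fixes g :: "real \<Rightarrow> 'a::{real_inner,second_countable_topology}"
  assumes [measurable]: "g \<in> borel_measurable M" and i: "integrable M (\<lambda>r. norm (g r))"
  shows "integrable M (\<lambda>r. inner (g r) v)"
proof (rule Bochner_Integration.integrable_bound[OF integrable_mult_right[OF i, of "norm v"]])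
  show "AE x in M. norm (inner (g x) v) \<le> norm (norm v * norm (g x))"
    by (rule AE_I2) (simp add: Cauchy_Schwarz_ineq2 mult.commute[of "norm v"])
qed simp

lemma prim_diff:
  fixes g :: "real \<Rightarrow> 'a::{real_inner,second_countable_topology}"
  assumes p: "prim T k g" and "0 \<le> s" "s \<le> t" "t \<le> T"
  shows "inner (k t) v - inner (k s) v = Iint T (\<lambda>r. inner (g r) v) s t"
proof -
  have i: "integrable (MT T) (\<lambda>r. inner (g r) v)"
    using p unfolding prim_def by (intro integrable_inner_const) auto
  have k: "inner (k r) v = inner (k 0) v + Iint T (\<lambda>r. inner (g r) v) 0 r" if "0 \<le> r" "r \<le> T" for r
    by (rule p[unfolded prim_def, THEN conjunct2, THEN conjunct2, rule_format]) (use that in auto)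
  have "s \<le> T" "0 \<le> t" using assms(2-) by auto
  then show ?thesis
    using k[OF \<open>0 \<le> s\<close> \<open>s \<le> T\<close>] k[OF \<open>0 \<le> t\<close> \<open>t \<le> T\<close>] Iint_split[OF i order_refl assms(2-)]
    by linarith
qed

lemma prim_norm:
  fixes g :: "real \<Rightarrow> 'a::{real_inner,second_countable_topology}"
  assumes p: "prim T k g" and st: "0 \<le> s" "s \<le> t" "t \<le> T"
  shows "norm (k t - k s) \<le> Iint T (\<lambda>r. norm (g r)) s t"
proof (rule norm_le_of_inner_le)
  have g: "g \<in> borel_measurable (MT T)" "integrable (MT T) (\<lambda>r. norm (g r))" using p unfolding prim_def by auto
  fix v
  have "inner v (k t - k s) = Iint T (\<lambda>r. inner (g r) v) s t"
    using prim_diff[OF p st] by (simp add: inner_diff_right inner_commute)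
  also have "\<dots> \<le> Iint T (\<lambda>r. norm (g r) * norm v) s t"
    by (rule Iint_mono) (use g st in \<open>auto intro: integrable_inner_const norm_cauchy_schwarz\<close>)
  finally show "inner v (k t - k s) \<le> Iint T (\<lambda>r. norm (g r)) s t * norm v" by (simp add: Iint_multc)
qed (simp add: Iint_nonneg)

lemma continuous_on_of_increment_bound:
  fixes k :: "real \<Rightarrow> 'a::real_normed_vector" and N :: "real \<Rightarrow> real"
  assumes N: "continuous_on {0..T} N"
    and inc: "\<And>s t. 0 \<le> s \<Longrightarrow> s \<le> t \<Longrightarrow> t \<le> T \<Longrightarrow> norm (k t - k s) \<le> N t - N s"
  shows "continuous_on {0..T} k"
  unfolding continuous_on_iff
proof (intro ballI allI impI)
  fix x e :: real assume x: "x \<in> {0..T}" and e: "0 < e"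
  obtain d where d: "d > 0" "\<And>x'. x' \<in> {0..T} \<Longrightarrow> dist x' x < d \<Longrightarrow> dist (N x') (N x) < e"
    using N x e unfolding continuous_on_iff by blast
  have "dist (k y) (k x) < e" if y: "y \<in> {0..T}" "dist y x < d" for y
  proof -
    have "norm (k y - k x) \<le> \<bar>N y - N x\<bar>"
      using inc[of x y] inc[of y x] x y(1) norm_minus_commute[of "k y" "k x"] by (cases "x \<le> y") auto
    then show ?thesis using d(2)[OF y] by (simp add: dist_norm dist_real_def)
  qed
  then show "\<exists>d>0. \<forall>x'\<in>{0..T}. dist x' x < d \<longrightarrow> dist (k x') (k x) < e" using d(1) by blast
qed

lemma prim_continuous:
  fixes g :: "real \<Rightarrow> 'a::{real_inner,second_countable_topology}"
  assumes p: "prim T k g" shows "continuous_on {0..T} k"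
proof -
  have i: "integrable (MT T) (\<lambda>r. norm (g r))" using p unfolding prim_def by auto
  show ?thesis
  proof (rule continuous_on_of_increment_bound[OF Iint_continuous[OF i]])
    fix s t assume st: "0 \<le> s" "s \<le> t" "t \<le> T"
    show "norm (k t - k s) \<le> Iint T (\<lambda>r. norm (g r)) 0 t - Iint T (\<lambda>r. norm (g r)) 0 s"
      using prim_norm[OF p st] Iint_split[OF i, of 0 s t] st by linarith
  qed
qed

text \<open>The adjoint moves the operator onto the test vector, so weak primitives are preserved
  without integrating vectors.\<close>

lemma prim_bounded_linear:
  fixes g :: "real \<Rightarrow> 'a::{real_inner,complete_space,second_countable_topology}" and A :: "'a \<Rightarrow> 'b::{real_inner,second_countable_topology}"
  assumes p: "prim T k g" and A: "bounded_linear A"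
  shows "prim T (\<lambda>t. A (k t)) (\<lambda>t. A (g t))"
proof -
  have [measurable]: "g \<in> borel_measurable (MT T)" "A \<in> borel_measurable borel"
    using p bounded_linear_measurable[OF A] unfolding prim_def by auto
  obtain C where C: "\<And>x. norm (A x) \<le> norm x * C" using bounded_linear.bounded[OF A] by blast
  show ?thesis unfolding prim_def
  proof (intro conjI)
    have i: "integrable (MT T) (\<lambda>r. norm (g r) * C)" using p unfolding prim_def by auto
    show "integrable (MT T) (\<lambda>r. norm (A (g r)))"
      by (rule Bochner_Integration.integrable_bound[OF i]) (auto intro!: AE_I2 order_trans[OF C])
    show "\<forall>t\<in>{0..T}. \<forall>v. inner (A (k t)) v = inner (A (k 0)) v + Iint T (\<lambda>r. inner (A (g r)) v) 0 t"
      unfolding adjoint_inner[OF A] using p unfolding prim_def by blast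
  qed measurable
qed

text \<open>For each t the prescribed pairing is a bounded functional of the test vector; its Riesz
  representative is the value of the primitive.\<close>

lemma prim_exists:
  fixes g :: "real \<Rightarrow> 'a::{real_inner,complete_space,second_countable_topology}"
  assumes g: "g \<in> borel_measurable (MT T)" "integrable (MT T) (\<lambda>r. norm (g r))"
  shows "\<exists>k. prim T k g \<and> k 0 = k0"
proof -
  have "\<exists>x. \<forall>v. inner k0 v + Iint T (\<lambda>r. inner (g r) v) 0 t = inner v x" if t: "t \<in> {0..T}" for t
  proof (rule riesz_representation, rule bounded_linear_add[OF bounded_linear_inner_right])
    have i: "integrable (MT T) (\<lambda>r. inner (g r) v)" for v by (rule integrable_inner_const[OF g])
    show "bounded_linear (\<lambda>v. Iint T (\<lambda>r. inner (g r) v) 0 t)"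
    proof (rule bounded_linear_intro[where K="Iint T (\<lambda>r. norm (g r)) 0 t"])
      show "Iint T (\<lambda>r. inner (g r) (x + y)) 0 t = Iint T (\<lambda>r. inner (g r) x) 0 t + Iint T (\<lambda>r. inner (g r) y) 0 t" for x y
        using t i by (simp add: inner_add_right Iint_add)
      show "Iint T (\<lambda>r. inner (g r) (c *\<^sub>R x)) 0 t = c *\<^sub>R Iint T (\<lambda>r. inner (g r) x) 0 t" for c x
        by (simp add: Iint_cmult)
      show "norm (Iint T (\<lambda>r. inner (g r) x) 0 t) \<le> norm x * Iint T (\<lambda>r. norm (g r)) 0 t" for x
      proof -
        have "norm (Iint T (\<lambda>r. inner (g r) x) 0 t) \<le> Iint T (\<lambda>r. \<bar>inner (g r) x\<bar>) 0 t"
          using Iint_abs by simp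
        also have "\<dots> \<le> Iint T (\<lambda>r. norm (g r) * norm x) 0 t"
          by (rule Iint_mono) (use t i g(2) in \<open>auto simp: Cauchy_Schwarz_ineq2\<close>)
        finally show ?thesis by (simp only: Iint_multc mult.commute[of "norm x"])
      qed
    qed
  qed
  then obtain x where x: "\<And>t v. t \<in> {0..T} \<Longrightarrow> inner k0 v + Iint T (\<lambda>r. inner (g r) v) 0 t = inner v (x t)"
    by metis
  \<comment> \<open>The case distinction yields \<open>k 0 = k0\<close> also when
    \<open>{0..T}\<close> is empty and \<open>x\<close> is unconstrained.\<close>
  define k where "k t = (if t = 0 then k0 else x t)" for t
  have "inner (k t) v = inner (k 0) v + Iint T (\<lambda>r. inner (g r) v) 0 t" if "t \<in> {0..T}" for t v
    using x[OF that, of v] unfolding k_def by (auto simp: inner_commute)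
  then have "prim T k g" unfolding prim_def using g by blast
  then show ?thesis unfolding k_def by auto
qed

text \<open>Halving the variation of \<open>N\<close> by the intermediate value theorem halves the bound, so \<open>\<Phi>\<close> is constant.\<close>

lemma constant_of_quadratic_increment:
  fixes \<Phi> N :: "real \<Rightarrow> real"
  assumes N: "continuous_on {0..T} N" and mono: "\<And>s t. 0 \<le> s \<Longrightarrow> s \<le> t \<Longrightarrow> t \<le> T \<Longrightarrow> N s \<le> N t"
    and inc: "\<And>s t. 0 \<le> s \<Longrightarrow> s \<le> t \<Longrightarrow> t \<le> T \<Longrightarrow> \<bar>\<Phi> t - \<Phi> s\<bar> \<le> (N t - N s)\<^sup>2"
    and st: "0 \<le> s" "s \<le> t" "t \<le> T"
  shows "\<Phi> t = \<Phi> s"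
proof -
  have halve: "\<bar>\<Phi> t - \<Phi> s\<bar> \<le> (N t - N s)\<^sup>2 / 2 ^ n" if "0 \<le> s" "s \<le> t" "t \<le> T" for n s t
    using that
  proof (induction n arbitrary: s t)
    case 0 then show ?case using inc by simp
  next
    case (Suc n)
    have "\<exists>x\<ge>s. x \<le> t \<and> N x = (N s + N t) / 2"
      by (rule IVT') (use mono[of s t] Suc.prems in \<open>auto intro: continuous_on_subset[OF N]\<close>)
    then obtain x where x: "s \<le> x" "x \<le> t" "N x = (N s + N t) / 2" by blast
    have "\<bar>\<Phi> t - \<Phi> s\<bar> \<le> \<bar>\<Phi> t - \<Phi> x\<bar> + \<bar>\<Phi> x - \<Phi> s\<bar>" by simp
    also have "\<dots> \<le> (N t - N x)\<^sup>2 / 2 ^ n + (N x - N s)\<^sup>2 / 2 ^ n"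
      using Suc.prems x by (intro add_mono Suc.IH) auto
    also have "\<dots> = 2 * ((N t - N s) / 2)\<^sup>2 / 2 ^ n"
      unfolding x(3) by (simp add: field_simps)
    also have "\<dots> = (N t - N s)\<^sup>2 / 2 ^ Suc n" by (simp add: power_divide)
    finally show ?case .
  qed
  have "(\<lambda>n. (N t - N s)\<^sup>2 * (1/2) ^ n) \<longlonglongrightarrow> (N t - N s)\<^sup>2 * 0"
    by (intro tendsto_mult tendsto_const LIMSEQ_realpow_zero) auto
  then have "\<bar>\<Phi> t - \<Phi> s\<bar> \<le> 0"
    by (intro LIMSEQ_le_const[where X="\<lambda>n. (N t - N s)\<^sup>2 * (1/2) ^ n"])
       (use halve[OF st] in \<open>auto simp: power_divide\<close>)
  then show ?thesis by simp
qed

text \<open>On [s,t] the error of the formula is the integral of g against an increment of m plus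
  that of h against an increment of k. Both increments are at most that of \<open>N\<close>, the
  primitive of |g| + |h|, so the error is at most the square of the increment of \<open>N\<close>
  and \<open>constant_of_quadratic_increment\<close> applies. No approximation by smooth functions
  enters.\<close>

lemma product_rule:
  fixes g h :: "real \<Rightarrow> 'a::{real_inner,second_countable_topology}"
  assumes k: "prim T k g" and m: "prim T m h" and st: "0 \<le> s" "s \<le> t" "t \<le> T"
  shows "inner (k t) (m t) - inner (k s) (m s) = Iint T (\<lambda>r. inner (g r) (m r) + inner (k r) (h r)) s t"
    and "integrable (MT T) (\<lambda>r. inner (g r) (m r) + inner (k r) (h r))"
proof -
  have g: "g \<in> borel_measurable (MT T)" "integrable (MT T) (\<lambda>r. norm (g r))"
    and h: "h \<in> borel_measurable (MT T)" "integrable (MT T) (\<lambda>r. norm (h r))"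
    using k m unfolding prim_def by auto
  have cont: "continuous_on {0..T} k" "continuous_on {0..T} m" using prim_continuous k m by auto
  note [measurable] = g(1) h(1) cont[THEN continuous_on_measurable_MT]
  have intg: "integrable (MT T) (\<lambda>r. inner (f r) (n r))"
    if n: "continuous_on {0..T} n" and f: "f \<in> borel_measurable (MT T)" "integrable (MT T) (\<lambda>r. norm (f r))" for f n :: "real \<Rightarrow> 'a"
  proof -
    have "compact (n ` {0..T})" using n by (intro compact_continuous_image) auto
    then obtain B where B: "\<And>t. t \<in> {0..T} \<Longrightarrow> norm (n t) \<le> B"
      using compact_imp_bounded[of "n ` {0..T}"] unfolding bounded_iff by blast
    note [measurable] = f(1) continuous_on_measurable_MT[OF n]
    show ?thesis
    proof (rule Bochner_Integration.integrable_bound[OF integrable_mult_left[OF f(2), of B]])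
      show "AE r in MT T. norm (inner (f r) (n r)) \<le> norm (norm (f r) * B)"
      proof (rule AE_I2)
        fix r assume "r \<in> space (MT T)"
        then have "norm (n r) \<le> B" using B by auto
        then have "norm (f r) * norm (n r) \<le> norm (f r) * B" by (intro mult_left_mono) auto
        then show "norm (inner (f r) (n r)) \<le> norm (norm (f r) * B)"
          using Cauchy_Schwarz_ineq2[of "f r" "n r"] by simp
      qed
    qed measurable
  qed
  have i1: "integrable (MT T) (\<lambda>r. inner (g r) (m r))" by (rule intg[OF cont(2) g])
  have i2: "integrable (MT T) (\<lambda>r. inner (k r) (h r))" using intg[OF cont(1) h] by (simp add: inner_commute)
  show i3: "integrable (MT T) (\<lambda>r. inner (g r) (m r) + inner (k r) (h r))" using i1 i2 by simp
  define gh where "gh r = norm (g r) + norm (h r)" for r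
  define N where "N t = Iint T gh 0 t" for t
  have igh: "integrable (MT T) gh" unfolding gh_def using g(2) h(2) by simp
  have gh0: "0 \<le> gh r" for r unfolding gh_def by simp
  have Ninc: "N t - N s = Iint T gh s t" if "0 \<le> s" "s \<le> t" "t \<le> T" for s t
    unfolding N_def using Iint_split[OF igh, of 0 s t] that by simp
  define \<Phi> where "\<Phi> t = inner (k t) (m t) - Iint T (\<lambda>r. inner (g r) (m r) + inner (k r) (h r)) 0 t" for t
  have "\<Phi> t = \<Phi> s"
  proof (rule constant_of_quadratic_increment[where N=N, OF _ _ _ st])
    show "continuous_on {0..T} N" unfolding N_def by (rule Iint_continuous[OF igh])
    show "N s \<le> N t" if "0 \<le> s" "s \<le> t" "t \<le> T" for s t
      using Ninc[OF that] Iint_nonneg[of gh T s t] gh0 by simp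
    fix s t assume st: "0 \<le> s" "s \<le> t" "t \<le> T"
    let ?D = "N t - N s"
    have D0: "0 \<le> ?D" using Ninc[OF st] Iint_nonneg[of gh T s t] gh0 by simp
    have sub: "norm (m t - m r) \<le> ?D" "norm (k s - k r) \<le> ?D" if "s < r" "r \<le> t" for r
    proof -
      have "norm (m t - m r) \<le> Iint T (\<lambda>r. norm (h r)) r t" by (rule prim_norm[OF m]) (use st that in auto)
      also have "\<dots> \<le> Iint T gh r t"
        by (rule Iint_mono) (use st that h igh in \<open>auto simp: gh_def\<close>)
      also have "\<dots> \<le> ?D"
        using Ninc[OF st] Iint_split[OF igh, of s r t] Iint_nonneg[of gh T s r] gh0 st that by simp
      finally show "norm (m t - m r) \<le> ?D" .
      have "norm (k s - k r) \<le> Iint T (\<lambda>r. norm (g r)) s r"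
        by (subst norm_minus_commute, rule prim_norm[OF k]) (use st that in auto)
      also have "\<dots> \<le> Iint T gh s r"
        by (rule Iint_mono) (use st that g igh in \<open>auto simp: gh_def\<close>)
      also have "\<dots> \<le> ?D"
        using Ninc[OF st] Iint_split[OF igh, of s r t] Iint_nonneg[of gh T r t] gh0 st that by simp
      finally show "norm (k s - k r) \<le> ?D" .
    qed
    have i4: "integrable (MT T) (\<lambda>r. inner (g r) (m t))" "integrable (MT T) (\<lambda>r. inner (k s) (h r))"
      using integrable_inner_const[OF g, of "m t"] integrable_inner_const[OF h, of "k s"]
      by (simp_all add: inner_commute[of "k s"])
    \<comment> \<open>The increment of the product is split with m frozen at t and k frozen at s, so
      that \<open>prim_diff\<close> applies to each part with a fixed test vector.\<close>
    have "\<Phi> t - \<Phi> s = (inner (k t) (m t) - inner (k s) (m t)) + (inner (m t) (k s) - inner (m s) (k s))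
       - Iint T (\<lambda>r. inner (g r) (m r) + inner (k r) (h r)) s t"
      unfolding \<Phi>_def using Iint_split[OF i3, of 0 s t] st by (simp add: inner_commute)
    also have "\<dots> = Iint T (\<lambda>r. inner (g r) (m t)) s t + Iint T (\<lambda>r. inner (k s) (h r)) s t
       - Iint T (\<lambda>r. inner (g r) (m r) + inner (k r) (h r)) s t"
      using prim_diff[OF k st, of "m t"] prim_diff[OF m st, of "k s"]
      by (simp add: inner_commute[of _ "k s"])
    also have "\<dots> = Iint T (\<lambda>r. inner (g r) (m t - m r) + inner (k s - k r) (h r)) s t"
      using st i1 i2 i3 i4
      by (simp add: Iint_add[symmetric] Iint_diff[symmetric] inner_diff_left inner_diff_right)
         (simp add: algebra_simps)
    finally have eq: "\<Phi> t - \<Phi> s = \<dots>" .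
    have "\<bar>\<dots>\<bar> \<le> Iint T (\<lambda>r. \<bar>inner (g r) (m t - m r) + inner (k s - k r) (h r)\<bar>) s t" by (rule Iint_abs)
    also have "\<dots> \<le> Iint T (\<lambda>r. gh r * ?D) s t"
    proof (rule Iint_mono)
      show "integrable (MT T) (\<lambda>r. \<bar>inner (g r) (m t - m r) + inner (k s - k r) (h r)\<bar>)"
        using i1 i2 i4 by (intro integrable_abs Bochner_Integration.integrable_add) (simp_all add: inner_diff_left inner_diff_right)
      show "integrable (MT T) (\<lambda>r. gh r * ?D)" using igh by simp
      show "AE r in MT T. s < r \<and> r \<le> t \<longrightarrow> \<bar>inner (g r) (m t - m r) + inner (k s - k r) (h r)\<bar> \<le> gh r * ?D"
      proof (intro AE_I2 impI)
        fix r assume r: "s < r \<and> r \<le> t"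
        have "\<bar>inner (g r) (m t - m r)\<bar> \<le> norm (g r) * ?D"
          by (rule order_trans[OF Cauchy_Schwarz_ineq2]) (use sub(1)[of r] r in \<open>auto intro: mult_left_mono\<close>)
        moreover have "\<bar>inner (k s - k r) (h r)\<bar> \<le> ?D * norm (h r)"
          by (rule order_trans[OF Cauchy_Schwarz_ineq2]) (use sub(2)[of r] r in \<open>auto intro: mult_right_mono\<close>)
        ultimately show "\<bar>inner (g r) (m t - m r) + inner (k s - k r) (h r)\<bar> \<le> gh r * ?D"
          unfolding gh_def by (simp add: algebra_simps)
      qed
    qed (use st in auto)
    also have "\<dots> = ?D\<^sup>2" using Ninc[OF st] by (simp add: Iint_multc power2_eq_square)
    finally show "\<bar>\<Phi> t - \<Phi> s\<bar> \<le> ?D\<^sup>2" unfolding eq .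
  qed
  then show "inner (k t) (m t) - inner (k s) (m s) = Iint T (\<lambda>r. inner (g r) (m r) + inner (k r) (h r)) s t"
    unfolding \<Phi>_def using Iint_split[OF i3, of 0 s t] st by simp
qed

text \<open>Half-open intervals form an intersection-stable generator, so the integral of f vanishes
  over all Borel sets by Dynkin's theorem, and then over all Lebesgue sets, which differ from Borel
  sets by subsets of null sets.\<close>

lemma AE_zero_of_Iint_zero:
  fixes f :: "real \<Rightarrow> real"
  assumes f: "integrable (MT T) f" and zero: "\<And>s t. 0 \<le> s \<Longrightarrow> s \<le> t \<Longrightarrow> t \<le> T \<Longrightarrow> Iint T f s t = 0"
  shows "AE t in MT T. f t = 0"
proof (cases "0 \<le> T")
  case False
  then show ?thesis by (intro AE_I2) auto
next
  case T: True
  \<comment> \<open>Extension by zero, as the generating intervals range over the whole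
    line.\<close>
  define g where "g r = indicator {0..T} r * f r" for r
  have g: "integrable lebesgue g"
    using f integrable_restrict_space[of "{0..T}" lebesgue f] unfolding g_def by simp
  have gI: "(\<integral>r. indicator A r * g r \<partial>lebesgue) = (\<integral>r. indicator A r * f r \<partial>MT T)" for A
    by (subst integral_restrict_space) (auto simp: g_def mult_ac)
  have gset: "integrable lebesgue (\<lambda>r. indicator A r * g r)" if "A \<in> sets lebesgue" for A
    using integrable_mult_indicator[OF that g] by simp
  \<comment> \<open>Prepares the case of complements, which are taken in the whole line.\<close>
  have total: "(\<integral>r. g r \<partial>lebesgue) = 0"
    using zero[of 0 T] T gI[of UNIV] Iint_full[OF f T] by simp
  have bor: "(\<integral>r. indicator A r * g r \<partial>lebesgue) = 0" if "A \<in> sets borel" for A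
  proof -
    let ?G = "range (\<lambda>(a, b). {a<..b::real})"
    have "Int_stable ?G" "?G \<subseteq> Pow UNIV" "A \<in> sigma_sets UNIV ?G"
      using that by (auto simp: borel_sigma_sets_Ioc Int_stable_def)
    then show ?thesis
    proof (induction rule: sigma_sets_induct_disjoint)
      case (basic A)
      then obtain a b where A: "A = {a<..b}" by auto
      \<comment> \<open>Clipping the interval to [0,T] loses at most the point 0.\<close>
      have "(\<integral>r. indicator A r * f r \<partial>MT T) = Iint T f (max a 0) (min b T)"
        unfolding Iint_def
      proof (rule integral_cong_AE)
        show "AE r in MT T. indicat_real A r * f r = indicat_real {max a 0<..min b T} r * f r"
          using AE_MT_neq[of 0 T] AE_space
          by eventually_elim (auto simp: A indicator_def)
        have "(\<lambda>r. indicat_real A r) \<in> borel_measurable (MT T)"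
          by (intro measurable_restrict_space1 borel_measurable_indicator) (simp add: A)
        then show "(\<lambda>r. indicat_real A r * f r) \<in> borel_measurable (MT T)" using f by auto
      qed (use Ioc_integrable[OF f, of "max a 0" "min b T"] in auto)
      also have "\<dots> = 0"
      proof (cases "max a 0 \<le> min b T")
        case True then show ?thesis by (intro zero) auto
      next
        case False
        then have "{max a 0<..min b T} = {}" by auto
        then show ?thesis unfolding Iint_def by (simp only:) simp
      qed
      finally show ?case by (simp add: gI)
    next
      case empty then show ?case by simp
    next
      case (compl A)
      have "A \<in> sets lebesgue" using compl.hyps by (simp flip: borel_sigma_sets_Ioc) (metis borel_sigma_sets_Ioc sets_completionI_sets sets_lborel sets_measure_of_conv UNIV_I Pow_UNIV top_greatest)
      have "(\<integral>r. indicator (UNIV - A) r * g r \<partial>lebesgue) = (\<integral>r. g r - indicator A r * g r \<partial>lebesgue)"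
        by (intro Bochner_Integration.integral_cong refl) (auto simp: indicator_def)
      also have "\<dots> = 0" using g gset[OF \<open>A \<in> sets lebesgue\<close>] total compl.IH by simp
      finally show ?case .
    next
      case (union A)
      have A: "A i \<in> sets lebesgue" for i using union.hyps(2) by (metis range_subsetD borel_sigma_sets_Ioc sets_completionI_sets sets_lborel sets_measure_of_conv Pow_UNIV top_greatest)
      have "(LINT x:(\<Union>i. A i)|lebesgue. g x) = (\<Sum>i. (LINT x:(A i)|lebesgue. g x))"
        using union.hyps(1) gset[of "\<Union>i. A i"] A
        by (intro lebesgue_integral_countable_add) (auto simp: disjoint_family_on_def set_integrable_def)
      then show ?case using union.IH by (simp add: set_lebesgue_integral_def)
    qed
  qed
  show ?thesis
  proof (rule sigma_finite_measure.density_zero[OF _ f])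
    show "sigma_finite_measure (MT T)" using finite_measure_MT by (rule finite_measure.axioms(1))
    fix A assume "A \<in> sets (MT T)"
    then have Al: "A \<in> sets lebesgue" by (auto simp: sets_restrict_space_iff)
    then obtain S N N' where A: "A = S \<union> N" "N \<subseteq> N'" "N' \<in> null_sets lborel" "S \<in> sets lborel"
      by (rule sets_completionE)
    have N': "AE r in lebesgue. r \<notin> N'" using A(3) by (intro AE_completion AE_not_in)
    have "(\<integral>r. indicator A r * g r \<partial>lebesgue) = (\<integral>r. indicator S r * g r \<partial>lebesgue)"
    proof (rule integral_cong_AE)
      show "AE r in lebesgue. indicat_real A r * g r = indicat_real S r * g r"
        using N' by eventually_elim (use A in \<open>auto simp: indicator_def\<close>)
    qed (use gset[OF Al] gset[of S] A(4) in auto)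
    also have "\<dots> = 0" using bor A(4) by simp
    finally show "set_lebesgue_integral (MT T) A f = 0" unfolding set_lebesgue_integral_def by (simp add: gI)
  qed
qed

text \<open>The exceptional null set depends on v. A countable dense set of test vectors gives a
  common one: if g t were nonzero, the open half-space of vectors having positive inner product with
  it would contain one of them.\<close>

lemma AE_zero_of_inner_zero:
  fixes g :: "real \<Rightarrow> 'a::{real_inner,second_countable_topology}"
  assumes "\<And>v. AE t in M. inner (g t) v = 0"
  shows "AE t in M. g t = 0"
proof -
  obtain D :: "'a set" where D: "countable D" "\<And>X. open X \<Longrightarrow> X \<noteq> {} \<Longrightarrow> \<exists>d\<in>D. d \<in> X"
    by (rule countable_dense_setE) blast
  have "AE t in M. \<forall>d\<in>D. inner (g t) d = 0"
    using assms by (intro AE_ball_countable' D(1)) auto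
  then show ?thesis
  proof eventually_elim
    case (elim t)
    show ?case
    proof (rule ccontr)
      assume "g t \<noteq> 0"
      then have "g t \<in> {x. 0 < inner (g t) x}" by simp
      moreover have "open {x. 0 < inner (g t) x}"
        by (intro open_Collect_less continuous_intros)
      ultimately obtain d where "d \<in> D" "0 < inner (g t) d" using D(2)[of "{x. 0 < inner (g t) x}"] by blast
      then show False using elim by auto
    qed
  qed
qed

lemma AE_MT_obtain:
  assumes P: "AE t in MT T. P t" and ab: "0 \<le> a" "a < b" "b \<le> T"
  obtains t where "a < t" "t < b" "P t"
proof (rule ccontr)
  assume "\<not> thesis"
  then have no: "\<And>t. a < t \<Longrightarrow> t < b \<Longrightarrow> \<not> P t" using that by blast
  have "AE t in lebesgue. t \<in> {0..T} \<longrightarrow> P t" using P by (subst (asm) AE_restrict_space_iff) auto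
  then have "AE t in lebesgue. t \<notin> {a<..<b}" by eventually_elim (use no ab in force)
  then have "{a<..<b} \<in> null_sets lebesgue" by (subst (asm) AE_iff_null_sets[symmetric]) auto
  then have "emeasure lborel {a<..<b} = 0" by (metis null_setsD1 emeasure_completion sets_lborel borel_open open_greaterThanLessThan null_sets_completion_iff)
  then show False using ab by simp
qed

lemma continuous_AE_eq:
  fixes f g :: "real \<Rightarrow> 'a::metric_space"
  assumes f: "continuous_on {0..T} f" and g: "continuous_on {0..T} g"
    and ae: "AE t in MT T. f t = g t" and t: "t \<in> {0..T}" and T: "0 < T"
  shows "f t = g t"
proof (rule ccontr)
  assume ne: "f t \<noteq> g t"
  define h where "h t = dist (f t) (g t)" for t
  have h: "continuous_on {0..T} h" unfolding h_def by (intro continuous_intros f g)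
  have "0 < h t" using ne unfolding h_def by simp
  then obtain d where d: "d > 0" "\<And>x. x \<in> {0..T} \<Longrightarrow> dist x t < d \<Longrightarrow> dist (h x) (h t) < h t"
    using h t unfolding continuous_on_iff by blast
  define a where "a = max 0 (t - d/2)"
  define b where "b = min T (t + d/2)"
  have ab: "0 \<le> a" "a < b" "b \<le> T" "t - d/2 \<le> a" "b \<le> t + d/2" using d(1) t T unfolding a_def b_def by auto
  obtain x where x: "a < x" "x < b" "f x = g x" by (rule AE_MT_obtain[OF ae ab(1-3)])
  have "dist x t < d" using x ab d(1) by (auto simp: dist_real_def abs_less_iff)
  then have "dist (h x) (h t) < h t" using d(2)[of x] x ab by auto
  moreover have "h x = 0" using x(3) by (simp add: h_def)
  ultimately show False using \<open>0 < h t\<close> by (simp add: dist_real_def)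
qed

section \<open>Traces and integration by parts in \<open>W\<^sub>T\<close>\<close>

context gelfand begin

text \<open>Working form of membership in W_T: \<open>e\<close> is the Riesz representative of the
  derivative of \<open>w\<close>. The equivalence with the distributional definition is the content
  of \<open>WE_imp_is_wderiv\<close> and \<open>is_wderiv_imp_WE\<close>.\<close>

definition WE :: "real \<Rightarrow> (real \<Rightarrow> 'v) \<Rightarrow> (real \<Rightarrow> 'v) \<Rightarrow> bool" where
  "WE T w e \<longleftrightarrow> w \<in> L2sp T \<and> e \<in> L2sp T \<and> (\<exists>k. prim T k e \<and> (AE t in MT T. K (w t) = k t))"

lemma WE_L2: "WE T w e \<Longrightarrow> w \<in> L2sp T" "WE T w e \<Longrightarrow> e \<in> L2sp T"
  unfolding WE_def by auto

lemma L2sp_iota: "w \<in> L2sp T \<Longrightarrow> (\<lambda>t. \<iota> (w t)) \<in> L2sp T"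
  by (rule L2sp_bl[OF _ bl])

lemma Jr_K_L2: "w \<in> L2sp T \<Longrightarrow> \<epsilon> > 0 \<Longrightarrow> (\<lambda>t. Jr \<epsilon> (K (w t))) \<in> L2sp T"
  by (intro L2sp_bl[OF L2sp_bl[OF _ bl_K] bl_Jr])

text \<open>Since \<open>Jr \<epsilon> (K (w t))\<close> approximates w t, the pairing on the left
  regularizes the H inner product of the traces. The resolvent is bounded on V, so the product rule
  applies; its symmetry brings both terms of the integrand to the same form.\<close>

lemma resolvent_identity:
  assumes p: "prim T k1 e1" "prim T k2 e2" and e: "e1 \<in> L2sp T" "e2 \<in> L2sp T" and w: "w1 \<in> L2sp T" "w2 \<in> L2sp T"
    and ae: "AE t in MT T. K (w1 t) = k1 t" "AE t in MT T. K (w2 t) = k2 t"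
    and eps: "\<epsilon> > 0" and st: "0 \<le> s" "s \<le> t" "t \<le> T"
  shows "inner (k1 t) (Jr \<epsilon> (k2 t)) - inner (k1 s) (Jr \<epsilon> (k2 s))
    = Iint T (\<lambda>r. inner (e1 r) (Jr \<epsilon> (K (w2 r))) + inner (e2 r) (Jr \<epsilon> (K (w1 r)))) s t"
proof -
  have p': "prim T (\<lambda>t. Jr \<epsilon> (k2 t)) (\<lambda>t. Jr \<epsilon> (e2 t))" by (rule prim_bounded_linear[OF p(2) bl_Jr[OF eps]])
  have "inner (k1 t) (Jr \<epsilon> (k2 t)) - inner (k1 s) (Jr \<epsilon> (k2 s))
    = Iint T (\<lambda>r. inner (e1 r) (Jr \<epsilon> (k2 r)) + inner (k1 r) (Jr \<epsilon> (e2 r))) s t"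
    by (rule product_rule(1)[OF p(1) p' st])
  also have "\<dots> = Iint T (\<lambda>r. inner (e1 r) (Jr \<epsilon> (K (w2 r))) + inner (e2 r) (Jr \<epsilon> (K (w1 r)))) s t"
  proof (rule Iint_cong_AE)
    show "AE r in MT T. s < r \<and> r \<le> t \<longrightarrow> inner (e1 r) (Jr \<epsilon> (k2 r)) + inner (k1 r) (Jr \<epsilon> (e2 r))
      = inner (e1 r) (Jr \<epsilon> (K (w2 r))) + inner (e2 r) (Jr \<epsilon> (K (w1 r)))"
      using ae
    proof eventually_elim
      case (elim r)
      have "inner (k1 r) (Jr \<epsilon> (e2 r)) = inner (e2 r) (Jr \<epsilon> (k1 r))"
        by (subst Jr_sym[OF eps]) (rule inner_commute)
      then show ?case using elim by simp
    qed
    show "(\<lambda>r. inner (e1 r) (Jr \<epsilon> (k2 r)) + inner (k1 r) (Jr \<epsilon> (e2 r))) \<in> borel_measurable (MT T)"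
      by (rule borel_measurable_integrable[OF product_rule(2)[OF p(1) p' st]])
    show "(\<lambda>r. inner (e1 r) (Jr \<epsilon> (K (w2 r))) + inner (e2 r) (Jr \<epsilon> (K (w1 r)))) \<in> borel_measurable (MT T)"
      by (intro borel_measurable_integrable Bochner_Integration.integrable_add L2sp_inner e Jr_K_L2 w eps)
  qed (use st in auto)
  finally show ?thesis .
qed

text \<open>The bound must not depend on \<epsilon>. At some time s the primitive equals
  \<open>K (w s)\<close>, and there the pairing is at most |k s| |w s| by \<open>Jr_K_norm\<close>;
  from s on, in either direction, increments are controlled by the integral of |e| |w|.\<close>

lemma resolvent_bound:
  assumes p: "prim T k e" and e: "e \<in> L2sp T" and w: "w \<in> L2sp T"
    and ae: "AE t in MT T. K (w t) = k t" and T: "0 < T"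
  obtains C where "C \<ge> 0" "\<And>t \<epsilon>. t \<in> {0..T} \<Longrightarrow> \<epsilon> > 0 \<Longrightarrow> inner (k t) (Jr \<epsilon> (k t)) \<le> C"
proof -
  obtain s where s: "0 < s" "s < T" "K (w s) = k s"
    by (rule AE_MT_obtain[OF ae order_refl T order_refl])
  let ?I = "\<integral>r. norm (e r) * norm (w r) \<partial>MT T"
  have inc: "\<bar>inner (k b) (Jr \<epsilon> (k b)) - inner (k a) (Jr \<epsilon> (k a))\<bar> \<le> 2 * ?I"
    if ab: "0 \<le> a" "a \<le> b" "b \<le> T" and eps: "\<epsilon> > 0" for a b \<epsilon>
  proof -
    let ?f = "\<lambda>r. inner (e r) (Jr \<epsilon> (K (w r))) + inner (e r) (Jr \<epsilon> (K (w r)))"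
    have i: "integrable (MT T) ?f"
      by (intro Bochner_Integration.integrable_add L2sp_inner e Jr_K_L2 w eps)
    have i2: "integrable (MT T) (\<lambda>r. 2 * (norm (e r) * norm (w r)))" using L2sp_norm_mult[OF e w] by simp
    have "\<bar>inner (k b) (Jr \<epsilon> (k b)) - inner (k a) (Jr \<epsilon> (k a))\<bar> = \<bar>Iint T ?f a b\<bar>"
      by (simp only: resolvent_identity[OF p p e e w w ae ae eps ab])
    also have "\<dots> \<le> Iint T (\<lambda>r. \<bar>?f r\<bar>) a b" by (rule Iint_abs)
    also have "\<dots> \<le> Iint T (\<lambda>r. 2 * (norm (e r) * norm (w r))) a b"
    proof (rule Iint_mono)
      show "AE r in MT T. a < r \<and> r \<le> b \<longrightarrow> \<bar>?f r\<bar> \<le> 2 * (norm (e r) * norm (w r))"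
      proof (intro AE_I2 impI)
        fix r
        have "\<bar>inner (e r) (Jr \<epsilon> (K (w r)))\<bar> \<le> norm (e r) * norm (w r)"
          by (rule order_trans[OF Cauchy_Schwarz_ineq2]) (intro mult_left_mono Jr_K_norm eps norm_ge_zero)
        then show "\<bar>?f r\<bar> \<le> 2 * (norm (e r) * norm (w r))" by simp
      qed
    qed (use ab i i2 in auto)
    also have "\<dots> \<le> (\<integral>r. 2 * (norm (e r) * norm (w r)) \<partial>MT T)"
      by (rule Iint_le_full[OF i2]) (use ab in auto)
    finally show ?thesis by simp
  qed
  have I0: "0 \<le> ?I" by (intro integral_nonneg_AE) auto
  show ?thesis
  proof (rule that[of "norm (k s) * norm (w s) + 2 * ?I"])
    fix t \<epsilon> :: real assume t: "t \<in> {0..T}" and eps: "\<epsilon> > 0"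
    have "inner (k s) (Jr \<epsilon> (k s)) \<le> norm (k s) * norm (Jr \<epsilon> (K (w s)))"
      unfolding s(3) by (rule norm_cauchy_schwarz)
    also have "\<dots> \<le> norm (k s) * norm (w s)" by (intro mult_left_mono Jr_K_norm eps norm_ge_zero)
    finally show "inner (k t) (Jr \<epsilon> (k t)) \<le> norm (k s) * norm (w s) + 2 * ?I"
      using inc[of s t \<epsilon>] inc[of t s \<epsilon>] s t eps by (cases "s \<le> t") auto
  qed (use I0 in simp)
qed

abbreviation epsn :: "nat \<Rightarrow> real" where "epsn n \<equiv> inverse (real (Suc n))"

lemma epsn: "epsn n > 0" "epsn \<longlonglongrightarrow> 0"
  using LIMSEQ_inverse_real_of_nat by auto

text \<open>The hypothesis bounds the image of \<open>Jr \<epsilon> x\<close> in H uniformly. Since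
  x - \<epsilon> \<open>Jr \<epsilon> x\<close> is \<open>K (Jr \<epsilon> x)\<close>, the
  functional given by x is, up to an error vanishing with \<epsilon>, the H inner product with that
  bounded vector, and \<open>iota_represent\<close> applies.\<close>

lemma primitive_in_H:
  assumes C: "C \<ge> 0" "\<And>\<epsilon>. \<epsilon> > 0 \<Longrightarrow> inner x (Jr \<epsilon> x) \<le> C"
  shows "\<exists>h. istar h = x"
proof (rule iota_represent[where C="sqrt C"])
  fix v
  have "(\<lambda>n. inner v x - inner v (epsn n *\<^sub>R Jr (epsn n) x)) \<longlonglongrightarrow> inner v x - inner v 0"
    by (intro tendsto_intros eps_Jr_tendsto epsn)
  then have lim: "(\<lambda>n. \<bar>inner v x - inner v (epsn n *\<^sub>R Jr (epsn n) x)\<bar>) \<longlonglongrightarrow> \<bar>inner v x\<bar>"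
    by (auto dest: tendsto_rabs)
  have "\<bar>inner v x - inner v (epsn n *\<^sub>R Jr (epsn n) x)\<bar> \<le> sqrt C * norm (\<iota> v)" for n
  proof -
    let ?z = "Jr (epsn n) x"
    have e: "epsn n > 0" by (rule epsn)
    have "(norm (\<iota> ?z))\<^sup>2 \<le> C" using C(2)[OF e] Jr_energy[OF e, of x] e
      by (smt (verit) mult_nonneg_nonneg zero_le_power2)
    then have z: "norm (\<iota> ?z) \<le> sqrt C" by (rule real_le_rsqrt)
    have "inner v x - inner v (epsn n *\<^sub>R ?z) = inner v (K ?z)"
      using Jr[OF e, of x] by (metis add_diff_cancel_right' inner_diff_right)
    also have "\<bar>\<dots>\<bar> \<le> norm (\<iota> v) * norm (\<iota> ?z)" unfolding K_inner by (rule Cauchy_Schwarz_ineq2)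
    also have "\<dots> \<le> norm (\<iota> v) * sqrt C" using z by (intro mult_left_mono) auto
    finally show ?thesis by (simp add: mult.commute)
  qed
  then show "\<bar>inner v x\<bar> \<le> sqrt C * norm (\<iota> v)"
    by (intro LIMSEQ_le_const2[OF lim]) auto
qed

text \<open>Limit of \<open>resolvent_identity\<close> as \<epsilon> tends to 0: the boundary terms
  converge in H by \<open>iota_Jr_istar_tendsto\<close>, and \<open>Jr_K_norm\<close> dominates the
  integrands by |e1| |w2| + |e2| |w1|.\<close>

lemma trace_product:
  assumes p: "prim T k1 e1" "prim T k2 e2" and e: "e1 \<in> L2sp T" "e2 \<in> L2sp T" and w: "w1 \<in> L2sp T" "w2 \<in> L2sp T"
    and ae: "AE t in MT T. K (w1 t) = k1 t" "AE t in MT T. K (w2 t) = k2 t"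
    and u: "\<And>t. t \<in> {0..T} \<Longrightarrow> istar (u1 t) = k1 t" "\<And>t. t \<in> {0..T} \<Longrightarrow> istar (u2 t) = k2 t"
    and st: "0 \<le> s" "s \<le> t" "t \<le> T"
  shows "inner (u1 t) (u2 t) - inner (u1 s) (u2 s) = Iint T (\<lambda>r. inner (e1 r) (w2 r) + inner (e2 r) (w1 r)) s t"
proof -
  have lim1: "(\<lambda>n. inner (k1 r) (Jr (epsn n) (k2 r))) \<longlonglongrightarrow> inner (u1 r) (u2 r)" if r: "r \<in> {0..T}" for r
  proof -
    have "(\<lambda>n. inner (\<iota> (Jr (epsn n) (istar (u2 r)))) (u1 r)) \<longlonglongrightarrow> inner (u2 r) (u1 r)"
      by (intro tendsto_intros iota_Jr_istar_tendsto epsn)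
    then show ?thesis
      unfolding u(1)[OF r, symmetric] u(2)[OF r, symmetric] istar_inner by (simp add: inner_commute)
  qed
  let ?F = "\<lambda>n r. inner (e1 r) (Jr (epsn n) (K (w2 r))) + inner (e2 r) (Jr (epsn n) (K (w1 r)))"
  have lim2: "(\<lambda>n. Iint T (?F n) s t) \<longlonglongrightarrow> Iint T (\<lambda>r. inner (e1 r) (w2 r) + inner (e2 r) (w1 r)) s t"
    unfolding Iint_def
  proof (rule integral_dominated_convergence[where w="\<lambda>r. norm (e1 r) * norm (w2 r) + norm (e2 r) * norm (w1 r)"])
    have int: "integrable (MT T) (?F n)" for n
      by (intro Bochner_Integration.integrable_add L2sp_inner e Jr_K_L2 w epsn)
    show "(\<lambda>r. indicat_real {s<..t} r * ?F n r) \<in> borel_measurable (MT T)" for n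
      by (rule borel_measurable_integrable[OF Ioc_integrable[OF int st(1,3)]])
    show "(\<lambda>r. indicat_real {s<..t} r * (inner (e1 r) (w2 r) + inner (e2 r) (w1 r))) \<in> borel_measurable (MT T)"
      by (rule borel_measurable_integrable[OF Ioc_integrable[OF _ st(1,3)]])
         (intro Bochner_Integration.integrable_add L2sp_inner e w)
    show "integrable (MT T) (\<lambda>r. norm (e1 r) * norm (w2 r) + norm (e2 r) * norm (w1 r))"
      by (intro Bochner_Integration.integrable_add L2sp_norm_mult e w)
    show "AE r in MT T. (\<lambda>n. indicat_real {s<..t} r * ?F n r) \<longlonglongrightarrow> indicat_real {s<..t} r * (inner (e1 r) (w2 r) + inner (e2 r) (w1 r))"
      by (intro AE_I2 tendsto_intros Jr_K_tendsto epsn)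
    show "AE r in MT T. norm (indicat_real {s<..t} r * ?F n r) \<le> norm (e1 r) * norm (w2 r) + norm (e2 r) * norm (w1 r)" for n
    proof (rule AE_I2)
      fix r
      have b: "\<bar>inner x (Jr (epsn n) (K y))\<bar> \<le> norm x * norm y" for x y
        by (rule order_trans[OF Cauchy_Schwarz_ineq2]) (intro mult_left_mono Jr_K_norm epsn norm_ge_zero)
      have "norm (indicat_real {s<..t} r * ?F n r) \<le> \<bar>?F n r\<bar>" by (auto simp: indicator_def)
      also have "\<dots> \<le> norm (e1 r) * norm (w2 r) + norm (e2 r) * norm (w1 r)"
        by (rule order_trans[OF abs_triangle_ineq add_mono[OF b b]])
      finally show "norm (indicat_real {s<..t} r * ?F n r) \<le> norm (e1 r) * norm (w2 r) + norm (e2 r) * norm (w1 r)" .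
    qed
  qed
  have "(\<lambda>n. Iint T (?F n) s t) \<longlonglongrightarrow> inner (u1 t) (u2 t) - inner (u1 s) (u2 s)"
    unfolding resolvent_identity[OF p e w ae epsn(1) st, symmetric]
    by (intro tendsto_diff lim1) (use st in auto)
  then show ?thesis using LIMSEQ_unique[OF lim2] by simp
qed

text \<open>The primitive takes values in H by the uniform resolvent bound. Continuity into H then
  follows from weak continuity together with continuity of the norm, the latter by
  \<open>trace_product\<close> with both functions equal.\<close>

lemma trace_exists:
  assumes T: "0 < T" and W: "w \<in> L2sp T" "e \<in> L2sp T" and p: "prim T k e" and ae: "AE t in MT T. K (w t) = k t"
  obtains u where "\<And>t. t \<in> {0..T} \<Longrightarrow> istar (u t) = k t" "continuous_on {0..T} u" "AE t in MT T. u t = \<iota> (w t)"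
proof -
  obtain C where C: "C \<ge> 0" "\<And>t \<epsilon>. t \<in> {0..T} \<Longrightarrow> \<epsilon> > 0 \<Longrightarrow> inner (k t) (Jr \<epsilon> (k t)) \<le> C"
    by (rule resolvent_bound[OF p W(2,1) ae T]) blast
  have "\<forall>t\<in>{0..T}. \<exists>h. istar h = k t" by (intro ballI primitive_in_H[OF C(1)] C(2))
  then obtain u where u: "\<And>t. t \<in> {0..T} \<Longrightarrow> istar (u t) = k t" by metis
  have id: "(norm (u t))\<^sup>2 - (norm (u s))\<^sup>2 = Iint T (\<lambda>r. inner (e r) (w r) + inner (e r) (w r)) s t"
    if "0 \<le> s" "s \<le> t" "t \<le> T" for s t
    using trace_product[OF p p W(2) W(2) W(1) W(1) ae ae u u that] by (simp add: power2_norm_eq_inner)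
  have i: "integrable (MT T) (\<lambda>r. inner (e r) (w r) + inner (e r) (w r))"
    by (intro Bochner_Integration.integrable_add L2sp_inner W)
  have n2: "continuous_on {0..T} (\<lambda>t. (norm (u t))\<^sup>2)"
  proof (rule continuous_on_eq)
    show "continuous_on {0..T} (\<lambda>t. (norm (u 0))\<^sup>2 + Iint T (\<lambda>r. inner (e r) (w r) + inner (e r) (w r)) 0 t)"
      by (intro continuous_intros Iint_continuous i)
    show "(norm (u 0))\<^sup>2 + Iint T (\<lambda>r. inner (e r) (w r) + inner (e r) (w r)) 0 t = (norm (u t))\<^sup>2" if "t \<in> {0..T}" for t
      using id[of 0 t] that by simp
  qed
  have wk: "continuous_on {0..T} (\<lambda>t. inner (\<iota> v) (u t))" for v
  proof (rule continuous_on_eq)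
    show "continuous_on {0..T} (\<lambda>t. inner v (k t))"
      by (intro continuous_intros prim_continuous[OF p])
    show "inner v (k t) = inner (\<iota> v) (u t)" if "t \<in> {0..T}" for t
      using istar_inner(1)[of v "u t"] u[OF that] by simp
  qed
  have "compact ((\<lambda>t. (norm (u t))\<^sup>2) ` {0..T})" using n2 by (intro compact_continuous_image) auto
  then obtain B0 where B0: "\<And>t. t \<in> {0..T} \<Longrightarrow> norm ((norm (u t))\<^sup>2) \<le> B0"
    using compact_imp_bounded[of "(\<lambda>t. (norm (u t))\<^sup>2) ` {0..T}"] unfolding bounded_iff by blast
  define B where "B = sqrt B0"
  have B: "norm (u t) \<le> B" if "t \<in> {0..T}" for t
    using B0[OF that] unfolding B_def by (intro real_le_rsqrt) simp
  have "continuous_on {0..T} u"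
    unfolding continuous_on_sequentially comp_def
  proof (intro allI impI ballI, elim conjE)
    fix x :: "nat \<Rightarrow> real" and a assume a: "a \<in> {0..T}" and x: "\<forall>n. x n \<in> {0..T}" "x \<longlonglongrightarrow> a"
    have weak: "(\<lambda>n. inner h (u (x n) - u a)) \<longlonglongrightarrow> 0" for h
    proof (rule LIMSEQ_I)
      fix r :: real assume r: "r > 0"
      have B0': "0 \<le> B" using B[OF a] norm_ge_zero[of "u a"] by linarith
      \<comment> \<open>Weak continuity is known only against the range of \<iota>; boundedness of u
        extends it to every h. The constant leaves r/2 for the part tested with h - \<iota> v, since
        increments of u are at most 2 (B + 1).\<close>
      obtain v where v: "norm (\<iota> v - h) < r / (4 * (B + 1))"
        using iota_approx[of "r / (4 * (B + 1))" h] r B0' by auto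
      have "(\<lambda>n. inner (\<iota> v) (u (x n))) \<longlonglongrightarrow> inner (\<iota> v) (u a)"
        using wk[of v] a x unfolding continuous_on_sequentially comp_def by blast
      then obtain N where N: "\<And>n. n \<ge> N \<Longrightarrow> norm (inner (\<iota> v) (u (x n)) - inner (\<iota> v) (u a)) < r/2"
        using LIMSEQ_D[of _ _ "r/2"] r by (meson half_gt_zero)
      have "norm (inner h (u (x n) - u a) - 0) < r" if "n \<ge> N" for n
      proof -
        have "inner h (u (x n) - u a) = inner (h - \<iota> v) (u (x n) - u a) + (inner (\<iota> v) (u (x n)) - inner (\<iota> v) (u a))"
          by (simp add: inner_diff_left inner_diff_right)
        moreover have "\<bar>inner (h - \<iota> v) (u (x n) - u a)\<bar> \<le> r/2"
        proof -
          have "norm (u (x n) - u a) \<le> 2 * (B + 1)"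
            using norm_triangle_ineq4[of "u (x n)" "u a"] B[OF a] B[of "x n"] x(1) by simp
          moreover have "norm (h - \<iota> v) \<le> r / (4 * (B + 1))" using v by (simp add: norm_minus_commute)
          ultimately have "norm (h - \<iota> v) * norm (u (x n) - u a) \<le> r / (4 * (B + 1)) * (2 * (B + 1))"
            using B0' r by (intro mult_mono) auto
          also have "\<dots> = r/2" using B0' by (simp add: field_simps)
          finally show ?thesis using Cauchy_Schwarz_ineq2[of "h - \<iota> v" "u (x n) - u a"] by linarith
        qed
        ultimately show ?thesis
          using N[OF that] abs_triangle_ineq[of "inner (h - \<iota> v) (u (x n) - u a)" "inner (\<iota> v) (u (x n)) - inner (\<iota> v) (u a)"]
          unfolding diff_0_right real_norm_def by linarith
      qed
      then show "\<exists>no. \<forall>n\<ge>no. norm (inner h (u (x n) - u a) - 0) < r" by blast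
    qed
    have "(\<lambda>n. (norm (u (x n)))\<^sup>2) \<longlonglongrightarrow> (norm (u a))\<^sup>2"
      using n2 a x unfolding continuous_on_sequentially comp_def by blast
    then have "(\<lambda>n. ((norm (u (x n)))\<^sup>2 - (norm (u a))\<^sup>2) - 2 * inner (u a) (u (x n) - u a)) \<longlonglongrightarrow> ((norm (u a))\<^sup>2 - (norm (u a))\<^sup>2) - 2 * 0"
      by (intro tendsto_diff tendsto_mult tendsto_const weak)
    moreover have "((norm (u (x n)))\<^sup>2 - (norm (u a))\<^sup>2) - 2 * inner (u a) (u (x n) - u a) = (norm (u (x n) - u a))\<^sup>2" for n
      unfolding norm_diff_sq by (simp add: power2_norm_eq_inner inner_diff_right inner_commute)
    ultimately have "(\<lambda>n. (norm (u (x n) - u a))\<^sup>2) \<longlonglongrightarrow> 0" by simp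
    then have "(\<lambda>n. sqrt ((norm (u (x n) - u a))\<^sup>2)) \<longlonglongrightarrow> sqrt 0" by (rule tendsto_real_sqrt)
    then have "(\<lambda>n. norm (u (x n) - u a)) \<longlonglongrightarrow> 0" by simp
    then show "(\<lambda>n. u (x n)) \<longlonglongrightarrow> u a" by (simp add: tendsto_norm_zero_iff LIM_zero_iff)
  qed
  moreover have "AE t in MT T. u t = \<iota> (w t)"
    using ae AE_space
  proof eventually_elim
    case (elim t)
    then have "istar (u t) = istar (\<iota> (w t))" using u[of t] unfolding K_def by simp
    then show ?case by (rule istar_inj)
  qed
  ultimately show ?thesis using u that by blast
qed

text \<open>The choice in \<open>hval\<close> is of one function for all times. For T > 0,
  continuous functions that agree almost everywhere agree on all of [0,T], so there the chosen
  function is determined.\<close>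

lemma hval_unique:
  assumes "0 < T" "continuous_on {0..T} u" "AE t in MT T. u t = \<iota> (w t)" "t \<in> {0..T}"
  shows "hval \<iota> T w t = u t"
proof -
  have "continuous_on {0..T} (hval \<iota> T w) \<and> (AE s in MT T. hval \<iota> T w s = \<iota> (w s))"
    unfolding hval_def
    by (rule someI[where P="\<lambda>u. continuous_on {0..T} u \<and> (AE s in MT T. u s = \<iota> (w s))", OF conjI[OF assms(2,3)]])
  then show ?thesis
    by (intro continuous_AE_eq[OF _ assms(2) _ assms(4,1)]) (use assms(3) in auto)
qed

lemma WE_trace:
  assumes T: "0 < T" and W: "WE T w e"
  obtains k where "prim T k e" "AE t in MT T. K (w t) = k t" "\<And>t. t \<in> {0..T} \<Longrightarrow> istar (hval \<iota> T w t) = k t"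
    "continuous_on {0..T} (hval \<iota> T w)" "AE t in MT T. hval \<iota> T w t = \<iota> (w t)"
proof -
  obtain k where k: "prim T k e" "AE t in MT T. K (w t) = k t" using W unfolding WE_def by blast
  obtain u where u: "\<And>t. t \<in> {0..T} \<Longrightarrow> istar (u t) = k t" "continuous_on {0..T} u" "AE t in MT T. u t = \<iota> (w t)"
    by (rule trace_exists[OF T WE_L2[OF W] k]) blast
  have h: "hval \<iota> T w t = u t" if "t \<in> {0..T}" for t by (rule hval_unique[OF T u(2,3) that])
  show ?thesis
  proof (rule that[OF k])
    show "continuous_on {0..T} (hval \<iota> T w)" by (rule continuous_on_eq[OF u(2)]) (simp add: h)
    show "AE t in MT T. hval \<iota> T w t = \<iota> (w t)" using u(3) AE_space by eventually_elim (simp add: h)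
  qed (simp add: h u(1))
qed

lemma WE_product:
  assumes T: "0 < T" and W: "WE T w1 e1" "WE T w2 e2" and st: "0 \<le> s" "s \<le> t" "t \<le> T"
  shows "inner (hval \<iota> T w1 t) (hval \<iota> T w2 t) - inner (hval \<iota> T w1 s) (hval \<iota> T w2 s)
    = Iint T (\<lambda>r. inner (e1 r) (w2 r) + inner (e2 r) (w1 r)) s t"
proof -
  obtain k1 where k1: "prim T k1 e1" "AE t in MT T. K (w1 t) = k1 t" "\<And>t. t \<in> {0..T} \<Longrightarrow> istar (hval \<iota> T w1 t) = k1 t"
    by (rule WE_trace[OF T W(1)]) blast
  obtain k2 where k2: "prim T k2 e2" "AE t in MT T. K (w2 t) = k2 t" "\<And>t. t \<in> {0..T} \<Longrightarrow> istar (hval \<iota> T w2 t) = k2 t"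
    by (rule WE_trace[OF T W(2)]) blast
  show ?thesis
    by (rule trace_product[OF k1(1) k2(1) WE_L2(2)[OF W(1)] WE_L2(2)[OF W(2)] WE_L2(1)[OF W(1)] WE_L2(1)[OF W(2)] k1(2) k2(2) k1(3) k2(3) st])
qed

lemma WE_hval_continuous: "0 < T \<Longrightarrow> WE T w e \<Longrightarrow> continuous_on {0..T} (hval \<iota> T w)"
  by (rule WE_trace)

lemma WE_hval_AE: "0 < T \<Longrightarrow> WE T w e \<Longrightarrow> AE t in MT T. hval \<iota> T w t = \<iota> (w t)"
  by (rule WE_trace)

section \<open>Linearity of traces and uniqueness of derivatives\<close>

lemma prim_lincomb:
  fixes g h :: "real \<Rightarrow> 'a::{real_inner,second_countable_topology}"
  assumes "prim T k g" "prim T m h"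
  shows "prim T (\<lambda>t. c *\<^sub>R k t + d *\<^sub>R m t) (\<lambda>t. c *\<^sub>R g t + d *\<^sub>R h t)"
proof -
  have g: "g \<in> borel_measurable (MT T)" "integrable (MT T) (\<lambda>r. norm (g r))"
    and h: "h \<in> borel_measurable (MT T)" "integrable (MT T) (\<lambda>r. norm (h r))"
    and k: "\<And>t v. t \<in> {0..T} \<Longrightarrow> inner (k t) v = inner (k 0) v + Iint T (\<lambda>r. inner (g r) v) 0 t"
    and m: "\<And>t v. t \<in> {0..T} \<Longrightarrow> inner (m t) v = inner (m 0) v + Iint T (\<lambda>r. inner (h r) v) 0 t"
    using assms unfolding prim_def by blast+
  note [measurable] = g(1) h(1)
  show ?thesis unfolding prim_def
  proof (intro conjI ballI allI)
    have i: "integrable (MT T) (\<lambda>r. \<bar>c\<bar> * norm (g r) + \<bar>d\<bar> * norm (h r))" using g h by simp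
    show "integrable (MT T) (\<lambda>r. norm (c *\<^sub>R g r + d *\<^sub>R h r))"
      by (rule Bochner_Integration.integrable_bound[OF i]) (auto intro!: AE_I2 norm_triangle_mono)
    fix t v assume t: "t \<in> {0..T}"
    have "inner (c *\<^sub>R k t + d *\<^sub>R m t) v = c * inner (k t) v + d * inner (m t) v" by (simp add: inner_add_left)
    also have "\<dots> = c * (inner (k 0) v + Iint T (\<lambda>r. inner (g r) v) 0 t) + d * (inner (m 0) v + Iint T (\<lambda>r. inner (h r) v) 0 t)"
      by (simp only: k[OF t, of v] m[OF t, of v])
    also have "\<dots> = inner (c *\<^sub>R k 0 + d *\<^sub>R m 0) v + Iint T (\<lambda>r. inner (c *\<^sub>R g r + d *\<^sub>R h r) v) 0 t"
      using t integrable_inner_const[OF g, of v] integrable_inner_const[OF h, of v]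
      by (simp add: inner_add_left Iint_add Iint_cmult distrib_left)
    finally show "inner (c *\<^sub>R k t + d *\<^sub>R m t) v = inner (c *\<^sub>R k 0 + d *\<^sub>R m 0) v + Iint T (\<lambda>r. inner (c *\<^sub>R g r + d *\<^sub>R h r) v) 0 t" .
  qed measurable
qed

lemma WE_lincomb:
  assumes W: "WE T w1 e1" "WE T w2 e2"
  shows "WE T (\<lambda>t. c *\<^sub>R w1 t + d *\<^sub>R w2 t) (\<lambda>t. c *\<^sub>R e1 t + d *\<^sub>R e2 t)"
proof -
  interpret bounded_linear K by (rule bl_K)
  obtain k1 k2 where k: "prim T k1 e1" "AE t in MT T. K (w1 t) = k1 t" "prim T k2 e2" "AE t in MT T. K (w2 t) = k2 t"
    using W unfolding WE_def by blast
  have "AE t in MT T. K (c *\<^sub>R w1 t + d *\<^sub>R w2 t) = c *\<^sub>R k1 t + d *\<^sub>R k2 t"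
    using k(2,4) by eventually_elim (simp add: add scaleR)
  then show ?thesis
    unfolding WE_def
    by (intro conjI exI[of _ "\<lambda>t. c *\<^sub>R k1 t + d *\<^sub>R k2 t"] L2sp_add L2sp_scaleR WE_L2[OF W(1)] WE_L2[OF W(2)] prim_lincomb k)
qed

lemma hval_lincomb:
  assumes T: "0 < T" and W: "WE T w1 e1" "WE T w2 e2" and t: "t \<in> {0..T}"
  shows "hval \<iota> T (\<lambda>t. c *\<^sub>R w1 t + d *\<^sub>R w2 t) t = c *\<^sub>R hval \<iota> T w1 t + d *\<^sub>R hval \<iota> T w2 t"
proof (rule hval_unique[OF T _ _ t])
  interpret bounded_linear \<iota> by (rule bl)
  show "continuous_on {0..T} (\<lambda>t. c *\<^sub>R hval \<iota> T w1 t + d *\<^sub>R hval \<iota> T w2 t)"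
    by (intro continuous_intros WE_hval_continuous[OF T W(1)] WE_hval_continuous[OF T W(2)])
  show "AE t in MT T. c *\<^sub>R hval \<iota> T w1 t + d *\<^sub>R hval \<iota> T w2 t = \<iota> (c *\<^sub>R w1 t + d *\<^sub>R w2 t)"
    using WE_hval_AE[OF T W(1)] WE_hval_AE[OF T W(2)] by eventually_elim (simp add: add scaleR)
qed

text \<open>Both primitives are continuous and equal K w almost everywhere, hence coincide on [0,T];
  so e and e' have the same integrals over all subintervals, tested with any v.\<close>

lemma WE_unique:
  assumes T: "0 < T" and W: "WE T w e" "WE T w e'"
  shows "AE t in MT T. e t = e' t"
proof -
  obtain k k' where k: "prim T k e" "AE t in MT T. K (w t) = k t" "prim T k' e'" "AE t in MT T. K (w t) = k' t"
    using W unfolding WE_def by blast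
  have "AE t in MT T. k t = k' t" using k(2,4) by eventually_elim simp
  then have kk: "k t = k' t" if "t \<in> {0..T}" for t
    by (intro continuous_AE_eq[OF prim_continuous[OF k(1)] prim_continuous[OF k(3)] _ that T])
  have "AE t in MT T. inner (e t - e' t) v = 0" for v
  proof (rule AE_zero_of_Iint_zero)
    note i = L2sp_inner_const[OF WE_L2(2)[OF W(1)], of v] L2sp_inner_const[OF WE_L2(2)[OF W(2)], of v]
    show "integrable (MT T) (\<lambda>t. inner (e t - e' t) v)" using i by (simp add: inner_diff_left)
    fix s t assume st: "0 \<le> s" "s \<le> t" "t \<le> T"
    have "Iint T (\<lambda>r. inner (e r - e' r) v) s t = Iint T (\<lambda>r. inner (e r) v) s t - Iint T (\<lambda>r. inner (e' r) v) s t"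
      using i st by (simp add: inner_diff_left Iint_diff)
    also have "\<dots> = 0" using prim_diff[OF k(1) st, of v] prim_diff[OF k(3) st, of v] kk[of s] kk[of t] st by simp
    finally show "Iint T (\<lambda>r. inner (e r - e' r) v) s t = 0" .
  qed
  then have "AE t in MT T. e t - e' t = 0" by (rule AE_zero_of_inner_zero)
  then show ?thesis by simp
qed

end

text \<open>Supplies the functions fed into the product rule: test functions times a vector and,
  with x = 1, the exponential weights of Gronwall's inequality.\<close>

lemma prim_scaled_const:
  fixes \<psi> \<psi>' :: "real \<Rightarrow> real" and x :: "'a::real_inner"
  assumes d: "\<And>t. (\<psi> has_real_derivative \<psi>' t) (at t)" and c: "continuous_on UNIV \<psi>'"
  shows "prim T (\<lambda>t. \<psi> t *\<^sub>R x) (\<lambda>t. \<psi>' t *\<^sub>R x)"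
proof -
  have c': "continuous_on {0..T} \<psi>'" using c continuous_on_subset by blast
  have i: "integrable (MT T) \<psi>'"
    using L2sp_inner_const[OF L2sp_continuous[OF c'], of 1] by simp
  have FTC: "Iint T \<psi>' 0 t = \<psi> t - \<psi> 0" if t: "t \<in> {0..T}" for t
  proof -
    have "Iint T \<psi>' 0 t = (\<integral>r. indicator {0..T} r * (indicator {0<..t} r * \<psi>' r) \<partial>lebesgue)"
      unfolding Iint_def by (subst integral_restrict_space) auto
    also have "\<dots> = (\<integral>r. \<psi>' r * indicator {0..t} r \<partial>lebesgue)"
    proof (rule integral_cong_AE)
      have n0: "AE r in lebesgue. r \<noteq> (0::real)" by (auto intro!: AE_I'[of "{0}"])
      show "AE r in lebesgue. indicat_real {0..T} r * (indicat_real {0<..t} r * \<psi>' r) = \<psi>' r * indicat_real {0..t} r"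
        using n0 by eventually_elim (use t in \<open>auto simp: indicator_def\<close>)
      have [measurable]: "\<psi>' \<in> borel_measurable borel" using c by (rule borel_measurable_continuous_onI)
      show "(\<lambda>r. indicat_real {0..T} r * (indicat_real {0<..t} r * \<psi>' r)) \<in> borel_measurable lebesgue"
        "(\<lambda>r. \<psi>' r * indicat_real {0..t} r) \<in> borel_measurable lebesgue"
        by (simp_all add: measurable_completion)
    qed
    also have "\<dots> = (\<integral>r. \<psi>' r * indicator {0..t} r \<partial>lborel)"
    proof (rule integral_completion)
      have [measurable]: "\<psi>' \<in> borel_measurable borel" using c by (rule borel_measurable_continuous_onI)
      show "(\<lambda>r. \<psi>' r * indicat_real {0..t} r) \<in> borel_measurable lborel" by measurable
    qed
    also have "\<dots> = \<psi> t - \<psi> 0"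
      by (rule integral_FTC_Icc_real) (use t d c in \<open>auto simp: continuous_on_eq_continuous_at\<close>)
    finally show ?thesis .
  qed
  show ?thesis unfolding prim_def
  proof (intro conjI ballI allI)
    show "(\<lambda>t. \<psi>' t *\<^sub>R x) \<in> borel_measurable (MT T)"
      by (intro continuous_on_measurable_MT continuous_intros c')
    show "integrable (MT T) (\<lambda>r. norm (\<psi>' r *\<^sub>R x))" using i by simp
    fix t v assume "t \<in> {0..T}"
    then show "inner (\<psi> t *\<^sub>R x) v = inner (\<psi> 0 *\<^sub>R x) v + Iint T (\<lambda>r. inner (\<psi>' r *\<^sub>R x) v) 0 t"
      using FTC[of t] by (simp add: Iint_multc left_diff_distrib)
  qed
qed

text \<open>These are the test elements of W_T: compactly supported \<psi> detect derivatives, and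
  \<psi> with nonzero end values detect traces.\<close>

lemma (in gelfand) WE_scaled_const:
  assumes d: "\<And>t. (\<psi> has_real_derivative \<psi>' t) (at t)" and c: "continuous_on UNIV \<psi>'"
  shows "WE T (\<lambda>t. \<psi> t *\<^sub>R v) (\<lambda>t. \<psi>' t *\<^sub>R K v)"
    and "0 < T \<Longrightarrow> t \<in> {0..T} \<Longrightarrow> hval \<iota> T (\<lambda>t. \<psi> t *\<^sub>R v) t = \<psi> t *\<^sub>R \<iota> v"
proof -
  interpret K: bounded_linear K by (rule bl_K)
  interpret I: bounded_linear \<iota> by (rule bl)
  have c1: "continuous_on {0..T} \<psi>'" using c continuous_on_subset by blast
  have "continuous_on UNIV \<psi>" using d by (intro DERIV_continuous_on) (auto intro: has_field_derivative_at_within)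
  then have c2: "continuous_on {0..T} \<psi>" using continuous_on_subset by blast
  show "WE T (\<lambda>t. \<psi> t *\<^sub>R v) (\<lambda>t. \<psi>' t *\<^sub>R K v)"
    unfolding WE_def
    by (intro conjI L2sp_continuous continuous_intros c1 c2 exI[of _ "\<lambda>t. \<psi> t *\<^sub>R K v"] prim_scaled_const d c)
       (simp add: K.scaleR)
  show "hval \<iota> T (\<lambda>t. \<psi> t *\<^sub>R v) t = \<psi> t *\<^sub>R \<iota> v" if "0 < T" "t \<in> {0..T}"
    by (rule hval_unique[OF that(1) _ _ that(2)]) (auto intro!: continuous_intros c2 simp: I.scaleR)
qed

section \<open>Distributional derivatives\<close>

lemma testfun_deriv:
  assumes "testfun T \<phi>"
  shows "(\<phi> has_real_derivative deriv \<phi> t) (at t)" "continuous_on UNIV (deriv \<phi>)" "\<phi> 0 = 0" "\<phi> T = 0"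
proof -
  have "\<phi> differentiable at t" using assms unfolding testfun_def differentiable_on_def by auto
  then show "(\<phi> has_real_derivative deriv \<phi> t) (at t)" by (simp add: DERIV_deriv_iff_real_differentiable)
  show "continuous_on UNIV (deriv \<phi>)" using assms unfolding testfun_def by blast
  obtain a b where "0 < a" "b < T" "\<And>t. t \<notin> {a..b} \<Longrightarrow> \<phi> t = 0" using assms unfolding testfun_def by blast
  then show "\<phi> 0 = 0" "\<phi> T = 0" by auto
qed

text \<open>The antiderivative vanishes to the left of the support by normalization, and to the
  right because the mean is zero.\<close>

lemma testfun_exists:
  assumes c: "continuous_on UNIV \<theta>" and ab: "0 < a" "a \<le> b" "b < T" and supp: "\<And>t. t \<notin> {a..b} \<Longrightarrow> \<theta> t = 0"
    and zero: "(\<integral>t. \<theta> t \<partial>MT T) = 0"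
  obtains \<phi> where "testfun T \<phi>" "deriv \<phi> = \<theta>"
proof -
  have "\<exists>F. \<forall>x. -\<infinity> < ereal x \<longrightarrow> ereal x < \<infinity> \<longrightarrow> (F has_vector_derivative \<theta> x) (at x)"
    by (rule einterval_antiderivative) (use c in \<open>auto simp: continuous_on_eq_continuous_at\<close>)
  then obtain F where F: "\<And>x. (F has_real_derivative \<theta> x) (at x)"
    by (auto simp: has_real_derivative_iff_has_vector_derivative)
  define \<phi> where "\<phi> t = F t - F 0" for t
  have d: "(\<phi> has_real_derivative \<theta> t) (at t)" for t unfolding \<phi>_def by (auto intro!: derivative_eq_intros F)
  have deriv: "deriv \<phi> = \<theta>" using DERIV_imp_deriv[OF d] by auto
  have constS: "\<phi> x = \<phi> y" if "convex S" "\<And>t. t \<in> S \<Longrightarrow> \<theta> t = 0" "x \<in> S" "y \<in> S" for S x y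
  proof -
    have "\<exists>c. \<forall>x\<in>S. \<phi> x = c"
      by (rule has_field_derivative_zero_constant[OF that(1)])
         (metis d has_field_derivative_at_within that(2))
    then show ?thesis using that by auto
  qed
  have c': "continuous_on {0..T} \<theta>" using c continuous_on_subset by blast
  have i: "integrable (MT T) \<theta>"
    using L2sp_inner_const[OF L2sp_continuous[OF c'], of 1] by simp
  have "\<phi> T = 0"
    using prim_diff[OF prim_scaled_const[OF d c, of T "1::real"], of 0 T 1] zero Iint_full[OF i] ab
    by (simp add: \<phi>_def)
  have out: "\<phi> t = 0" if t: "t \<notin> {a..b}" for t
  proof (cases "t < a")
    case True
    have "\<phi> t = \<phi> 0" by (rule constS[of "{..<a}"]) (use supp True ab in auto)
    then show ?thesis by (simp add: \<phi>_def)
  next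
    case False
    have "\<phi> t = \<phi> T" by (rule constS[of "{b<..}"]) (use supp False ab t in auto)
    then show ?thesis by (simp add: \<open>\<phi> T = 0\<close>)
  qed
  have "\<phi> differentiable_on UNIV"
    using d unfolding differentiable_on_def real_differentiable_def
    by (blast intro: has_field_derivative_at_within)
  moreover have "\<exists>a b. 0 < a \<and> b < T \<and> (\<forall>t. t \<notin> {a..b} \<longrightarrow> \<phi> t = 0)" using ab out by blast
  ultimately have "testfun T \<phi>" using c unfolding testfun_def deriv by blast
  then show ?thesis using deriv that by blast
qed

lemma MT_integrable_mult_continuous:
  assumes f: "integrable (MT T) f" and g: "continuous_on UNIV (g :: real \<Rightarrow> real)"
  shows "integrable (MT T) (\<lambda>t. f t * g t :: real)"
proof -
  have g': "continuous_on {0..T} g" using g continuous_on_subset by blast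
  have "compact (g ` {0..T})" using g' by (intro compact_continuous_image) auto
  then obtain B where B: "\<And>t. t \<in> {0..T} \<Longrightarrow> norm (g t) \<le> B"
    using compact_imp_bounded[of "g ` {0..T}"] unfolding bounded_iff by blast
  have [measurable]: "f \<in> borel_measurable (MT T)" "g \<in> borel_measurable (MT T)"
    using f continuous_on_measurable_MT[OF g'] by auto
  show ?thesis
  proof (rule Bochner_Integration.integrable_bound[OF integrable_mult_left[OF integrable_norm[OF f], of B]])
    show "AE t in MT T. norm (f t * g t) \<le> norm (norm (f t) * B)"
    proof (rule AE_I2)
      fix t assume "t \<in> space (MT T)"
      then have "\<bar>g t\<bar> \<le> \<bar>B\<bar>" using B[of t] by auto
      then show "norm (f t * g t) \<le> norm (norm (f t) * B)" by (simp add: abs_mult mult_left_mono)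
    qed
  qed measurable
qed

lemma MT_integrable_continuous: "continuous_on UNIV (g :: real \<Rightarrow> real) \<Longrightarrow> integrable (MT T) g"
  using MT_integrable_mult_continuous[of T "\<lambda>_. 1" g] by simp

text \<open>A hat function around T/2, scaled to integral 1. Continuity is enough smoothness: it is
  to enter derivatives of test functions, which are themselves only of class C^1.\<close>

definition bump :: "real \<Rightarrow> real \<Rightarrow> real" where
  "bump T t = max 0 (T/4 - \<bar>t - T/2\<bar>) / (\<integral>t. max 0 (T/4 - \<bar>t - T/2\<bar>) \<partial>MT T)"

lemma bump:
  assumes T: "0 < T"
  shows "continuous_on UNIV (bump T)" "(\<integral>t. bump T t \<partial>MT T) = 1"
    "\<And>t. t \<notin> {T/4..3*T/4} \<Longrightarrow> bump T t = 0"
proof -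
  let ?h = "\<lambda>t. max 0 (T/4 - \<bar>t - T/2\<bar>)"
  show c: "continuous_on UNIV (bump T)" unfolding bump_def divide_inverse by (intro continuous_intros)
  have ch: "continuous_on UNIV ?h" by (intro continuous_intros)
  have i: "integrable (MT T) ?h" by (rule MT_integrable_continuous[OF ch])
  have "(\<integral>t. ?h t \<partial>MT T) \<noteq> 0"
  proof
    assume "(\<integral>t. ?h t \<partial>MT T) = 0"
    then have "AE t in MT T. ?h t = 0"
      by (subst (asm) integral_nonneg_eq_0_iff_AE[OF i]) auto
    then have "?h (T/2) = 0"
      by (intro continuous_AE_eq[OF _ continuous_on_const _ _ T]) (use T continuous_on_subset[OF ch] in auto)
    then show False using T by simp
  qed
  then show "(\<integral>t. bump T t \<partial>MT T) = 1" unfolding bump_def by simp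
  show "bump T t = 0" if "t \<notin> {T/4..3*T/4}" for t
  proof -
    have "T/4 - \<bar>t - T/2\<bar> \<le> 0" using that by (auto simp: abs_if)
    then show ?thesis unfolding bump_def by simp
  qed
qed

text \<open>Du Bois-Reymond: the functions \<open>\<psi> - (\<integral>\<psi>) bump\<close> are derivatives of test functions, so \<open>f\<close> pairs
  with continuous compactly supported \<open>\<psi>\<close> like the constant \<open>\<integral>f bump\<close>; now let \<open>\<psi>\<close> approximate indicators.\<close>

lemma du_Bois_Reymond:
  fixes f :: "real \<Rightarrow> real"
  assumes T: "0 < T" and f: "integrable (MT T) f"
    and test: "\<And>\<phi>. testfun T \<phi> \<Longrightarrow> (\<integral>t. f t * deriv \<phi> t \<partial>MT T) = 0"
  shows "AE t in MT T. f t = (\<integral>t. f t * bump T t \<partial>MT T)"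
proof -
  define c where "c = (\<integral>t. f t * bump T t \<partial>MT T)"
  define g where "g t = f t - c" for t
  have g: "integrable (MT T) g" unfolding g_def using f by simp
  have orth: "(\<integral>t. g t * \<psi> t \<partial>MT T) = 0"
    if \<psi>: "continuous_on UNIV \<psi>" and ab: "0 < a" "a \<le> b" "b < T" and supp: "\<And>t. t \<notin> {a..b} \<Longrightarrow> \<psi> t = 0" for \<psi> a b
  proof -
    let ?m = "\<integral>t. \<psi> t \<partial>MT T"
    define \<theta> where "\<theta> t = \<psi> t - ?m * bump T t" for t
    have c\<theta>: "continuous_on UNIV \<theta>" unfolding \<theta>_def by (intro continuous_intros \<psi> bump(1)[OF T])
    note i = MT_integrable_continuous[OF \<psi>, of T] MT_integrable_continuous[OF bump(1)[OF T], of T]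
    have i1: "integrable (MT T) (\<lambda>t. f t * \<psi> t)" "integrable (MT T) (\<lambda>t. f t * bump T t)"
      by (intro MT_integrable_mult_continuous f \<psi> bump(1)[OF T])+
    have z: "(\<integral>t. \<theta> t \<partial>MT T) = 0" unfolding \<theta>_def using i bump(2)[OF T] by simp
    obtain \<phi> where "testfun T \<phi>" "deriv \<phi> = \<theta>"
    \<comment> \<open>The supports of \<psi> and \<open>bump\<close> are enclosed in one interval
      inside (0,T).\<close>
    proof (rule testfun_exists[OF c\<theta> _ _ _ _ z, where a="min a (T/4)" and b="max b (3*T/4)"])
      show "\<theta> t = 0" if "t \<notin> {min a (T/4)..max b (3*T/4)}" for t
      proof -
        have "t \<notin> {a..b}" "t \<notin> {T/4..3*T/4}" using that by auto
        then show ?thesis using supp bump(3)[OF T] unfolding \<theta>_def by simp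
      qed
    qed (use ab T in auto)
    then have "(\<integral>t. f t * \<theta> t \<partial>MT T) = 0" using test by metis
    moreover have "f t * \<theta> t = f t * \<psi> t - ?m * (f t * bump T t)" for t
      unfolding \<theta>_def by (simp add: algebra_simps)
    ultimately have "(\<integral>t. f t * \<psi> t \<partial>MT T) = ?m * c"
      unfolding c_def using i1 by simp
    then show ?thesis unfolding g_def using i i1 by (simp add: left_diff_distrib)
  qed
  have Icc: "Iint T g a b = 0" if ab: "0 < a" "a \<le> b" "b < T" for a b
  proof -
    \<comment> \<open>Trapezoids equal to 1 on [a,b] with slopes n; as soon as 1/n is below both a
      and T - b, their support lies inside (0,T).\<close>
    define \<psi> where "\<psi> n t = max 0 (min 1 (1 + real n * min (t - a) (b - t)))" for n t
    have c\<psi>: "continuous_on UNIV (\<psi> n)" for n unfolding \<psi>_def by (intro continuous_intros)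
    have p01: "0 \<le> \<psi> n t" "\<psi> n t \<le> 1" for n t unfolding \<psi>_def by auto
    have "\<forall>\<^sub>F n in sequentially. 1 / real n < min a (T - b)"
      by (rule order_tendstoD(2)[OF lim_1_over_n]) (use ab in auto)
    then have ev: "\<forall>\<^sub>F n in sequentially. (\<integral>t. g t * \<psi> n t \<partial>MT T) = 0"
      using eventually_gt_at_top[of 0]
    proof eventually_elim
      case (elim n)
      have "\<psi> n t = 0" if "t \<notin> {a - 1/real n..b + 1/real n}" for t
      proof -
        have "min (t - a) (b - t) < - (1/real n)" using that by auto
        then have "real n * min (t - a) (b - t) < real n * (- (1 / real n))"
          using elim by (intro mult_strict_left_mono) auto
        then have "1 + real n * min (t - a) (b - t) < 0" using elim by simp
        then show ?thesis unfolding \<psi>_def by (simp add: max_def min_def)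
      qed
      moreover have "0 < a - 1/real n" "b + 1/real n < T" "0 < 1/real n" using elim by auto
      ultimately show ?case
        using ab by (intro orth[OF c\<psi>, of "a - 1/real n" "b + 1/real n"]) linarith+
    qed
    have lim: "(\<lambda>n. \<integral>t. g t * \<psi> n t \<partial>MT T) \<longlonglongrightarrow> (\<integral>t. indicator {a<..b} t * g t \<partial>MT T)"
    proof (rule integral_dominated_convergence[where w="\<lambda>t. norm (g t)"])
      show "AE t in MT T. (\<lambda>n. g t * \<psi> n t) \<longlonglongrightarrow> indicat_real {a<..b} t * g t"
        using AE_MT_neq[of a T]
      proof eventually_elim
        case (elim t)
        show ?case
        proof (cases "t \<in> {a..b}")
          case True
          then have "\<psi> n t = 1" for n unfolding \<psi>_def by (auto simp: max_def min_def)
          then show ?thesis using True elim by simp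
        next
          case False
          then have neg: "min (t - a) (b - t) < 0" by auto
          then have "0 < - min (t - a) (b - t)" by simp
          from reals_Archimedean3[OF this] obtain N where N: "1 < real N * - min (t - a) (b - t)" by blast
          have "\<psi> n t = 0" if "n \<ge> N" for n
          proof -
            have "real N * - min (t - a) (b - t) \<le> real n * - min (t - a) (b - t)"
              using that neg by (intro mult_right_mono) auto
            then have "1 + real n * min (t - a) (b - t) < 0" using N by simp
            then show ?thesis unfolding \<psi>_def by (simp add: max_def min_def)
          qed
          then have "\<forall>\<^sub>F n in sequentially. g t * \<psi> n t = indicat_real {a<..b} t * g t"
            using False unfolding eventually_sequentially by (intro exI[of _ N]) (auto simp: indicator_def)
          then show ?thesis by (rule tendsto_eventually)
        qed
      qed
      show "AE t in MT T. norm (g t * \<psi> n t) \<le> norm (g t)" for n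
        using p01 by (intro AE_I2) (auto simp: abs_mult mult_left_le)
      show "(\<lambda>t. g t * \<psi> n t) \<in> borel_measurable (MT T)" for n
        by (intro borel_measurable_integrable MT_integrable_mult_continuous g c\<psi>)
      show "(\<lambda>t. indicat_real {a<..b} t * g t) \<in> borel_measurable (MT T)"
        by (intro borel_measurable_integrable Ioc_integrable g) (use ab in auto)
    qed (use g in auto)
    have "(\<lambda>n. \<integral>t. g t * \<psi> n t \<partial>MT T) \<longlonglongrightarrow> 0" by (rule tendsto_eventually[OF ev])
    then show ?thesis unfolding Iint_def using LIMSEQ_unique[OF lim] by simp
  qed
  \<comment> \<open>\<open>Icc\<close> concerns intervals strictly inside (0,T); continuity of the
    integral brings in the end points.\<close>
  have F: "Iint T g 0 t = Iint T g 0 (T/2)" if t: "t \<in> {0..T}" for t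
  proof (rule continuous_AE_eq[OF Iint_continuous[OF g] continuous_on_const _ t T])
    show "AE t in MT T. Iint T g 0 t = Iint T g 0 (T/2)"
      using AE_MT_neq[of 0 T] AE_MT_neq[of T T] AE_space
    proof eventually_elim
      case (elim t)
      then have t: "0 < t" "t < T" by auto
      show ?case
      proof (cases "t \<le> T/2")
        case True
        have "Iint T g 0 (T/2) = Iint T g 0 t + Iint T g t (T/2)" by (rule Iint_split[OF g]) (use True t T in auto)
        moreover have "Iint T g t (T/2) = 0" by (rule Icc) (use True t T in auto)
        ultimately show ?thesis by simp
      next
        case False
        have "Iint T g 0 t = Iint T g 0 (T/2) + Iint T g (T/2) t" by (rule Iint_split[OF g]) (use False t T in auto)
        moreover have "Iint T g (T/2) t = 0" by (rule Icc) (use False t T in auto)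
        ultimately show ?thesis by simp
      qed
    qed
  qed
  have "AE t in MT T. g t = 0"
  proof (rule AE_zero_of_Iint_zero[OF g])
    fix s t assume st: "0 \<le> s" "s \<le> t" "t \<le> T"
    then show "Iint T g s t = 0" using F[of s] F[of t] Iint_split[OF g order_refl st] by simp
  qed
  then show ?thesis unfolding g_def c_def by simp
qed

section \<open>Equivalence of weak primitives and distributional derivatives\<close>

lemma L2sp_riesz:
  fixes d :: "real \<Rightarrow> ('v::{real_inner,complete_space,second_countable_topology} \<Rightarrow>\<^sub>L real)"
  shows "(\<lambda>t. riesz (d t)) \<in> L2sp T \<longleftrightarrow> d \<in> L2sp T"
proof
  assume "(\<lambda>t. riesz (d t)) \<in> L2sp T"
  from L2sp_bl[OF this bounded_linear_unriesz] show "d \<in> L2sp T" by simp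
qed (rule L2sp_bl[OF _ bounded_linear_riesz])

lemma L2nrm_riesz: "L2nrm T (\<lambda>t. riesz (d t)) = L2nrm T d"
  by (rule L2nrm_cong_AE) (simp add: norm_riesz)

context gelfand begin

text \<open>Integration by parts against \<phi> v, whose boundary terms vanish with \<phi>.\<close>

lemma WE_imp_is_wderiv:
  assumes T: "0 < T" and W: "WE T w (\<lambda>t. riesz (d t))"
  shows "is_wderiv \<iota> T w d"
  unfolding is_wderiv_def
proof (intro allI impI)
  fix \<phi> v assume \<phi>: "testfun T \<phi>"
  note tf = testfun_deriv[OF \<phi>]
  note S = WE_scaled_const(1)[OF tf(1,2), of T v]
  have h: "hval \<iota> T (\<lambda>t. \<phi> t *\<^sub>R v) t = \<phi> t *\<^sub>R \<iota> v" if "t \<in> {0..T}" for t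
    by (rule WE_scaled_const(2)[OF tf(1,2) T that])
  have i: "integrable (MT T) (\<lambda>t. blinfun_apply (d t) v * \<phi> t)" "integrable (MT T) (\<lambda>t. inner (\<iota> (w t)) (\<iota> v) * deriv \<phi> t)"
    using L2sp_inner[OF WE_L2(2)[OF W] WE_L2(1)[OF S]] L2sp_inner[OF WE_L2(2)[OF S] WE_L2(1)[OF W]]
    by (simp_all add: inner_riesz K_inner inner_commute mult.commute)
  have "0 = Iint T (\<lambda>r. inner (riesz (d r)) (\<phi> r *\<^sub>R v) + inner (deriv \<phi> r *\<^sub>R K v) (w r)) 0 T"
    using WE_product[OF T W S, of 0 T] T h[of 0] h[of T] tf(3,4) by simp
  also have "\<dots> = (\<integral>r. inner (riesz (d r)) (\<phi> r *\<^sub>R v) + inner (deriv \<phi> r *\<^sub>R K v) (w r) \<partial>MT T)"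
    by (rule Iint_full) (intro Bochner_Integration.integrable_add L2sp_inner WE_L2(1)[OF S] WE_L2(2)[OF S] WE_L2(1)[OF W] WE_L2(2)[OF W], use T in simp)
  also have "\<dots> = (\<integral>r. blinfun_apply (d r) v * \<phi> r + inner (\<iota> (w r)) (\<iota> v) * deriv \<phi> r \<partial>MT T)"
    by (intro Bochner_Integration.integral_cong refl) (simp add: inner_riesz K_inner inner_commute mult.commute)
  also have "\<dots> = (\<integral>r. blinfun_apply (d r) v * \<phi> r \<partial>MT T) + (\<integral>r. inner (\<iota> (w r)) (\<iota> v) * deriv \<phi> r \<partial>MT T)"
    using i by simp
  finally show "(\<integral>t. inner (\<iota> (w t)) (\<iota> v) * deriv \<phi> t \<partial>MT T) = - (\<integral>t. blinfun_apply (d t) v * \<phi> t \<partial>MT T)" by simp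
qed

text \<open>With k a primitive of the candidate derivative, y = K w - k has zero distributional
  derivative in every direction v, so by du Bois-Reymond its inner product with v is almost
  everywhere constant. It remains to see that these constants come from one vector c and that the
  null set can be chosen independently of v.\<close>

lemma is_wderiv_imp_WE:
  assumes T: "0 < T" and w: "w \<in> L2sp T" and d: "d \<in> L2sp T" and wd: "is_wderiv \<iota> T w d"
  shows "WE T w (\<lambda>t. riesz (d t))"
proof -
  define e where "e t = riesz (d t)" for t
  have e: "e \<in> L2sp T" unfolding e_def using d by (simp add: L2sp_riesz)
  obtain k where k: "prim T k e"
    using prim_exists[OF L2spD(1)[OF e] L2sp_norm_integrable[OF e]] by blast
  define y where "y t = K (w t) - k t" for t
  have y: "y \<in> L2sp T" unfolding y_def
    by (intro L2sp_diff L2sp_bl[OF w bl_K] L2sp_continuous prim_continuous[OF k])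
  have yb: "(\<lambda>t. bump T t *\<^sub>R y t) \<in> borel_measurable (MT T)" "integrable (MT T) (\<lambda>t. norm (bump T t *\<^sub>R y t))"
  proof -
    have [measurable]: "bump T \<in> borel_measurable (MT T)" "y \<in> borel_measurable (MT T)"
      using continuous_on_measurable_MT[OF continuous_on_subset[OF bump(1)[OF T]]] L2spD(1)[OF y] by auto
    show "(\<lambda>t. bump T t *\<^sub>R y t) \<in> borel_measurable (MT T)" by measurable
    have "continuous_on UNIV (\<lambda>t. \<bar>bump T t\<bar>)" by (intro continuous_intros bump(1)[OF T])
    from MT_integrable_mult_continuous[OF L2sp_norm_integrable[OF y] this]
    show "integrable (MT T) (\<lambda>t. norm (bump T t *\<^sub>R y t))" by (simp add: mult.commute)
  qed
  \<comment> \<open>The mean of y weighted by \<open>bump\<close> will be the vector c; it is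
    obtained as the end value of a weak primitive instead of a vector-valued integral.\<close>
  obtain x where x: "prim T x (\<lambda>t. bump T t *\<^sub>R y t)" "x 0 = 0" using prim_exists[OF yb, of 0] by blast
  define c where "c = x T"
  have c: "inner c v = (\<integral>t. inner (y t) v * bump T t \<partial>MT T)" for v
  proof -
    have "inner (x T) v - inner (x 0) v = Iint T (\<lambda>r. inner (bump T r *\<^sub>R y r) v) 0 T"
      by (rule prim_diff[OF x(1)]) (use T in auto)
    also have "\<dots> = (\<integral>t. inner (bump T t *\<^sub>R y t) v \<partial>MT T)"
      by (rule Iint_full[OF integrable_inner_const[OF yb]]) (use T in auto)
    finally show ?thesis unfolding c_def x(2) by (simp add: mult.commute)
  qed
  have "AE t in MT T. inner (y t - c) v = 0" for v
  proof -
    have "AE t in MT T. inner (y t) v = (\<integral>t. inner (y t) v * bump T t \<partial>MT T)"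
    proof (rule du_Bois_Reymond[OF T L2sp_inner_const[OF y]])
      fix \<phi> assume \<phi>: "testfun T \<phi>"
      note tf = testfun_deriv[OF \<phi>]
      have p: "prim T (\<lambda>t. \<phi> t *\<^sub>R v) (\<lambda>t. deriv \<phi> t *\<^sub>R v)" by (rule prim_scaled_const[OF tf(1,2)])
      have c\<phi>: "continuous_on UNIV \<phi>" using tf(1) by (intro DERIV_continuous_on) (auto intro: has_field_derivative_at_within)
      have i: "integrable (MT T) (\<lambda>r. inner (e r) v * \<phi> r)" "integrable (MT T) (\<lambda>r. inner (k r) v * deriv \<phi> r)"
        "integrable (MT T) (\<lambda>r. inner (K (w r)) v * deriv \<phi> r)"
        by (intro MT_integrable_mult_continuous L2sp_inner_const e c\<phi> tf(2) L2sp_continuous prim_continuous[OF k] L2sp_bl[OF w bl_K])+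
      have pr: "inner (k T) (\<phi> T *\<^sub>R v) - inner (k 0) (\<phi> 0 *\<^sub>R v) = Iint T (\<lambda>r. inner (e r) (\<phi> r *\<^sub>R v) + inner (k r) (deriv \<phi> r *\<^sub>R v)) 0 T"
        "integrable (MT T) (\<lambda>r. inner (e r) (\<phi> r *\<^sub>R v) + inner (k r) (deriv \<phi> r *\<^sub>R v))"
        using product_rule[OF k p, of 0 T] T by auto
      have "0 = Iint T (\<lambda>r. inner (e r) (\<phi> r *\<^sub>R v) + inner (k r) (deriv \<phi> r *\<^sub>R v)) 0 T"
        using pr(1) tf(3,4) by simp
      also have "\<dots> = (\<integral>r. inner (e r) (\<phi> r *\<^sub>R v) + inner (k r) (deriv \<phi> r *\<^sub>R v) \<partial>MT T)"
        by (rule Iint_full[OF pr(2)]) (use T in simp)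
      also have "\<dots> = (\<integral>r. inner (e r) v * \<phi> r \<partial>MT T) + (\<integral>r. inner (k r) v * deriv \<phi> r \<partial>MT T)"
        using i by (simp add: mult.commute)
      finally have 1: "(\<integral>r. inner (k r) v * deriv \<phi> r \<partial>MT T) = - (\<integral>r. inner (e r) v * \<phi> r \<partial>MT T)" by simp
      have 2: "(\<integral>r. inner (K (w r)) v * deriv \<phi> r \<partial>MT T) = - (\<integral>r. inner (e r) v * \<phi> r \<partial>MT T)"
        using wd \<phi> unfolding is_wderiv_def e_def K_inner inner_riesz by blast
      show "(\<integral>t. inner (y t) v * deriv \<phi> t \<partial>MT T) = 0"
        unfolding y_def using i 1 2 by (simp add: inner_diff_left left_diff_distrib)
    qed
    then show ?thesis unfolding inner_diff_left c by simp
  qed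
  then have "AE t in MT T. y t - c = 0" by (rule AE_zero_of_inner_zero)
  then have "AE t in MT T. K (w t) = k t + c" unfolding y_def by eventually_elim (simp add: algebra_simps)
  moreover have "prim T (\<lambda>t. k t + c) e"
    unfolding prim_def
  proof (intro conjI ballI allI)
    fix t v assume t: "t \<in> {0..T}"
    show "inner (k t + c) v = inner (k 0 + c) v + Iint T (\<lambda>r. inner (e r) v) 0 t"
      using prim_diff[OF k, of 0 t v] t by (simp add: inner_add_left)
  qed (use k in \<open>simp_all add: prim_def\<close>)
  ultimately show ?thesis using w e unfolding WE_def e_def by blast
qed

lemma WT_iff: "0 < T \<Longrightarrow> w \<in> WT \<iota> T \<longleftrightarrow> (\<exists>e. WE T w e)"
proof
  assume T: "0 < T" and "w \<in> WT \<iota> T"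
  then show "\<exists>e. WE T w e" unfolding WT_def using is_wderiv_imp_WE[OF T] by blast
next
  assume T: "0 < T" and "\<exists>e. WE T w e"
  then obtain e where e: "WE T w e" by blast
  have "WE T w (\<lambda>t. riesz (unriesz (e t)))" using e by simp
  from WE_imp_is_wderiv[OF T this] show "w \<in> WT \<iota> T"
    unfolding WT_def using WE_L2[OF e] L2sp_bl[OF WE_L2(2)[OF e] bounded_linear_unriesz] by blast
qed

lemma wderiv_WE:
  assumes T: "0 < T" and w: "w \<in> WT \<iota> T"
  shows "wderiv \<iota> T w \<in> L2sp T" "WE T w (\<lambda>t. riesz (wderiv \<iota> T w t))"
proof -
  have "\<exists>d. d \<in> L2sp T \<and> is_wderiv \<iota> T w d" using w unfolding WT_def by blast
  then have d: "wderiv \<iota> T w \<in> L2sp T \<and> is_wderiv \<iota> T w (wderiv \<iota> T w)"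
    unfolding wderiv_def by (rule someI_ex)
  then show "wderiv \<iota> T w \<in> L2sp T" by blast
  show "WE T w (\<lambda>t. riesz (wderiv \<iota> T w t))"
    using d w unfolding WT_def by (intro is_wderiv_imp_WE[OF T]) auto
qed

end

section \<open>The a priori estimate\<close>

lemma MT_mult_bounded:
  assumes f: "integrable (MT T) f" and E: "continuous_on UNIV E"
  shows "integrable (MT T) (\<lambda>t. E t * f t :: real)"
  using MT_integrable_mult_continuous[OF f E] by (simp add: mult.commute)

text \<open>Gronwall's inequality in both time directions, by multiplying with \<open>exp (\<mp>\<kappa> t)\<close>.\<close>

lemma energy_forward:
  fixes y m n f :: "real \<Rightarrow> real"
  assumes T: "0 \<le> T" and y: "prim T y m" and i: "integrable (MT T) n" "integrable (MT T) f"
    and nonneg: "\<And>t. 0 \<le> n t" "\<And>t. 0 \<le> f t" "0 \<le> \<kappa>"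
    and le: "AE t in MT T. m t \<le> - n t + \<kappa> * y t + f t"
  shows "y T + (\<integral>t. n t \<partial>MT T) \<le> exp (\<kappa> * T) * (y 0 + (\<integral>t. f t \<partial>MT T))"
proof -
  define E where "E t = exp (- \<kappa> * t)" for t
  have cE: "continuous_on UNIV E" unfolding E_def by (intro continuous_intros)
  have dE: "(E has_real_derivative - \<kappa> * E t) (at t)" for t
    unfolding E_def by (auto intro!: derivative_eq_intros)
  have "continuous_on UNIV (\<lambda>t. - \<kappa> * E t)" by (intro continuous_intros cE)
  then have pE: "prim T E (\<lambda>t. - \<kappa> * E t)" using prim_scaled_const[OF dE, of T "1::real"] by simp
  note pr = product_rule[OF y pE order_refl T order_refl]
  have iE: "integrable (MT T) (\<lambda>t. E t * n t)" "integrable (MT T) (\<lambda>t. E t * f t)"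
    by (intro MT_mult_bounded i cE)+
  have E0: "0 < E t" for t unfolding E_def by simp
  have Eb: "exp (- \<kappa> * T) \<le> E t" "E t \<le> 1" if "t \<in> {0..T}" for t
    unfolding E_def using that nonneg(3) by (auto intro: mult_left_mono)
  have "y T * E T - y 0 * E 0 = (\<integral>r. m r * E r + y r * (- \<kappa> * E r) \<partial>MT T)"
    using pr Iint_full[OF pr(2) T] by simp
  also have "\<dots> \<le> (\<integral>r. E r * f r - E r * n r \<partial>MT T)"
  proof (rule integral_mono_AE)
    show "AE r in MT T. m r * E r + y r * (- \<kappa> * E r) \<le> E r * f r - E r * n r"
      using le
    proof eventually_elim
      case (elim r)
      have "E r * m r \<le> E r * (- n r + \<kappa> * y r + f r)" using elim E0[of r] by (intro mult_left_mono) auto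
      then show ?case by (simp add: algebra_simps)
    qed
  qed (use pr(2) iE in auto)
  also have "\<dots> = (\<integral>r. E r * f r \<partial>MT T) - (\<integral>r. E r * n r \<partial>MT T)" using iE by simp
  finally have 1: "y T * E T + (\<integral>r. E r * n r \<partial>MT T) \<le> y 0 + (\<integral>r. E r * f r \<partial>MT T)" by (simp add: E_def)
  have 2: "(\<integral>r. E r * f r \<partial>MT T) \<le> (\<integral>r. f r \<partial>MT T)"
    by (rule integral_mono[OF iE(2) i(2)]) (use Eb nonneg(2) in \<open>auto simp: mult_left_le_one_le less_imp_le[OF E0]\<close>)
  have 3: "exp (- \<kappa> * T) * (\<integral>r. n r \<partial>MT T) \<le> (\<integral>r. E r * n r \<partial>MT T)"
    unfolding integral_mult_right_zero[symmetric]
    by (rule integral_mono[OF _ iE(1)]) (use i Eb nonneg(1) in \<open>auto intro: mult_right_mono\<close>)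
  have "exp (- \<kappa> * T) * (y T + (\<integral>t. n t \<partial>MT T)) \<le> y 0 + (\<integral>r. f r \<partial>MT T)"
    using 1 2 3 by (simp add: E_def distrib_left mult.commute)
  then have "exp (\<kappa> * T) * (exp (- \<kappa> * T) * (y T + (\<integral>t. n t \<partial>MT T))) \<le> exp (\<kappa> * T) * (y 0 + (\<integral>r. f r \<partial>MT T))"
    by (intro mult_left_mono) auto
  then show ?thesis by (simp add: mult.assoc[symmetric] exp_add[symmetric])
qed

lemma energy_backward:
  fixes y m n f :: "real \<Rightarrow> real"
  assumes T: "0 \<le> T" and y: "prim T y m" and i: "integrable (MT T) n" "integrable (MT T) f"
    and nonneg: "\<And>t. 0 \<le> n t" "\<And>t. 0 \<le> f t" "0 \<le> \<kappa>"
    and ge: "AE t in MT T. n t - \<kappa> * y t - f t \<le> m t"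
  shows "y 0 + (\<integral>t. n t \<partial>MT T) \<le> exp (\<kappa> * T) * (y T + (\<integral>t. f t \<partial>MT T))"
proof -
  define E where "E t = exp (\<kappa> * t)" for t
  have cE: "continuous_on UNIV E" unfolding E_def by (intro continuous_intros)
  have dE: "(E has_real_derivative \<kappa> * E t) (at t)" for t
    unfolding E_def by (auto intro!: derivative_eq_intros)
  have "continuous_on UNIV (\<lambda>t. \<kappa> * E t)" by (intro continuous_intros cE)
  then have pE: "prim T E (\<lambda>t. \<kappa> * E t)" using prim_scaled_const[OF dE, of T "1::real"] by simp
  note pr = product_rule[OF y pE order_refl T order_refl]
  have iE: "integrable (MT T) (\<lambda>t. E t * n t)" "integrable (MT T) (\<lambda>t. E t * f t)"
    by (intro MT_mult_bounded i cE)+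
  have E0: "0 < E t" for t unfolding E_def by simp
  have Eb: "1 \<le> E t" "E t \<le> exp (\<kappa> * T)" if "t \<in> {0..T}" for t
    unfolding E_def using that nonneg(3) by (auto intro: mult_left_mono)
  have "(\<integral>r. E r * n r \<partial>MT T) - (\<integral>r. E r * f r \<partial>MT T) = (\<integral>r. E r * n r - E r * f r \<partial>MT T)" using iE by simp
  also have "\<dots> \<le> (\<integral>r. m r * E r + y r * (\<kappa> * E r) \<partial>MT T)"
  proof (rule integral_mono_AE)
    show "AE r in MT T. E r * n r - E r * f r \<le> m r * E r + y r * (\<kappa> * E r)"
      using ge
    proof eventually_elim
      case (elim r)
      have "E r * (n r - \<kappa> * y r - f r) \<le> E r * m r" using elim E0[of r] by (intro mult_left_mono) auto
      then show ?case by (simp add: algebra_simps)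
    qed
  qed (use pr(2) iE in auto)
  also have "\<dots> = y T * E T - y 0 * E 0"
    using pr Iint_full[OF pr(2) T] by simp
  finally have 1: "y 0 + (\<integral>r. E r * n r \<partial>MT T) \<le> exp (\<kappa> * T) * y T + (\<integral>r. E r * f r \<partial>MT T)"
    by (simp add: E_def mult.commute)
  have 2: "(\<integral>r. n r \<partial>MT T) \<le> (\<integral>r. E r * n r \<partial>MT T)"
    by (rule integral_mono[OF i(1) iE(1)]) (use Eb nonneg(1) mult_right_mono[of 1] in fastforce)
  have 3: "(\<integral>r. E r * f r \<partial>MT T) \<le> exp (\<kappa> * T) * (\<integral>r. f r \<partial>MT T)"
    unfolding integral_mult_right_zero[symmetric]
    by (rule integral_mono[OF iE(2)]) (use i Eb nonneg(2) in \<open>auto intro: mult_right_mono\<close>)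
  show ?thesis using 1 2 3 by (simp add: distrib_left)
qed

text \<open>Puts the squared norm of the trace into the form required by the scalar energy
  inequalities.\<close>

lemma (in gelfand) prim_norm_sq:
  assumes T: "0 < T" and W: "WE T w e"
  shows "prim T (\<lambda>t. (norm (hval \<iota> T w t))\<^sup>2) (\<lambda>t. 2 * inner (e t) (w t))"
proof -
  have i: "integrable (MT T) (\<lambda>t. inner (e t) (w t))" by (rule L2sp_inner[OF WE_L2(2,1)[OF W]])
  show ?thesis unfolding prim_def
  proof (intro conjI ballI allI)
    fix t v :: real assume t: "t \<in> {0..T}"
    have "(norm (hval \<iota> T w t))\<^sup>2 - (norm (hval \<iota> T w 0))\<^sup>2 = Iint T (\<lambda>t. 2 * inner (e t) (w t)) 0 t"
      using WE_product[OF T W W, of 0 t] t by (simp add: power2_norm_eq_inner)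
    then have eq: "(norm (hval \<iota> T w t))\<^sup>2 = (norm (hval \<iota> T w 0))\<^sup>2 + Iint T (\<lambda>t. 2 * inner (e t) (w t)) 0 t"
      by simp
    show "inner ((norm (hval \<iota> T w t))\<^sup>2) v = inner ((norm (hval \<iota> T w 0))\<^sup>2) v + Iint T (\<lambda>r. inner (2 * inner (e r) (w r)) v) 0 t"
      unfolding inner_real_def Iint_multc eq by (rule distrib_right)
  qed (use i in auto)
qed

section \<open>Young's inequality and squares of sums\<close>

lemma young: "0 < \<theta> \<Longrightarrow> 2 * (x * y) \<le> \<theta> * y\<^sup>2 + x\<^sup>2 / \<theta>" for x y \<theta> :: real
proof -
  assume t: "0 < \<theta>"
  have "0 \<le> (\<theta> * y - x)\<^sup>2 / \<theta>" using t by simp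
  also have "\<dots> = \<theta> * y\<^sup>2 + x\<^sup>2 / \<theta> - 2 * (x * y)" using t by (simp add: field_simps power2_eq_square)
  finally show ?thesis by simp
qed

lemma young_inner: "0 < \<theta> \<Longrightarrow> \<bar>2 * inner x y\<bar> \<le> \<theta> * (norm y)\<^sup>2 + (norm x)\<^sup>2 / \<theta>" for x y :: "'a::real_inner"
  using young[of \<theta> "norm x" "norm y"] Cauchy_Schwarz_ineq2[of x y] by simp

lemma sq_sum3_le: "(norm (x + y + z))\<^sup>2 \<le> 3 * (norm x)\<^sup>2 + 3 * (norm y)\<^sup>2 + 3 * (norm z)\<^sup>2"
  for x y z :: "'a::real_normed_vector"
proof -
  have "norm (x + y + z) \<le> norm x + norm y + norm z" by (intro norm_triangle_mono order_refl)
  then have "(norm (x + y + z))\<^sup>2 \<le> (norm x + norm y + norm z)\<^sup>2" by (intro power_mono) auto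
  also have "\<dots> \<le> 3 * (norm x)\<^sup>2 + 3 * (norm y)\<^sup>2 + 3 * (norm z)\<^sup>2"
    using zero_le_power2[of "norm x - norm y"] zero_le_power2[of "norm x - norm z"] zero_le_power2[of "norm y - norm z"]
    by (simp add: power2_eq_square algebra_simps)
  finally show ?thesis .
qed

lemma L2nrm_sq_sum3:
  fixes f g h :: "real \<Rightarrow> 'a::{real_normed_vector,second_countable_topology}"
  assumes "f \<in> L2sp T" "g \<in> L2sp T" "h \<in> L2sp T"
  shows "(L2nrm T (\<lambda>t. f t + g t + h t))\<^sup>2 \<le> 3 * (L2nrm T f)\<^sup>2 + 3 * (L2nrm T g)\<^sup>2 + 3 * (L2nrm T h)\<^sup>2"
proof -
  have L: "(\<lambda>t. f t + g t + h t) \<in> L2sp T" by (intro L2sp_add assms)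
  have "(\<integral>t. (norm (f t + g t + h t))\<^sup>2 \<partial>MT T) \<le> (\<integral>t. 3 * (norm (f t))\<^sup>2 + 3 * (norm (g t))\<^sup>2 + 3 * (norm (h t))\<^sup>2 \<partial>MT T)"
    by (rule integral_mono) (use assms L in \<open>auto simp: L2spD sq_sum3_le\<close>)
  then show ?thesis using assms L by (simp add: L2nrm_sq L2spD)
qed

text \<open>\<open>A\<close> is the operator of the state equation followed by \<open>riesz\<close>,
  and \<open>C\<close> stands for the adjoint of B. The bounds are locale parameters of their own,
  so that constants defined from them do not mention \<open>A\<close>; this is how independence of
  \<sigma> enters.\<close>

locale saddle = gelfand \<iota>
  for \<iota> :: "'v::{real_inner,complete_space,second_countable_topology} \<Rightarrow> 'h::{real_inner,complete_space,second_countable_topology}" +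
  fixes A :: "'v \<Rightarrow> 'v" and C :: "'h \<Rightarrow> 'u::{real_inner,complete_space,second_countable_topology}" and Q P :: "'h \<Rightarrow> 'h"
    and \<rho> \<theta> cA ci cC cQ cP :: real
  assumes blA: "bounded_linear A" and blC: "bounded_linear C" and blQ: "bounded_linear Q" and blP: "bounded_linear P"
    and \<rho>: "0 \<le> \<rho>" and \<theta>: "0 < \<theta>"
    and coercive: "\<And>v. inner (A v) v \<le> \<rho> * (norm (\<iota> v))\<^sup>2 - \<theta> * (norm v)\<^sup>2"
    and boundA: "\<And>v. norm (A v) \<le> cA * norm v"
    and boundi: "\<And>v. norm (\<iota> v) \<le> ci * norm v" and boundC: "\<And>h. norm (C h) \<le> cC * norm h"
    and boundQ: "\<And>h. norm (Q h) \<le> cQ * norm h" and boundP: "\<And>h. norm (P h) \<le> cP * norm h"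
    and c0: "0 \<le> cA" "0 \<le> ci" "0 \<le> cC" "0 \<le> cQ" "0 \<le> cP"
begin

section \<open>The saddle-point operator in Riesz coordinates\<close>

definition CC :: "'v \<Rightarrow> 'v" where "CC v = istar (adjoint C (C (\<iota> v)))"
definition QQ :: "'v \<Rightarrow> 'v" where "QQ v = istar (adjoint Q (Q (\<iota> v)))"
definition PP :: "'h \<Rightarrow> 'h" where "PP h = adjoint P (P h)"

lemma CC_inner: "inner (CC v) w = inner (C (\<iota> v)) (C (\<iota> w))"
  unfolding CC_def by (simp add: istar_inner inner_commute flip: adjoint_inner[OF blC])

lemma QQ_inner: "inner (QQ v) w = inner (Q (\<iota> v)) (Q (\<iota> w))"
  unfolding QQ_def by (simp add: istar_inner inner_commute flip: adjoint_inner[OF blQ])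

lemma PP_inner: "inner (PP h) g = inner (P h) (P g)"
  unfolding PP_def by (metis adjoint_inner[OF blP] inner_commute)

lemma bl_CC: "bounded_linear CC" and bl_QQ: "bounded_linear QQ" and bl_PP: "bounded_linear PP"
  unfolding CC_def[abs_def] QQ_def[abs_def] PP_def[abs_def]
  by (intro bounded_linear_compose[OF bl_istar] bounded_linear_compose[OF bounded_linear_adjoint]
      bounded_linear_compose[OF blC] bounded_linear_compose[OF blQ] blP blC blQ bl)+

lemma bl_At: "bounded_linear (adjoint A)"
  by (rule bounded_linear_adjoint[OF blA])

lemma At_inner: "inner (adjoint A v) w = inner (A w) v"
  by (metis adjoint_inner[OF blA] inner_commute)

lemma norm_istar: "norm (istar h) \<le> ci * norm h"
  unfolding istar_def by (rule norm_adjoint_le[OF bl c0(2) boundi])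

lemma norm_CC: "norm (CC v) \<le> cC * ci * norm (C (\<iota> v))"
  using order_trans[OF norm_istar mult_left_mono[OF norm_adjoint_le[OF blC c0(3) boundC] c0(2)]]
  by (simp add: CC_def mult_ac)

lemma norm_QQ: "norm (QQ v) \<le> cQ * ci * norm (Q (\<iota> v))"
  using order_trans[OF norm_istar mult_left_mono[OF norm_adjoint_le[OF blQ c0(4) boundQ] c0(2)]]
  by (simp add: QQ_def mult_ac)

lemma norm_PP: "norm (PP h) \<le> cP * norm (P h)"
  unfolding PP_def by (rule norm_adjoint_le[OF blP c0(5) boundP])

lemma norm_At: "norm (adjoint A v) \<le> cA * norm v"
  by (rule norm_adjoint_le[OF blA c0(1) boundA])

definition G1 :: "(real \<Rightarrow> 'v) \<Rightarrow> (real \<Rightarrow> 'v) \<Rightarrow> (real \<Rightarrow> 'v) \<Rightarrow> real \<Rightarrow> 'v" where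
  "G1 e1 w1 w2 t = e1 t - A (w1 t) - CC (w2 t)"

definition G3 :: "(real \<Rightarrow> 'v) \<Rightarrow> (real \<Rightarrow> 'v) \<Rightarrow> (real \<Rightarrow> 'v) \<Rightarrow> real \<Rightarrow> 'v" where
  "G3 w1 e2 w2 t = QQ (w1 t) - e2 t - adjoint A (w2 t)"

definition G4 :: "real \<Rightarrow> (real \<Rightarrow> 'v) \<Rightarrow> (real \<Rightarrow> 'v) \<Rightarrow> 'h" where
  "G4 T w1 w2 = PP (hval \<iota> T w1 T) + hval \<iota> T w2 T"

lemma G1_L2: "e1 \<in> L2sp T \<Longrightarrow> w1 \<in> L2sp T \<Longrightarrow> w2 \<in> L2sp T \<Longrightarrow> G1 e1 w1 w2 \<in> L2sp T"
  unfolding G1_def[abs_def] by (intro L2sp_diff L2sp_bl[OF _ blA] L2sp_bl[OF _ bl_CC])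

lemma G3_L2: "w1 \<in> L2sp T \<Longrightarrow> e2 \<in> L2sp T \<Longrightarrow> w2 \<in> L2sp T \<Longrightarrow> G3 w1 e2 w2 \<in> L2sp T"
  unfolding G3_def[abs_def] by (intro L2sp_diff L2sp_bl[OF _ bl_QQ] L2sp_bl[OF _ bl_At])

definition Dsq :: "real \<Rightarrow> (real \<Rightarrow> 'v) \<Rightarrow> (real \<Rightarrow> 'v) \<Rightarrow> (real \<Rightarrow> 'v) \<Rightarrow> (real \<Rightarrow> 'v) \<Rightarrow> real" where
  "Dsq T w1 e1 w2 e2 = (L2nrm T (G1 e1 w1 w2))\<^sup>2 + (norm (hval \<iota> T w1 0))\<^sup>2
     + (L2nrm T (G3 w1 e2 w2))\<^sup>2 + (norm (G4 T w1 w2))\<^sup>2"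

text \<open>Besides the W_T norms it contains the end values that are multiplied by data in
  \<open>cross\<close>: w1 at T and w2 at 0.\<close>

definition Ysq :: "real \<Rightarrow> (real \<Rightarrow> 'v) \<Rightarrow> (real \<Rightarrow> 'v) \<Rightarrow> (real \<Rightarrow> 'v) \<Rightarrow> (real \<Rightarrow> 'v) \<Rightarrow> real" where
  "Ysq T w1 e1 w2 e2 = (L2nrm T w1)\<^sup>2 + (L2nrm T e1)\<^sup>2 + (L2nrm T w2)\<^sup>2 + (L2nrm T e2)\<^sup>2
     + (norm (hval \<iota> T w1 T))\<^sup>2 + (norm (hval \<iota> T w2 0))\<^sup>2"

text \<open>Dominates the coefficients 1 + 1/\<theta> + cC^2 of the forward estimate and 2 + 2 cP^2
  + 1/\<theta> + cQ^2 of the backward estimate.\<close>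

definition k0 :: real where "k0 = 2 + 1 / \<theta> + cC\<^sup>2 + cQ\<^sup>2 + 2 * cP\<^sup>2"

text \<open>Sum of the bounds for the six terms of \<open>Ysq\<close>: 2 k0 for the traces, 2
  k0/\<theta> for the functions, the rest for the derivatives as recovered from the
  equations.\<close>

definition k1 :: real where
  "k1 = 2 * k0 + 2 * (k0 / \<theta>) + 6 + 6 * (cA\<^sup>2 * (k0 / \<theta>)) + 3 * (cC * ci)\<^sup>2 + 3 * (cQ * ci)\<^sup>2"

text \<open>The factor 6 comes from solving Y^2 \<le> L (D^2 + 4 D Y) for Y when L is at least
  1.\<close>

definition cG :: "real \<Rightarrow> real" where "cG T = 6 * (k1 * exp ((2 * \<rho> + 1) * T))"

context
  fixes T :: real and w1 e1 w2 e2 :: "real \<Rightarrow> 'v"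
  assumes T: "0 < T" and W1: "WE T w1 e1" and W2: "WE T w2 e2"
begin

definition "F1 = G1 e1 w1 w2"
definition "F3 = G3 w1 e2 w2"
definition "u1 = hval \<iota> T w1"
definition "u2 = hval \<iota> T w2"
definition "Eb = (L2nrm T (\<lambda>t. C (\<iota> (w2 t))))\<^sup>2"
definition "Eq = (L2nrm T (\<lambda>t. Q (\<iota> (w1 t))))\<^sup>2"
definition "Ep = (norm (P (u1 T)))\<^sup>2"

lemmas WL = WE_L2[OF W1] WE_L2[OF W2]

lemma F_L2: "F1 \<in> L2sp T" "F3 \<in> L2sp T"
  unfolding F1_def F3_def by (intro G1_L2 G3_L2 WL)+

lemma CQ_L2: "(\<lambda>t. C (\<iota> (w2 t))) \<in> L2sp T" "(\<lambda>t. Q (\<iota> (w1 t))) \<in> L2sp T"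
  by (intro L2sp_bl[OF _ blC] L2sp_bl[OF _ blQ] L2sp_iota WL)+

lemma e1_eq: "e1 t = F1 t + A (w1 t) + CC (w2 t)"
  unfolding F1_def G1_def by simp

lemma e2_eq: "e2 t = QQ (w1 t) - F3 t - adjoint A (w2 t)"
  unfolding F3_def G3_def by simp

text \<open>State equation tested with w1. Coercivity leaves 2 \<theta>, half of which absorbs the
  source by Young's inequality; the exponent collects 2 \<rho> from coercivity and 1 from the
  coupling term. The coupling is kept in terms of C applied to w2, the quantity controlled by
  \<open>cross\<close>.\<close>

lemma forward:
  "(norm (u1 T))\<^sup>2 + \<theta> * (L2nrm T w1)\<^sup>2
    \<le> exp ((2 * \<rho> + 1) * T) * ((norm (u1 0))\<^sup>2 + ((L2nrm T F1)\<^sup>2 / \<theta> + cC\<^sup>2 * Eb))"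
proof -
  have "(norm (u1 T))\<^sup>2 + (\<integral>t. \<theta> * (norm (w1 t))\<^sup>2 \<partial>MT T)
    \<le> exp ((2 * \<rho> + 1) * T) * ((norm (u1 0))\<^sup>2 + (\<integral>t. (norm (F1 t))\<^sup>2 / \<theta> + cC\<^sup>2 * (norm (C (\<iota> (w2 t))))\<^sup>2 \<partial>MT T))"
    unfolding u1_def
  proof (rule energy_forward[OF _ prim_norm_sq[OF T W1]])
    show "AE t in MT T. 2 * inner (e1 t) (w1 t)
      \<le> - (\<theta> * (norm (w1 t))\<^sup>2) + (2 * \<rho> + 1) * (norm (hval \<iota> T w1 t))\<^sup>2 + ((norm (F1 t))\<^sup>2 / \<theta> + cC\<^sup>2 * (norm (C (\<iota> (w2 t))))\<^sup>2)"
      using WE_hval_AE[OF T W1]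
    proof eventually_elim
      case (elim t)
      have 1: "2 * inner (F1 t) (w1 t) \<le> \<theta> * (norm (w1 t))\<^sup>2 + (norm (F1 t))\<^sup>2 / \<theta>"
        using young_inner[OF \<theta>, of "F1 t" "w1 t"] by linarith
      have "inner (C (\<iota> (w2 t))) (C (\<iota> (w1 t))) \<le> norm (C (\<iota> (w2 t))) * norm (C (\<iota> (w1 t)))" by (rule norm_cauchy_schwarz)
      also have "\<dots> \<le> norm (C (\<iota> (w2 t))) * (cC * norm (\<iota> (w1 t)))" by (intro mult_left_mono boundC) auto
      finally have 2: "2 * inner (CC (w2 t)) (w1 t) \<le> (norm (\<iota> (w1 t)))\<^sup>2 + cC\<^sup>2 * (norm (C (\<iota> (w2 t))))\<^sup>2"
        using young[of 1 "cC * norm (C (\<iota> (w2 t)))" "norm (\<iota> (w1 t))"] by (simp add: CC_inner power_mult_distrib mult_ac)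
      show ?case
        using 1 2 coercive[of "w1 t"] unfolding e1_eq[of t] elim by (simp add: inner_add_left algebra_simps)
    qed
  qed (use T \<theta> \<rho> WL F_L2 CQ_L2 in \<open>auto simp: L2spD(2)\<close>)
  then show ?thesis
    using WL F_L2 CQ_L2 by (simp add: L2nrm_sq Eb_def L2spD(2))
qed

text \<open>Adjoint equation tested with w2, run from T down to 0 because of the sign of its
  derivative; the state enters only through the observation by Q, again controlled by
  \<open>cross\<close>.\<close>

lemma backward:
  "(norm (u2 0))\<^sup>2 + \<theta> * (L2nrm T w2)\<^sup>2
    \<le> exp ((2 * \<rho> + 1) * T) * ((norm (u2 T))\<^sup>2 + ((L2nrm T F3)\<^sup>2 / \<theta> + cQ\<^sup>2 * Eq))"
proof -
  have "(norm (u2 0))\<^sup>2 + (\<integral>t. \<theta> * (norm (w2 t))\<^sup>2 \<partial>MT T)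
    \<le> exp ((2 * \<rho> + 1) * T) * ((norm (u2 T))\<^sup>2 + (\<integral>t. (norm (F3 t))\<^sup>2 / \<theta> + cQ\<^sup>2 * (norm (Q (\<iota> (w1 t))))\<^sup>2 \<partial>MT T))"
    unfolding u2_def
  proof (rule energy_backward[OF _ prim_norm_sq[OF T W2]])
    show "AE t in MT T. \<theta> * (norm (w2 t))\<^sup>2 - (2 * \<rho> + 1) * (norm (hval \<iota> T w2 t))\<^sup>2 - ((norm (F3 t))\<^sup>2 / \<theta> + cQ\<^sup>2 * (norm (Q (\<iota> (w1 t))))\<^sup>2)
      \<le> 2 * inner (e2 t) (w2 t)"
      using WE_hval_AE[OF T W2]
    proof eventually_elim
      case (elim t)
      have 1: "2 * inner (F3 t) (w2 t) \<le> \<theta> * (norm (w2 t))\<^sup>2 + (norm (F3 t))\<^sup>2 / \<theta>"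
        using young_inner[OF \<theta>, of "F3 t" "w2 t"] by linarith
      have "- inner (Q (\<iota> (w1 t))) (Q (\<iota> (w2 t))) \<le> norm (Q (\<iota> (w1 t))) * norm (Q (\<iota> (w2 t)))"
        using Cauchy_Schwarz_ineq2[of "Q (\<iota> (w1 t))" "Q (\<iota> (w2 t))"] by linarith
      also have "\<dots> \<le> norm (Q (\<iota> (w1 t))) * (cQ * norm (\<iota> (w2 t)))" by (intro mult_left_mono boundQ) auto
      finally have 2: "- (2 * inner (QQ (w1 t)) (w2 t)) \<le> (norm (\<iota> (w2 t)))\<^sup>2 + cQ\<^sup>2 * (norm (Q (\<iota> (w1 t))))\<^sup>2"
        using young[of 1 "cQ * norm (Q (\<iota> (w1 t)))" "norm (\<iota> (w2 t))"] by (simp add: QQ_inner power_mult_distrib mult_ac)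
      show ?case
        using 1 2 coercive[of "w2 t"] unfolding e2_eq[of t] elim by (simp add: At_inner inner_diff_left algebra_simps)
    qed
  qed (use T \<theta> \<rho> WL F_L2 CQ_L2 in \<open>auto simp: L2spD(2)\<close>)
  then show ?thesis
    using WL F_L2 CQ_L2 by (simp add: L2nrm_sq Eq_def L2spD(2))
qed

text \<open>Testing the two equations crosswise cancels the \<open>A\<close>-terms; all quadratic terms have the same sign.\<close>

lemma cross:
  "Ep + Eb + Eq = inner (u1 T) (G4 T w1 w2) - inner (u1 0) (u2 0)
     - (\<integral>t. inner (F1 t) (w2 t) \<partial>MT T) + (\<integral>t. inner (F3 t) (w1 t) \<partial>MT T)"
proof -
  have i: "integrable (MT T) (\<lambda>t. inner (F1 t) (w2 t))" "integrable (MT T) (\<lambda>t. inner (F3 t) (w1 t))"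
    "integrable (MT T) (\<lambda>t. (norm (C (\<iota> (w2 t))))\<^sup>2)" "integrable (MT T) (\<lambda>t. (norm (Q (\<iota> (w1 t))))\<^sup>2)"
    using L2sp_inner[OF F_L2(1) WL(3)] L2sp_inner[OF F_L2(2) WL(1)] CQ_L2 by (auto simp: L2spD(2))
  have i': "integrable (MT T) (\<lambda>r. inner (e1 r) (w2 r) + inner (e2 r) (w1 r))"
    by (intro Bochner_Integration.integrable_add L2sp_inner WL)
  have "inner (u1 T) (u2 T) - inner (u1 0) (u2 0) = (\<integral>r. inner (e1 r) (w2 r) + inner (e2 r) (w1 r) \<partial>MT T)"
    unfolding u1_def u2_def using WE_product[OF T W1 W2, of 0 T] Iint_full[OF i'] T by simp
  also have "\<dots> = (\<integral>r. inner (F1 r) (w2 r) - inner (F3 r) (w1 r) + (norm (C (\<iota> (w2 r))))\<^sup>2 + (norm (Q (\<iota> (w1 r))))\<^sup>2 \<partial>MT T)"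
    by (intro Bochner_Integration.integral_cong refl)
       (simp add: e1_eq e2_eq inner_add_left inner_diff_left CC_inner QQ_inner At_inner power2_norm_eq_inner)
  also have "\<dots> = (\<integral>t. inner (F1 t) (w2 t) \<partial>MT T) - (\<integral>t. inner (F3 t) (w1 t) \<partial>MT T) + Eb + Eq"
    using i CQ_L2 by (simp add: Eb_def Eq_def L2nrm_sq)
  finally have 1: "inner (u1 T) (u2 T) - inner (u1 0) (u2 0) = \<dots>" .
  have "inner (u1 T) (G4 T w1 w2) = Ep + inner (u1 T) (u2 T)"
    unfolding G4_def Ep_def u1_def u2_def inner_add_right
    by (metis PP_inner inner_commute power2_norm_eq_inner)
  with 1 show ?thesis by simp
qed

lemma apriori: "sqrt (Ysq T w1 e1 w2 e2) \<le> cG T * sqrt (Dsq T w1 e1 w2 e2)"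
proof -
  let ?M = "exp ((2 * \<rho> + 1) * T)"
  let ?D2 = "Dsq T w1 e1 w2 e2" and ?Y2 = "Ysq T w1 e1 w2 e2"
  let ?D = "sqrt ?D2" and ?Y = "sqrt ?Y2"
  define E where "E = Ep + Eb + Eq"
  define S where "S = ?D2 + E"
  have E0: "0 \<le> Ep" "0 \<le> Eb" "0 \<le> Eq" unfolding Ep_def Eb_def Eq_def by auto
  have D0: "0 \<le> ?D2" unfolding Dsq_def by simp
  have Y0: "0 \<le> ?Y2" unfolding Ysq_def by simp
  have S0: "0 \<le> S" unfolding S_def E_def using E0 D0 by simp
  have M1: "1 \<le> ?M" using T \<rho> by simp
  have k0pos: "2 \<le> k0" unfolding k0_def using \<theta> by simp
  have D: "(L2nrm T F1)\<^sup>2 \<le> ?D2" "(norm (u1 0))\<^sup>2 \<le> ?D2" "(L2nrm T F3)\<^sup>2 \<le> ?D2" "(norm (G4 T w1 w2))\<^sup>2 \<le> ?D2"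
    unfolding Dsq_def F1_def F3_def u1_def by auto
  have th: "x / \<theta> \<le> 1 / \<theta> * y" if "x \<le> y" for x y using that \<theta> by (simp add: divide_right_mono)
  have fw: "(norm (u1 T))\<^sup>2 + \<theta> * (L2nrm T w1)\<^sup>2 \<le> ?M * (k0 * S)"
  proof (rule order_trans[OF forward mult_left_mono])
    have "(norm (u1 0))\<^sup>2 + (L2nrm T F1)\<^sup>2 / \<theta> + cC\<^sup>2 * Eb \<le> 1 * S + 1 / \<theta> * S + cC\<^sup>2 * S"
      using D(1,2) E0 D0 th[of "(L2nrm T F1)\<^sup>2" S] unfolding S_def E_def by (intro add_mono mult_left_mono) auto
    also have "\<dots> = (1 + 1 / \<theta> + cC\<^sup>2) * S" by (simp add: algebra_simps)
    also have "\<dots> \<le> k0 * S" unfolding k0_def using S0 by (intro mult_right_mono) auto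
    finally show "(norm (u1 0))\<^sup>2 + ((L2nrm T F1)\<^sup>2 / \<theta> + cC\<^sup>2 * Eb) \<le> k0 * S" by simp
  qed simp
  have bw: "(norm (u2 0))\<^sup>2 + \<theta> * (L2nrm T w2)\<^sup>2 \<le> ?M * (k0 * S)"
  proof (rule order_trans[OF backward mult_left_mono])
    have "u2 T = G4 T w1 w2 + - PP (u1 T)" unfolding G4_def u1_def u2_def by simp
    then have "(norm (u2 T))\<^sup>2 \<le> 2 * (norm (G4 T w1 w2))\<^sup>2 + 2 * (norm (PP (u1 T)))\<^sup>2"
      using sq_sum_le[of "G4 T w1 w2" "- PP (u1 T)"] by simp
    also have "(norm (PP (u1 T)))\<^sup>2 \<le> (cP * norm (P (u1 T)))\<^sup>2" by (intro power_mono norm_PP) auto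
    finally have "(norm (u2 T))\<^sup>2 \<le> 2 * (norm (G4 T w1 w2))\<^sup>2 + 2 * cP\<^sup>2 * Ep"
      by (simp add: power_mult_distrib Ep_def)
    then have "(norm (u2 T))\<^sup>2 + (L2nrm T F3)\<^sup>2 / \<theta> + cQ\<^sup>2 * Eq \<le> 2 * (norm (G4 T w1 w2))\<^sup>2 + 2 * cP\<^sup>2 * Ep + (L2nrm T F3)\<^sup>2 / \<theta> + cQ\<^sup>2 * Eq"
      by simp
    also have "\<dots> \<le> 2 * S + 2 * cP\<^sup>2 * S + 1 / \<theta> * S + cQ\<^sup>2 * S"
      using D(3,4) E0 D0 th[of "(L2nrm T F3)\<^sup>2" S] unfolding S_def E_def by (intro add_mono mult_left_mono) auto
    also have "\<dots> = (2 + 2 * cP\<^sup>2 + 1 / \<theta> + cQ\<^sup>2) * S" by (simp add: algebra_simps)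
    also have "\<dots> \<le> k0 * S" unfolding k0_def using S0 by (intro mult_right_mono) auto
    finally show "(norm (u2 T))\<^sup>2 + ((L2nrm T F3)\<^sup>2 / \<theta> + cQ\<^sup>2 * Eq) \<le> k0 * S" by simp
  qed simp
  \<comment> \<open>Since \<open>?M\<close> is at least 1, bounds by S are also bounds by
    \<open>?R\<close>, so that all later estimates are multiples of \<open>?R\<close>.\<close>
  let ?R = "?M * S"
  have R: "S \<le> ?R" "0 \<le> ?R" using M1 S0 by (simp_all add: mult_le_cancel_right1)
  have MR: "?M * (k0 * S) = k0 * ?R" by simp
  have "0 \<le> \<theta> * (L2nrm T w1)\<^sup>2" "0 \<le> \<theta> * (L2nrm T w2)\<^sup>2" using \<theta> by auto
  then have u: "(norm (u1 T))\<^sup>2 \<le> k0 * ?R" "(norm (u2 0))\<^sup>2 \<le> k0 * ?R"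
    using fw bw unfolding MR by linarith+
  have w: "(L2nrm T w1)\<^sup>2 \<le> k0 / \<theta> * ?R" "(L2nrm T w2)\<^sup>2 \<le> k0 / \<theta> * ?R"
  proof -
    have "\<theta> * (L2nrm T w1)\<^sup>2 \<le> k0 * ?R" "\<theta> * (L2nrm T w2)\<^sup>2 \<le> k0 * ?R"
      using fw bw zero_le_power2[of "norm (u1 T)"] zero_le_power2[of "norm (u2 0)"]
      unfolding MR by linarith+
    then show "(L2nrm T w1)\<^sup>2 \<le> k0 / \<theta> * ?R" "(L2nrm T w2)\<^sup>2 \<le> k0 / \<theta> * ?R"
      using \<theta> by (simp_all add: field_simps)
  qed
  have A: "(L2nrm T (\<lambda>t. A (w1 t)))\<^sup>2 \<le> cA\<^sup>2 * (L2nrm T w1)\<^sup>2"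
    by (rule L2nrm_sq_bound[OF WL(1) L2sp_bl[OF WL(1) blA] boundA])
  have At: "(L2nrm T (\<lambda>t. - adjoint A (w2 t)))\<^sup>2 \<le> cA\<^sup>2 * (L2nrm T w2)\<^sup>2"
    by (rule L2nrm_sq_bound[OF WL(3) L2sp_uminus[OF L2sp_bl[OF WL(3) bl_At]]]) (simp add: norm_At)
  have bC: "(L2nrm T (\<lambda>t. CC (w2 t)))\<^sup>2 \<le> (cC * ci)\<^sup>2 * Eb" unfolding Eb_def
    by (rule L2nrm_sq_bound[OF CQ_L2(1) L2sp_bl[OF WL(3) bl_CC] norm_CC])
  have bQ: "(L2nrm T (\<lambda>t. QQ (w1 t)))\<^sup>2 \<le> (cQ * ci)\<^sup>2 * Eq" unfolding Eq_def
    by (rule L2nrm_sq_bound[OF CQ_L2(2) L2sp_bl[OF WL(1) bl_QQ] norm_QQ])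
  have F3m: "(L2nrm T (\<lambda>t. - F3 t)) = L2nrm T F3" by (rule L2nrm_cong_AE) simp
  have cAw: "cA\<^sup>2 * (L2nrm T w1)\<^sup>2 \<le> cA\<^sup>2 * (k0 / \<theta>) * ?R" "cA\<^sup>2 * (L2nrm T w2)\<^sup>2 \<le> cA\<^sup>2 * (k0 / \<theta>) * ?R"
    using mult_left_mono[OF w(1), of "cA\<^sup>2"] mult_left_mono[OF w(2), of "cA\<^sup>2"] by (simp_all add: mult.assoc)
  have ER: "Eb \<le> ?R" "Eq \<le> ?R" "?D2 \<le> ?R" using R E0 D0 unfolding S_def E_def by linarith+
  \<comment> \<open>Derivatives are not reached by energy arguments; they are read off from the
    equations.\<close>
  have e1: "(L2nrm T e1)\<^sup>2 \<le> (3 + 3 * (cA\<^sup>2 * (k0 / \<theta>)) + 3 * (cC * ci)\<^sup>2) * ?R"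
  proof -
    have "(L2nrm T e1)\<^sup>2 = (L2nrm T (\<lambda>t. F1 t + A (w1 t) + CC (w2 t)))\<^sup>2" by (simp flip: e1_eq)
    also have "\<dots> \<le> 3 * (L2nrm T F1)\<^sup>2 + 3 * (L2nrm T (\<lambda>t. A (w1 t)))\<^sup>2 + 3 * (L2nrm T (\<lambda>t. CC (w2 t)))\<^sup>2"
      by (intro L2nrm_sq_sum3 F_L2 L2sp_bl[OF _ blA] L2sp_bl[OF _ bl_CC] WL)
    also have "\<dots> \<le> 3 * ?R + 3 * (cA\<^sup>2 * (k0 / \<theta>) * ?R) + 3 * ((cC * ci)\<^sup>2 * ?R)"
      by (intro add_mono mult_left_mono order_trans[OF D(1) ER(3)] order_trans[OF A cAw(1)] order_trans[OF bC] mult_left_mono ER) auto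
    finally show ?thesis by (simp add: algebra_simps)
  qed
  have e2: "(L2nrm T e2)\<^sup>2 \<le> (3 + 3 * (cA\<^sup>2 * (k0 / \<theta>)) + 3 * (cQ * ci)\<^sup>2) * ?R"
  proof -
    have "(L2nrm T e2)\<^sup>2 = (L2nrm T (\<lambda>t. - F3 t + - adjoint A (w2 t) + QQ (w1 t)))\<^sup>2"
      by (intro arg_cong[where f="\<lambda>x. x\<^sup>2"] L2nrm_cong_AE AE_I2) (simp add: e2_eq algebra_simps)
    also have "\<dots> \<le> 3 * (L2nrm T (\<lambda>t. - F3 t))\<^sup>2 + 3 * (L2nrm T (\<lambda>t. - adjoint A (w2 t)))\<^sup>2 + 3 * (L2nrm T (\<lambda>t. QQ (w1 t)))\<^sup>2"
      by (intro L2nrm_sq_sum3 L2sp_uminus F_L2 L2sp_bl[OF _ bl_At] L2sp_bl[OF _ bl_QQ] WL)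
    also have "\<dots> \<le> 3 * ?R + 3 * (cA\<^sup>2 * (k0 / \<theta>) * ?R) + 3 * ((cQ * ci)\<^sup>2 * ?R)"
      unfolding F3m
      by (intro add_mono mult_left_mono order_trans[OF D(3) ER(3)] order_trans[OF At cAw(2)] order_trans[OF bQ] mult_left_mono ER) auto
    finally show ?thesis by (simp add: algebra_simps)
  qed
  have Ybound: "?Y2 \<le> k1 * ?R"
  proof -
    have "?Y2 \<le> k0 / \<theta> * ?R + (3 + 3 * (cA\<^sup>2 * (k0 / \<theta>)) + 3 * (cC * ci)\<^sup>2) * ?R + k0 / \<theta> * ?R
       + (3 + 3 * (cA\<^sup>2 * (k0 / \<theta>)) + 3 * (cQ * ci)\<^sup>2) * ?R + k0 * ?R + k0 * ?R"
      unfolding Ysq_def by (intro add_mono w e1 e2 u[unfolded u1_def u2_def])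
    also have "\<dots> = k1 * ?R" unfolding k1_def by (simp add: algebra_simps)
    finally show ?thesis .
  qed
  have Ebound: "E \<le> 4 * (?D * ?Y)"
  proof -
    have sD: "L2nrm T F1 \<le> ?D" "norm (u1 0) \<le> ?D" "L2nrm T F3 \<le> ?D" "norm (G4 T w1 w2) \<le> ?D"
      using D by (auto intro: real_le_rsqrt)
    have sY: "L2nrm T w1 \<le> ?Y" "L2nrm T w2 \<le> ?Y" "norm (u1 T) \<le> ?Y" "norm (u2 0) \<le> ?Y"
      unfolding Ysq_def u1_def u2_def by (auto intro!: real_le_rsqrt)
    have prods: "x * y \<le> ?D * ?Y" if "x \<le> ?D" "y \<le> ?Y" "0 \<le> y" for x y
      using that D0 by (intro mult_mono) auto
    have "E \<le> \<bar>inner (u1 T) (G4 T w1 w2)\<bar> + \<bar>inner (u1 0) (u2 0)\<bar> + \<bar>\<integral>t. inner (F1 t) (w2 t) \<partial>MT T\<bar> + \<bar>\<integral>t. inner (F3 t) (w1 t) \<partial>MT T\<bar>"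
      unfolding E_def cross by linarith
    also have "\<dots> \<le> norm (u1 T) * norm (G4 T w1 w2) + norm (u1 0) * norm (u2 0) + L2nrm T F1 * L2nrm T w2 + L2nrm T F3 * L2nrm T w1"
      by (intro add_mono Cauchy_Schwarz_ineq2 L2_inner_le F_L2 WL)
    also have "\<dots> \<le> ?D * ?Y + ?D * ?Y + ?D * ?Y + ?D * ?Y"
      using prods[OF sD(4) sY(3)] prods[OF sD(2) sY(4)] prods[OF sD(1) sY(2)] prods[OF sD(3) sY(1)]
      by (simp add: mult.commute)
    finally show ?thesis by (simp add: mult.commute)
  qed
  define L where "L = k1 * ?M"
  have k1pos: "6 \<le> k1" unfolding k1_def using k0pos \<theta> by simp
  have L1: "1 \<le> L" unfolding L_def using mult_mono[of 1 k1 1 ?M] k1pos M1 by simp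
  have Yq: "?Y\<^sup>2 \<le> L * (?D\<^sup>2 + 4 * (?D * ?Y))"
  proof -
    have "?Y\<^sup>2 = ?Y2" using Y0 by simp
    also have "\<dots> \<le> L * S" using Ybound unfolding L_def by (simp add: mult.assoc)
    also have "\<dots> \<le> L * (?D\<^sup>2 + 4 * (?D * ?Y))"
      using Ebound D0 L1 unfolding S_def by (intro mult_left_mono) auto
    finally show ?thesis .
  qed
  have "?Y \<le> 6 * L * ?D"
  \<comment> \<open>If Y > 6 L D, then D \<le> L D \<le> Y because L is at least 1, so L D^2 + 4 L D
    Y \<le> 5 L D Y, which is below Y^2.\<close>
  proof (rule ccontr)
    assume "\<not> ?Y \<le> 6 * L * ?D"
    then have less: "6 * (L * ?D) < ?Y" by simp
    have LD0: "0 \<le> L * ?D" using L1 D0 by simp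
    then have Ypos: "0 < ?Y" using less by linarith
    have "6 * (L * ?D) * ?Y < ?Y * ?Y" using less Ypos by (rule mult_strict_right_mono)
    moreover have "L * ?D * ?D \<le> L * ?D * ?Y"
    proof -
      have "?D \<le> L * ?D" using L1 D0 by (simp add: mult_le_cancel_right1)
      then have "?D \<le> ?Y" using less LD0 by linarith
      then show ?thesis using LD0 by (rule mult_left_mono)
    qed
    moreover have "0 \<le> L * ?D * ?Y" using LD0 Ypos by simp
    ultimately show False using Yq by (simp add: power2_eq_square algebra_simps)
  qed
  then show ?thesis unfolding cG_def L_def by (simp add: mult.assoc)
qed

end

end

section \<open>Existence and uniqueness\<close>

text \<open>The weak form holds for \<psi> with arbitrary end values. Compactly supported \<psi>
  identify the derivative; comparison with integration by parts for other \<psi> then identifies the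
  traces.\<close>

lemma (in gelfand) WE_of_weak_form:
  assumes T: "0 < T" and w: "w \<in> L2sp T" and e: "e \<in> L2sp T"
    and weak: "\<And>\<psi> \<psi>' v. \<lbrakk>\<And>t. (\<psi> has_real_derivative \<psi>' t) (at t); continuous_on UNIV \<psi>'\<rbrakk> \<Longrightarrow>
      (\<integral>t. inner (e t) (\<psi> t *\<^sub>R v) + inner (\<psi>' t *\<^sub>R K v) (w t) \<partial>MT T) = \<psi> T * inner hT (\<iota> v) - \<psi> 0 * inner h0 (\<iota> v)"
  shows "WE T w e" "hval \<iota> T w T = hT" "hval \<iota> T w 0 = h0"
proof -
  have "is_wderiv \<iota> T w (\<lambda>t. unriesz (e t))"
    unfolding is_wderiv_def
  proof (intro allI impI)
    fix \<phi> v assume "testfun T \<phi>"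
    note tf = testfun_deriv[OF this]
    note S = WE_L2[OF WE_scaled_const(1)[OF tf(1,2), of T v]]
    have i: "integrable (MT T) (\<lambda>t. inner (e t) (\<phi> t *\<^sub>R v))" "integrable (MT T) (\<lambda>t. inner (deriv \<phi> t *\<^sub>R K v) (w t))"
      by (intro L2sp_inner e w S)+
    have "(\<integral>t. inner (e t) (\<phi> t *\<^sub>R v) \<partial>MT T) + (\<integral>t. inner (deriv \<phi> t *\<^sub>R K v) (w t) \<partial>MT T) = 0"
      using weak[OF tf(1,2), of v] tf(3,4) i by simp
    moreover have "(\<integral>t. inner (e t) (\<phi> t *\<^sub>R v) \<partial>MT T) = (\<integral>t. blinfun_apply (unriesz (e t)) v * \<phi> t \<partial>MT T)"
      by (intro Bochner_Integration.integral_cong refl) (simp add: unriesz_apply inner_commute mult.commute)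
    moreover have "(\<integral>t. inner (deriv \<phi> t *\<^sub>R K v) (w t) \<partial>MT T) = (\<integral>t. inner (\<iota> (w t)) (\<iota> v) * deriv \<phi> t \<partial>MT T)"
      by (intro Bochner_Integration.integral_cong refl) (simp add: K_inner inner_commute mult.commute)
    ultimately show "(\<integral>t. inner (\<iota> (w t)) (\<iota> v) * deriv \<phi> t \<partial>MT T) = - (\<integral>t. blinfun_apply (unriesz (e t)) v * \<phi> t \<partial>MT T)"
      by simp
  qed
  from is_wderiv_imp_WE[OF T w L2sp_bl[OF e bounded_linear_unriesz] this]
  show W: "WE T w e" by simp
  have main: "\<psi> T * inner (hval \<iota> T w T - hT) (\<iota> v) = \<psi> 0 * inner (hval \<iota> T w 0 - h0) (\<iota> v)"
    if d: "\<And>t. (\<psi> has_real_derivative \<psi>' t) (at t)" "continuous_on UNIV \<psi>'" for \<psi> \<psi>' v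
  proof -
    note S = WE_scaled_const(1)[OF d, of T v]
    have i: "integrable (MT T) (\<lambda>t. inner (e t) (\<psi> t *\<^sub>R v) + inner (\<psi>' t *\<^sub>R K v) (w t))"
      by (intro Bochner_Integration.integrable_add L2sp_inner e w WE_L2[OF S])
    show ?thesis
      using WE_product[OF T W S, of 0 T] WE_scaled_const(2)[OF d T, of 0 v] WE_scaled_const(2)[OF d T, of T v] weak[OF d, of v] Iint_full[OF i] T
      by (simp add: inner_diff_left algebra_simps)
  qed
  \<comment> \<open>The function \<psi> t = t vanishes at 0 and isolates the value at T; the
    constant 1 then yields the value at 0.\<close>
  have "T * inner (hval \<iota> T w T - hT) (\<iota> v) = 0" for v
    using main[of "\<lambda>t. t" "\<lambda>_. 1" v] by simp
  then have "inner (\<iota> v) (hval \<iota> T w T - hT) = 0" for v using T by (simp add: inner_commute)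
  then show hT: "hval \<iota> T w T = hT" using inner_iota_eq0 by (metis eq_iff_diff_eq_0)
  have "inner (\<iota> v) (hval \<iota> T w 0 - h0) = 0" for v
    using main[of "\<lambda>t. 1" "\<lambda>_. 0" v] hT by (simp add: inner_commute)
  then show "hval \<iota> T w 0 = h0" using inner_iota_eq0 by (metis eq_iff_diff_eq_0)
qed

text \<open>The squared norm at t exceeds that at any s by at most the squared W_T norm; averaging
  over s gives the bound. The factor 1/T makes it unsuitable for \<open>cG\<close>; it serves for
  boundedness of the operator, where T is fixed.\<close>

lemma (in gelfand) hval_bound:
  assumes T: "0 < T" and W: "WE T w e" and t: "t \<in> {0..T}" and ci: "\<And>v. norm (\<iota> v) \<le> ci * norm v"
  shows "(norm (hval \<iota> T w t))\<^sup>2 \<le> (ci\<^sup>2 / T + 1) * ((L2nrm T w)\<^sup>2 + (L2nrm T e)\<^sup>2)"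
proof -
  define y where "y t = (norm (hval \<iota> T w t))\<^sup>2" for t
  let ?X = "(L2nrm T w)\<^sup>2 + (L2nrm T e)\<^sup>2"
  note L = WE_L2[OF W]
  have i: "integrable (MT T) (\<lambda>r. norm (2 * inner (e r) (w r)))" using L2sp_inner[OF L(2,1)] by simp
  have inc: "\<bar>y b - y a\<bar> \<le> ?X" if "0 \<le> a" "a \<le> b" "b \<le> T" for a b
  proof -
    have "norm (y b - y a) \<le> Iint T (\<lambda>r. norm (2 * inner (e r) (w r))) a b"
      unfolding y_def by (rule prim_norm[OF prim_norm_sq[OF T W] that])
    also have "\<dots> \<le> (\<integral>r. norm (2 * inner (e r) (w r)) \<partial>MT T)"
      by (rule Iint_le_full[OF i]) (use that in auto)
    also have "\<dots> \<le> (\<integral>r. (norm (w r))\<^sup>2 + (norm (e r))\<^sup>2 \<partial>MT T)"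
      by (rule integral_mono[OF i]) (use L young_inner[of 1] in \<open>auto simp: L2spD(2)\<close>)
    also have "\<dots> = ?X" using L by (simp add: L2nrm_sq L2spD(2))
    finally show ?thesis by simp
  qed
  have yc: "y t \<le> y s + ?X" if "s \<in> {0..T}" for s
    using inc[of s t] inc[of t s] that t by (cases "s \<le> t") auto
  have cy: "continuous_on {0..T} y" unfolding y_def
    by (intro continuous_intros WE_hval_continuous[OF T W])
  have iy: "integrable (MT T) y"
    using L2sp_inner_const[OF L2sp_continuous[OF cy], of 1] by simp
  have "T * (y t - ?X) = (\<integral>s. y t - ?X \<partial>MT T)" using T by (simp add: measure_restrict_space)
  also have "\<dots> \<le> (\<integral>s. y s \<partial>MT T)"
    by (rule integral_mono[OF MT_const_integrable iy]) (use yc in force)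
  also have "\<dots> = (\<integral>s. (norm (\<iota> (w s)))\<^sup>2 \<partial>MT T)"
  proof (rule integral_cong_AE)
    show "AE s in MT T. y s = (norm (\<iota> (w s)))\<^sup>2"
      using WE_hval_AE[OF T W] by eventually_elim (simp add: y_def)
  qed (use iy L2spD(2)[OF L2sp_iota[OF L(1)]] in auto)
  also have "\<dots> = (L2nrm T (\<lambda>s. \<iota> (w s)))\<^sup>2" by (simp add: L2nrm_sq L2sp_iota L(1))
  also have "\<dots> \<le> ci\<^sup>2 * (L2nrm T w)\<^sup>2" by (rule L2nrm_sq_bound[OF L(1) L2sp_iota[OF L(1)] ci])
  also have "\<dots> \<le> ci\<^sup>2 * ?X" by (intro mult_left_mono) auto
  finally have "T * y t \<le> (ci\<^sup>2 + T) * ?X" by (simp add: algebra_simps)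
  then have "y t \<le> (ci\<^sup>2 + T) * ?X / T" using T by (simp add: field_simps)
  also have "\<dots> = (ci\<^sup>2 / T + 1) * ?X" using T by (simp add: field_simps)
  finally show ?thesis unfolding y_def .
qed

section \<open>Boundedness of the operator and properties of the constant\<close>

context saddle begin

lemma k1_ge: "6 \<le> k1"
  unfolding k1_def k0_def using \<theta> by simp

lemma cG_props: "continuous_on {0<..} cG" "mono_on {0<..} cG" "0 < cG T"
proof -
  have k: "0 < k1" using k1_ge by simp
  show "continuous_on {0<..} cG" unfolding cG_def by (intro continuous_intros)
  show "mono_on {0<..} cG" unfolding cG_def using k \<rho> by (intro mono_onI mult_left_mono) (auto intro: mult_left_mono)
  show "0 < cG T" unfolding cG_def using k by simp
qed

lemma Dsq_bounded:
  assumes T: "0 < T"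
  obtains M where "\<And>w1 e1 w2 e2. WE T w1 e1 \<Longrightarrow> WE T w2 e2 \<Longrightarrow>
    Dsq T w1 e1 w2 e2 \<le> M * ((L2nrm T w1)\<^sup>2 + (L2nrm T e1)\<^sup>2 + (L2nrm T w2)\<^sup>2 + (L2nrm T e2)\<^sup>2)"
proof -
  obtain cCC where cCC: "\<And>v. norm (CC v) \<le> norm v * cCC" using bounded_linear.bounded[OF bl_CC] by blast
  obtain cQQ where cQQ: "\<And>v. norm (QQ v) \<le> norm v * cQQ" using bounded_linear.bounded[OF bl_QQ] by blast
  obtain cPP where cPP: "\<And>v. norm (PP v) \<le> norm v * cPP" using bounded_linear.bounded[OF bl_PP] by blast
  let ?h = "ci\<^sup>2 / T + 1"
  show ?thesis
  proof (rule that)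
    fix w1 e1 w2 e2 assume W: "WE T w1 e1" "WE T w2 e2"
    let ?X = "(L2nrm T w1)\<^sup>2 + (L2nrm T e1)\<^sup>2 + (L2nrm T w2)\<^sup>2 + (L2nrm T e2)\<^sup>2"
    note L = WE_L2[OF W(1)] WE_L2[OF W(2)]
    have X: "(L2nrm T w1)\<^sup>2 \<le> ?X" "(L2nrm T e1)\<^sup>2 \<le> ?X" "(L2nrm T w2)\<^sup>2 \<le> ?X" "(L2nrm T e2)\<^sup>2 \<le> ?X"
      and X2: "(L2nrm T w1)\<^sup>2 + (L2nrm T e1)\<^sup>2 \<le> ?X" "(L2nrm T w2)\<^sup>2 + (L2nrm T e2)\<^sup>2 \<le> ?X" and X0: "0 \<le> ?X" by auto
    have h0: "0 \<le> ?h" using T by simp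
    have h: "(norm (hval \<iota> T w1 t))\<^sup>2 \<le> ?h * ?X" "(norm (hval \<iota> T w2 t))\<^sup>2 \<le> ?h * ?X" if "t \<in> {0..T}" for t
      using hval_bound[OF T W(1) that boundi] hval_bound[OF T W(2) that boundi]
        mult_left_mono[OF X2(1) h0] mult_left_mono[OF X2(2) h0] by linarith+
    have bd: "(L2nrm T (\<lambda>t. F (w t)))\<^sup>2 \<le> c\<^sup>2 * ?X"
      if "bounded_linear F" "\<And>v. norm (F v) \<le> c * norm v" "w \<in> L2sp T" "(L2nrm T w)\<^sup>2 \<le> ?X" for F :: "'v \<Rightarrow> 'v" and c w
      using L2nrm_sq_bound[OF that(3) L2sp_bl[OF that(3,1)] that(2)] mult_left_mono[OF that(4), of "c\<^sup>2"] by simp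
    have neg: "bounded_linear (\<lambda>v. - F v)" if "bounded_linear F" for F :: "'v \<Rightarrow> 'v"
      using that by (rule bounded_linear_minus)
    have 1: "(L2nrm T (G1 e1 w1 w2))\<^sup>2 \<le> 3 * ?X + 3 * (cA\<^sup>2 * ?X) + 3 * (cCC\<^sup>2 * ?X)"
    proof -
      have "G1 e1 w1 w2 = (\<lambda>t. e1 t + - A (w1 t) + - CC (w2 t))" by (simp add: G1_def fun_eq_iff)
      then have "(L2nrm T (G1 e1 w1 w2))\<^sup>2 \<le> 3 * (L2nrm T e1)\<^sup>2 + 3 * (L2nrm T (\<lambda>t. - A (w1 t)))\<^sup>2 + 3 * (L2nrm T (\<lambda>t. - CC (w2 t)))\<^sup>2"
        using L2nrm_sq_sum3[OF L(2) L2sp_bl[OF L(1) neg[OF blA]] L2sp_bl[OF L(3) neg[OF bl_CC]]] by simp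
      also have "\<dots> \<le> 3 * ?X + 3 * (cA\<^sup>2 * ?X) + 3 * (cCC\<^sup>2 * ?X)"
        by (intro add_mono mult_left_mono X bd neg blA bl_CC L) (use boundA cCC in \<open>auto simp: mult.commute\<close>)
      finally show ?thesis .
    qed
    have 3: "(L2nrm T (G3 w1 e2 w2))\<^sup>2 \<le> 3 * (cQQ\<^sup>2 * ?X) + 3 * ?X + 3 * (cA\<^sup>2 * ?X)"
    proof -
      have "G3 w1 e2 w2 = (\<lambda>t. QQ (w1 t) + - e2 t + - adjoint A (w2 t))" by (simp add: G3_def fun_eq_iff)
      then have "(L2nrm T (G3 w1 e2 w2))\<^sup>2 \<le> 3 * (L2nrm T (\<lambda>t. QQ (w1 t)))\<^sup>2 + 3 * (L2nrm T (\<lambda>t. - e2 t))\<^sup>2 + 3 * (L2nrm T (\<lambda>t. - adjoint A (w2 t)))\<^sup>2"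
        using L2nrm_sq_sum3[OF L2sp_bl[OF L(1) bl_QQ] L2sp_uminus[OF L(4)] L2sp_bl[OF L(3) neg[OF bl_At]]] by simp
      also have "L2nrm T (\<lambda>t. - e2 t) = L2nrm T e2" by (rule L2nrm_cong_AE) simp
      also have "3 * (L2nrm T (\<lambda>t. QQ (w1 t)))\<^sup>2 + 3 * (L2nrm T e2)\<^sup>2 + 3 * (L2nrm T (\<lambda>t. - adjoint A (w2 t)))\<^sup>2
          \<le> 3 * (cQQ\<^sup>2 * ?X) + 3 * ?X + 3 * (cA\<^sup>2 * ?X)"
        by (intro add_mono mult_left_mono X bd neg bl_At bl_QQ L) (use norm_At cQQ in \<open>auto simp: mult.commute\<close>)
      finally show ?thesis .
    qed
    have 4: "(norm (G4 T w1 w2))\<^sup>2 \<le> 2 * (cPP\<^sup>2 * (?h * ?X)) + 2 * (?h * ?X)"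
    proof -
      have "(norm (PP (hval \<iota> T w1 T)))\<^sup>2 \<le> (norm (hval \<iota> T w1 T) * cPP)\<^sup>2" by (intro power_mono cPP) auto
      also have "\<dots> \<le> cPP\<^sup>2 * (?h * ?X)"
        using h(1)[of T] T by (simp only: power_mult_distrib mult.commute[of _ "cPP\<^sup>2"]) (intro mult_left_mono; simp)
      finally show ?thesis
        using sq_sum_le[of "PP (hval \<iota> T w1 T)" "hval \<iota> T w2 T"] h(2)[of T] T unfolding G4_def by simp
    qed
    have "Dsq T w1 e1 w2 e2 \<le> (3 * ?X + 3 * (cA\<^sup>2 * ?X) + 3 * (cCC\<^sup>2 * ?X)) + ?h * ?X + (3 * (cQQ\<^sup>2 * ?X) + 3 * ?X + 3 * (cA\<^sup>2 * ?X)) + (2 * (cPP\<^sup>2 * (?h * ?X)) + 2 * (?h * ?X))"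
      unfolding Dsq_def by (intro add_mono 1 3 4 h) (use T in auto)
    also have "\<dots> = (6 + 6 * cA\<^sup>2 + 3 * cCC\<^sup>2 + 3 * cQQ\<^sup>2 + 3 * ?h + 2 * cPP\<^sup>2 * ?h) * ?X" by algebra
    finally show "Dsq T w1 e1 w2 e2 \<le> (6 + 6 * cA\<^sup>2 + 3 * cCC\<^sup>2 + 3 * cQQ\<^sup>2 + 3 * ?h + 2 * cPP\<^sup>2 * ?h) * ?X" .
  qed
qed

section \<open>Linearity of the operator\<close>

lemma G1_lincomb: "G1 (\<lambda>t. c *\<^sub>R e t + d *\<^sub>R e' t) (\<lambda>t. c *\<^sub>R w t + d *\<^sub>R w' t) (\<lambda>t. c *\<^sub>R x t + d *\<^sub>R x' t) t
    = c *\<^sub>R G1 e w x t + d *\<^sub>R G1 e' w' x' t"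
  using bounded_linear.linear[OF blA] bounded_linear.linear[OF bl_CC]
  by (simp add: G1_def linear_add linear_scale algebra_simps)

lemma G3_lincomb: "G3 (\<lambda>t. c *\<^sub>R w t + d *\<^sub>R w' t) (\<lambda>t. c *\<^sub>R e t + d *\<^sub>R e' t) (\<lambda>t. c *\<^sub>R x t + d *\<^sub>R x' t) t
    = c *\<^sub>R G3 w e x t + d *\<^sub>R G3 w' e' x' t"
  using bounded_linear.linear[OF bl_At] bounded_linear.linear[OF bl_QQ]
  by (simp add: G3_def linear_add linear_scale algebra_simps)

lemma G4_lincomb:
  assumes "0 < T" "WE T w1 e1" "WE T w1' e1'" "WE T w2 e2" "WE T w2' e2'"
  shows "G4 T (\<lambda>t. c *\<^sub>R w1 t + d *\<^sub>R w1' t) (\<lambda>t. c *\<^sub>R w2 t + d *\<^sub>R w2' t) = c *\<^sub>R G4 T w1 w2 + d *\<^sub>R G4 T w1' w2'"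
  using bounded_linear.linear[OF bl_PP] hval_lincomb[OF assms(1,2,3), of T c d] hval_lincomb[OF assms(1,4,5), of T c d] assms(1)
  by (simp add: G4_def linear_add linear_scale algebra_simps)

text \<open>Interchanging the two components turns the operator into its own formal adjoint. Hence a very weak
  solution, i.e. a Riesz representative of the data functional on the range of the operator, exists by
  the a priori bound; testing with \<open>\<psi> t *\<^sub>R v\<close> shows that it is a solution.\<close>

lemma very_weak_solution:
  assumes T: "0 < T" and f: "f \<in> L2sp T" and g: "g \<in> L2sp T"
  obtains p q z0 z where "p \<in> L2sp T" "q \<in> L2sp T"
    "\<And>a1 b1 a2 b2. WE T a1 b1 \<Longrightarrow> WE T a2 b2 \<Longrightarrow>
      (\<integral>t. inner (p t) (G1 b1 a1 a2 t) \<partial>MT T) + inner z0 (hval \<iota> T a1 0)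
        + (\<integral>t. inner (q t) (G3 a1 b2 a2 t) \<partial>MT T) + inner z (G4 T a1 a2)
      = (\<integral>t. inner (f t) (a2 t) \<partial>MT T) + (\<integral>t. inner (g t) (a1 t) \<partial>MT T)
        + inner yT (hval \<iota> T a1 T) + inner y0 (hval \<iota> T a2 0)"
proof -
  \<comment> \<open>Derivatives are carried along as separate components, so that linear
    combinations are formed componentwise without the choice hidden in
    \<open>wderiv\<close>.\<close>
  define S where "S = {(a1, b1, a2, b2). WE T a1 b1 \<and> WE T a2 b2}"
  define g1 where "g1 = (\<lambda>(a1, b1, a2, b2 :: real \<Rightarrow> 'v). G1 b1 a1 a2)"
  define g2 where "g2 = (\<lambda>(a1, b1 :: real \<Rightarrow> 'v, a2 :: real \<Rightarrow> 'v, b2 :: real \<Rightarrow> 'v). hval \<iota> T a1 0)"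
  define g3 where "g3 = (\<lambda>(a1, b1 :: real \<Rightarrow> 'v, a2, b2). G3 a1 b2 a2)"
  define g4 where "g4 = (\<lambda>(a1, b1 :: real \<Rightarrow> 'v, a2, b2 :: real \<Rightarrow> 'v). G4 T a1 a2)"
  define ip where "ip x y = (\<integral>t. inner (g1 x t) (g1 y t) \<partial>MT T) + inner (g2 x) (g2 y)
    + (\<integral>t. inner (g3 x t) (g3 y t) \<partial>MT T) + inner (g4 x) (g4 y)" for x y
  define l where "l = (\<lambda>(a1, b1 :: real \<Rightarrow> 'v, a2, b2 :: real \<Rightarrow> 'v). (\<integral>t. inner (f t) (a2 t) \<partial>MT T) + (\<integral>t. inner (g t) (a1 t) \<partial>MT T)
        + inner yT (hval \<iota> T a1 T) + inner y0 (hval \<iota> T a2 0))"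
  have gL: "g1 x \<in> L2sp T" "g3 x \<in> L2sp T" if "x \<in> S" for x
    using that unfolding S_def g1_def g3_def by (auto intro!: G1_L2 G3_L2 dest: WE_L2)
  have ipD: "ip (a1, b1, a2, b2) (a1, b1, a2, b2) = Dsq T a1 b1 a2 b2" if "WE T a1 b1" "WE T a2 b2" for a1 b1 a2 b2
    unfolding ip_def g1_def g2_def g3_def g4_def Dsq_def
    using G1_L2[OF WE_L2(2,1)[OF that(1)] WE_L2(1)[OF that(2)]] G3_L2[OF WE_L2(1)[OF that(1)] WE_L2(2,1)[OF that(2)]]
    by (simp add: L2nrm_sq power2_norm_eq_inner)
  \<comment> \<open>The end values in \<open>l\<close> are the two contained in \<open>Ysq\<close>,
    so the a priori estimate gives continuity of \<open>l\<close> with respect to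
    \<open>ip\<close>.\<close>
  have lbound: "\<bar>l x\<bar> \<le> ((L2nrm T f + L2nrm T g + norm yT + norm y0) * cG T) * sqrt (ip x x)" if xS: "x \<in> S" for x
  proof -
    obtain a1 b1 a2 b2 where x: "x = (a1, b1, a2, b2)" "WE T a1 b1" "WE T a2 b2" using xS unfolding S_def by auto
    let ?Y = "sqrt (Ysq T a1 b1 a2 b2)"
    have Y: "L2nrm T a1 \<le> ?Y" "L2nrm T a2 \<le> ?Y" "norm (hval \<iota> T a1 T) \<le> ?Y" "norm (hval \<iota> T a2 0) \<le> ?Y"
      unfolding Ysq_def by (auto intro!: real_le_rsqrt)
    have "\<bar>l x\<bar> \<le> \<bar>\<integral>t. inner (f t) (a2 t) \<partial>MT T\<bar> + \<bar>\<integral>t. inner (g t) (a1 t) \<partial>MT T\<bar>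
        + \<bar>inner yT (hval \<iota> T a1 T)\<bar> + \<bar>inner y0 (hval \<iota> T a2 0)\<bar>"
      unfolding l_def x(1) by simp
    also have "\<dots> \<le> L2nrm T f * L2nrm T a2 + L2nrm T g * L2nrm T a1 + norm yT * norm (hval \<iota> T a1 T) + norm y0 * norm (hval \<iota> T a2 0)"
      by (intro add_mono Cauchy_Schwarz_ineq2 L2_inner_le f g WE_L2[OF x(2)] WE_L2[OF x(3)])
    also have "\<dots> \<le> L2nrm T f * ?Y + L2nrm T g * ?Y + norm yT * ?Y + norm y0 * ?Y"
      by (intro add_mono mult_left_mono Y) auto
    also have "\<dots> = (L2nrm T f + L2nrm T g + norm yT + norm y0) * ?Y" by (simp add: algebra_simps)
    also have "\<dots> \<le> (L2nrm T f + L2nrm T g + norm yT + norm y0) * (cG T * sqrt (ip x x))"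
      unfolding x(1) ipD[OF x(2,3)] by (intro mult_left_mono apriori[OF T x(2,3)]) auto
    finally show ?thesis by (simp add: mult.assoc)
  qed
  obtain s where sS: "\<And>n. s n \<in> S"
    and sC: "\<And>e. e > 0 \<Longrightarrow> \<exists>N. \<forall>m\<ge>N. \<forall>n\<ge>N. ip (s m) (s m) - 2 * ip (s m) (s n) + ip (s n) (s n) < e"
    and sl: "\<And>x. x \<in> S \<Longrightarrow> (\<lambda>n. ip (s n) x) \<longlonglongrightarrow> l x"
  proof (rule riesz_minimizing_sequence[of S l ip "(L2nrm T f + L2nrm T g + norm yT + norm y0) * cG T"])
    have "WE T (\<lambda>t. 0 *\<^sub>R 0) (\<lambda>t. 0 *\<^sub>R K 0)"
      by (rule WE_scaled_const(1)) (auto intro!: derivative_eq_intros)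
    then show "S \<noteq> {}" unfolding S_def by blast
    fix x y :: "(real \<Rightarrow> 'v) \<times> (real \<Rightarrow> 'v) \<times> (real \<Rightarrow> 'v) \<times> (real \<Rightarrow> 'v)" and c d :: real
    assume xS: "x \<in> S"
    show "0 \<le> ip x x" unfolding ip_def by (intro add_nonneg_nonneg integral_nonneg_AE) auto
    show "\<bar>l x\<bar> \<le> (L2nrm T f + L2nrm T g + norm yT + norm y0) * cG T * sqrt (ip x x)" by (rule lbound[OF xS])
    assume yS: "y \<in> S"
    show "ip x y = ip y x" unfolding ip_def by (simp add: inner_commute)
    obtain a1 b1 a2 b2 where x: "x = (a1, b1, a2, b2)" "WE T a1 b1" "WE T a2 b2" using xS unfolding S_def by auto
    obtain a1' b1' a2' b2' where y: "y = (a1', b1', a2', b2')" "WE T a1' b1'" "WE T a2' b2'" using yS unfolding S_def by auto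
    let ?z = "(\<lambda>t. c *\<^sub>R a1 t + d *\<^sub>R a1' t, \<lambda>t. c *\<^sub>R b1 t + d *\<^sub>R b1' t, \<lambda>t. c *\<^sub>R a2 t + d *\<^sub>R a2' t, \<lambda>t. c *\<^sub>R b2 t + d *\<^sub>R b2' t)"
    have zS: "?z \<in> S" unfolding S_def using WE_lincomb[OF x(2) y(2)] WE_lincomb[OF x(3) y(3)] by simp
    have gz: "g1 ?z t = c *\<^sub>R g1 x t + d *\<^sub>R g1 y t" "g2 ?z = c *\<^sub>R g2 x + d *\<^sub>R g2 y"
      "g3 ?z t = c *\<^sub>R g3 x t + d *\<^sub>R g3 y t" "g4 ?z = c *\<^sub>R g4 x + d *\<^sub>R g4 y" for t
      unfolding g1_def g2_def g3_def g4_def x(1) y(1)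
      using T by (simp_all add: G1_lincomb G3_lincomb G4_lincomb[OF T x(2) y(2) x(3) y(3)] hval_lincomb[OF T x(2) y(2)])
    have "ip ?z u = c * ip x u + d * ip y u" if "u \<in> S" for u
      unfolding ip_def gz using gL[OF xS] gL[OF yS] gL[OF that]
      by (simp add: inner_add_left L2sp_inner algebra_simps)
    moreover have "l ?z = c * l x + d * l y"
      unfolding l_def x(1) y(1) prod.case
      using T WE_L2[OF x(2)] WE_L2[OF x(3)] WE_L2[OF y(2)] WE_L2[OF y(3)] f g
      by (simp add: hval_lincomb[OF T x(2) y(2)] hval_lincomb[OF T x(3) y(3)] inner_add_right L2sp_inner algebra_simps)
    ultimately show "\<exists>z\<in>S. l z = c * l x + d * l y \<and> (\<forall>u\<in>S. ip z u = c * ip x u + d * ip y u)"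
      using zS by blast
  qed blast
  \<comment> \<open>A Cauchy sequence for \<open>ip\<close> is thus Cauchy in each of the four
    components of the data space, where limits exist.\<close>
  have split: "ip (s m) (s m) - 2 * ip (s m) (s n) + ip (s n) (s n)
    = (L2nrm T (\<lambda>t. g1 (s m) t - g1 (s n) t))\<^sup>2 + (norm (g2 (s m) - g2 (s n)))\<^sup>2
      + (L2nrm T (\<lambda>t. g3 (s m) t - g3 (s n) t))\<^sup>2 + (norm (g4 (s m) - g4 (s n)))\<^sup>2" for m n
  proof -
    have sq: "(L2nrm T (\<lambda>t. h t - k t))\<^sup>2 = (\<integral>t. inner (h t) (h t) \<partial>MT T) - 2 * (\<integral>t. inner (h t) (k t) \<partial>MT T) + (\<integral>t. inner (k t) (k t) \<partial>MT T)"
      if "h \<in> L2sp T" "k \<in> L2sp T" for h k :: "real \<Rightarrow> 'v"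
      using L2sp_diff[OF that] L2sp_inner[OF that(1,1)] L2sp_inner[OF that(1,2)] L2sp_inner[OF that(2,2)]
      by (simp add: L2nrm_sq norm_diff_sq)
    show ?thesis
      unfolding ip_def sq[OF gL(1)[OF sS] gL(1)[OF sS]] sq[OF gL(2)[OF sS] gL(2)[OF sS]] norm_diff_sq by simp
  qed
  have C4: "\<exists>N. \<forall>m\<ge>N. \<forall>n\<ge>N. (L2nrm T (\<lambda>t. g1 (s m) t - g1 (s n) t))\<^sup>2 < e \<and> (norm (g2 (s m) - g2 (s n)))\<^sup>2 < e
      \<and> (L2nrm T (\<lambda>t. g3 (s m) t - g3 (s n) t))\<^sup>2 < e \<and> (norm (g4 (s m) - g4 (s n)))\<^sup>2 < e" if e: "e > 0" for e
  proof -
    obtain N where N: "\<And>m n. m \<ge> N \<Longrightarrow> n \<ge> N \<Longrightarrow> ip (s m) (s m) - 2 * ip (s m) (s n) + ip (s n) (s n) < e"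
      using sC[OF e] by blast
    show ?thesis
    proof (intro exI[of _ N] allI impI)
      fix m n assume "m \<ge> N" "n \<ge> N"
      from N[OF this] show "(L2nrm T (\<lambda>t. g1 (s m) t - g1 (s n) t))\<^sup>2 < e \<and> (norm (g2 (s m) - g2 (s n)))\<^sup>2 < e
        \<and> (L2nrm T (\<lambda>t. g3 (s m) t - g3 (s n) t))\<^sup>2 < e \<and> (norm (g4 (s m) - g4 (s n)))\<^sup>2 < e"
        unfolding split
        using zero_le_power2[of "L2nrm T (\<lambda>t. g1 (s m) t - g1 (s n) t)"] zero_le_power2[of "norm (g2 (s m) - g2 (s n))"]
          zero_le_power2[of "L2nrm T (\<lambda>t. g3 (s m) t - g3 (s n) t)"] zero_le_power2[of "norm (g4 (s m) - g4 (s n))"]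
        by linarith
    qed
  qed
  obtain p where p: "p \<in> L2sp T" "(\<lambda>n. (L2nrm T (\<lambda>t. g1 (s n) t - p t))\<^sup>2) \<longlonglongrightarrow> 0"
  proof (rule L2sp_complete[of "\<lambda>n. g1 (s n)" T])
    show "g1 (s n) \<in> L2sp T" for n by (rule gL(1)[OF sS])
    show "\<exists>N. \<forall>m\<ge>N. \<forall>n\<ge>N. (L2nrm T (\<lambda>t. g1 (s m) t - g1 (s n) t))\<^sup>2 < e" if e: "e > 0" for e
      using C4[OF e] by blast
  qed (use T in auto)
  obtain q where q: "q \<in> L2sp T" "(\<lambda>n. (L2nrm T (\<lambda>t. g3 (s n) t - q t))\<^sup>2) \<longlonglongrightarrow> 0"
  proof (rule L2sp_complete[of "\<lambda>n. g3 (s n)" T])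
    show "g3 (s n) \<in> L2sp T" for n by (rule gL(2)[OF sS])
    show "\<exists>N. \<forall>m\<ge>N. \<forall>n\<ge>N. (L2nrm T (\<lambda>t. g3 (s m) t - g3 (s n) t))\<^sup>2 < e" if e: "e > 0" for e
      using C4[OF e] by blast
  qed (use T in auto)
  obtain z0 where z0: "(\<lambda>n. g2 (s n)) \<longlonglongrightarrow> z0"
    by (rule convergent_of_norm_sq_Cauchy[of "\<lambda>n. g2 (s n)"]) (use C4 in blast)+
  obtain z where z: "(\<lambda>n. g4 (s n)) \<longlonglongrightarrow> z"
    by (rule convergent_of_norm_sq_Cauchy[of "\<lambda>n. g4 (s n)"]) (use C4 in blast)+
  show ?thesis
  proof (rule that[OF p(1) q(1)])
    fix a1 b1 a2 b2 assume W: "WE T a1 b1" "WE T a2 b2"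
    let ?x = "(a1, b1, a2, b2)"
    have xS: "?x \<in> S" unfolding S_def using W by simp
    have "(\<lambda>n. ip (s n) ?x) \<longlonglongrightarrow> (\<integral>t. inner (p t) (g1 ?x t) \<partial>MT T) + inner z0 (g2 ?x)
      + (\<integral>t. inner (q t) (g3 ?x t) \<partial>MT T) + inner z (g4 ?x)"
      unfolding ip_def
      by (intro tendsto_add L2_inner_tendsto tendsto_inner tendsto_const z0 z p q gL sS xS)
    from LIMSEQ_unique[OF this sl[OF xS]]
    show "(\<integral>t. inner (p t) (G1 b1 a1 a2 t) \<partial>MT T) + inner z0 (hval \<iota> T a1 0)
        + (\<integral>t. inner (q t) (G3 a1 b2 a2 t) \<partial>MT T) + inner z (G4 T a1 a2)
      = (\<integral>t. inner (f t) (a2 t) \<partial>MT T) + (\<integral>t. inner (g t) (a1 t) \<partial>MT T)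
        + inner yT (hval \<iota> T a1 T) + inner y0 (hval \<iota> T a2 0)"
      unfolding g1_def g2_def g3_def g4_def l_def by simp
  qed
qed

text \<open>The function p, paired with the state equation, becomes w2, and q, paired with the
  adjoint equation, becomes w1. The vectors z and z0 turn out to be the traces w1(T) and
  w2(0).\<close>

lemma solution_exists:
  assumes T: "0 < T" and f: "f \<in> L2sp T" and g: "g \<in> L2sp T"
  obtains w1 e1 w2 e2 where "WE T w1 e1" "WE T w2 e2" "G1 e1 w1 w2 = f" "hval \<iota> T w1 0 = y0"
    "G3 w1 e2 w2 = g" "G4 T w1 w2 = yT"
proof -
  obtain p q z0 z where p: "p \<in> L2sp T" and q: "q \<in> L2sp T"
    and weak: "\<And>a1 b1 a2 b2. WE T a1 b1 \<Longrightarrow> WE T a2 b2 \<Longrightarrow>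
      (\<integral>t. inner (p t) (G1 b1 a1 a2 t) \<partial>MT T) + inner z0 (hval \<iota> T a1 0)
        + (\<integral>t. inner (q t) (G3 a1 b2 a2 t) \<partial>MT T) + inner z (G4 T a1 a2)
      = (\<integral>t. inner (f t) (a2 t) \<partial>MT T) + (\<integral>t. inner (g t) (a1 t) \<partial>MT T)
        + inner yT (hval \<iota> T a1 T) + inner y0 (hval \<iota> T a2 0)"
    by (rule very_weak_solution[OF T f g, of yT y0]) blast
  interpret A: bounded_linear A by (rule blA)
  interpret At: bounded_linear "adjoint A" by (rule bl_At)
  interpret CC: bounded_linear CC by (rule bl_CC)
  interpret QQ: bounded_linear QQ by (rule bl_QQ)
  interpret PP: bounded_linear PP by (rule bl_PP)
  have Z1: "WE T (\<lambda>t. 0) (\<lambda>t. 0)"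
    using WE_scaled_const(1)[of "\<lambda>_. 0" "\<lambda>_. 0" T 0] by simp
  have Z2: "hval \<iota> T (\<lambda>t. 0) t = 0" if "t \<in> {0..T}" for t
    using WE_scaled_const(2)[of "\<lambda>_. 0" "\<lambda>_. 0" T t 0] T that by simp
  \<comment> \<open>The would-be derivatives are read off from the equations, which then hold by
    definition; what remains is to recognize them as derivatives and to identify the traces.\<close>
  define e1 where "e1 t = f t + A (q t) + CC (p t)" for t
  define e2 where "e2 t = QQ (q t) - g t - adjoint A (p t)" for t
  have e1: "e1 \<in> L2sp T" unfolding e1_def[abs_def] by (intro L2sp_add f L2sp_bl[OF q blA] L2sp_bl[OF p bl_CC])
  have e2: "e2 \<in> L2sp T" unfolding e2_def[abs_def] by (intro L2sp_diff g L2sp_bl[OF q bl_QQ] L2sp_bl[OF p bl_At])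
  \<comment> \<open>Testing with the pair (0, \<psi> v) yields the state equation for q.\<close>
  have weak1: "(\<integral>t. inner (e1 t) (\<psi> t *\<^sub>R v) + inner (\<psi>' t *\<^sub>R K v) (q t) \<partial>MT T) = \<psi> T * inner z (\<iota> v) - \<psi> 0 * inner y0 (\<iota> v)"
    if d: "\<And>t. (\<psi> has_real_derivative \<psi>' t) (at t)" "continuous_on UNIV \<psi>'" for \<psi> \<psi>' v
  proof -
    note S = WE_scaled_const(1)[OF d, of T v] and h = WE_scaled_const(2)[OF d T, of _ v]
    note L = WE_L2[OF S]
    have "(\<integral>t. inner (e1 t) (\<psi> t *\<^sub>R v) + inner (\<psi>' t *\<^sub>R K v) (q t) \<partial>MT T)
      = (\<integral>t. inner (f t) (\<psi> t *\<^sub>R v) - (inner (p t) (G1 (\<lambda>t. 0) (\<lambda>t. 0) (\<lambda>t. \<psi> t *\<^sub>R v) t)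
          + inner (q t) (G3 (\<lambda>t. 0) (\<lambda>t. \<psi>' t *\<^sub>R K v) (\<lambda>t. \<psi> t *\<^sub>R v) t)) \<partial>MT T)"
    proof (intro Bochner_Integration.integral_cong refl)
      fix t
      have "inner (A (q t)) v = inner (q t) (adjoint A v)" "inner (CC (p t)) v = inner (p t) (CC v)"
        using At_inner[of v "q t"] CC_inner[of "p t" v] CC_inner[of v "p t"] by (simp_all add: inner_commute)
      then show "inner (e1 t) (\<psi> t *\<^sub>R v) + inner (\<psi>' t *\<^sub>R K v) (q t)
        = inner (f t) (\<psi> t *\<^sub>R v) - (inner (p t) (G1 (\<lambda>t. 0) (\<lambda>t. 0) (\<lambda>t. \<psi> t *\<^sub>R v) t)
          + inner (q t) (G3 (\<lambda>t. 0) (\<lambda>t. \<psi>' t *\<^sub>R K v) (\<lambda>t. \<psi> t *\<^sub>R v) t))"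
        by (simp add: e1_def G1_def G3_def A.zero CC.scaleR QQ.zero At.scaleR inner_add_left inner_diff_right inner_commute algebra_simps)
    qed
    also have "\<dots> = (\<integral>t. inner (f t) (\<psi> t *\<^sub>R v) \<partial>MT T) - ((\<integral>t. inner (p t) (G1 (\<lambda>t. 0) (\<lambda>t. 0) (\<lambda>t. \<psi> t *\<^sub>R v) t) \<partial>MT T)
          + (\<integral>t. inner (q t) (G3 (\<lambda>t. 0) (\<lambda>t. \<psi>' t *\<^sub>R K v) (\<lambda>t. \<psi> t *\<^sub>R v) t) \<partial>MT T))"
      using L2sp_inner[OF f L(1)] L2sp_inner[OF p G1_L2[OF L2sp_const L2sp_const L(1)]] L2sp_inner[OF q G3_L2[OF L2sp_const L(2) L(1)]]
      by simp
    also have "\<dots> = \<psi> T * inner z (\<iota> v) - \<psi> 0 * inner y0 (\<iota> v)"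
      using weak[OF Z1 S] T h[of 0] h[of T] Z2[of 0] Z2[of T] by (simp add: G4_def PP.zero)
    finally show ?thesis .
  qed
  note W1 = WE_of_weak_form[OF T q e1 weak1]
  \<comment> \<open>Testing with (\<psi> v, 0) yields the adjoint equation for p. Its end value at T
    is yT - PP z, which is the terminal condition since z is w1(T) by \<open>W1\<close>.\<close>
  have weak2: "(\<integral>t. inner (e2 t) (\<psi> t *\<^sub>R v) + inner (\<psi>' t *\<^sub>R K v) (p t) \<partial>MT T) = \<psi> T * inner (yT - PP z) (\<iota> v) - \<psi> 0 * inner z0 (\<iota> v)"
    if d: "\<And>t. (\<psi> has_real_derivative \<psi>' t) (at t)" "continuous_on UNIV \<psi>'" for \<psi> \<psi>' v
  proof -
    note S = WE_scaled_const(1)[OF d, of T v] and h = WE_scaled_const(2)[OF d T, of _ v]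
    note L = WE_L2[OF S]
    have "(\<integral>t. inner (e2 t) (\<psi> t *\<^sub>R v) + inner (\<psi>' t *\<^sub>R K v) (p t) \<partial>MT T)
      = (\<integral>t. inner (p t) (G1 (\<lambda>t. \<psi>' t *\<^sub>R K v) (\<lambda>t. \<psi> t *\<^sub>R v) (\<lambda>t. 0) t)
          + inner (q t) (G3 (\<lambda>t. \<psi> t *\<^sub>R v) (\<lambda>t. 0) (\<lambda>t. 0) t) - inner (g t) (\<psi> t *\<^sub>R v) \<partial>MT T)"
    proof (intro Bochner_Integration.integral_cong refl)
      fix t
      have "inner (adjoint A (p t)) v = inner (p t) (A v)" "inner (QQ (q t)) v = inner (q t) (QQ v)"
        using At_inner[of "p t" v] QQ_inner[of "q t" v] QQ_inner[of v "q t"] by (simp_all add: inner_commute)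
      then show "inner (e2 t) (\<psi> t *\<^sub>R v) + inner (\<psi>' t *\<^sub>R K v) (p t)
        = inner (p t) (G1 (\<lambda>t. \<psi>' t *\<^sub>R K v) (\<lambda>t. \<psi> t *\<^sub>R v) (\<lambda>t. 0) t)
          + inner (q t) (G3 (\<lambda>t. \<psi> t *\<^sub>R v) (\<lambda>t. 0) (\<lambda>t. 0) t) - inner (g t) (\<psi> t *\<^sub>R v)"
        by (simp add: e2_def G1_def G3_def A.scaleR CC.zero QQ.scaleR At.zero inner_diff_left inner_diff_right inner_commute algebra_simps)
    qed
    also have "\<dots> = (\<integral>t. inner (p t) (G1 (\<lambda>t. \<psi>' t *\<^sub>R K v) (\<lambda>t. \<psi> t *\<^sub>R v) (\<lambda>t. 0) t) \<partial>MT T)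
          + (\<integral>t. inner (q t) (G3 (\<lambda>t. \<psi> t *\<^sub>R v) (\<lambda>t. 0) (\<lambda>t. 0) t) \<partial>MT T) - (\<integral>t. inner (g t) (\<psi> t *\<^sub>R v) \<partial>MT T)"
      using L2sp_inner[OF g L(1)] L2sp_inner[OF p G1_L2[OF L(2) L(1) L2sp_const]] L2sp_inner[OF q G3_L2[OF L(1) L2sp_const L2sp_const]]
      by simp
    also have "\<dots> = \<psi> T * inner (yT - PP z) (\<iota> v) - \<psi> 0 * inner z0 (\<iota> v)"
    proof -
      have "inner z (PP (\<iota> v)) = inner (PP z) (\<iota> v)" using PP_inner[of "\<iota> v" z] PP_inner[of z "\<iota> v"] by (simp add: inner_commute)
      then show ?thesis
        using weak[OF S Z1] T h[of 0] h[of T] Z2[of 0] Z2[of T]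
        by (simp add: G4_def PP.scaleR inner_diff_left algebra_simps)
    qed
    finally show ?thesis .
  qed
  note W2 = WE_of_weak_form[OF T p e2 weak2]
  show ?thesis
  proof (rule that[OF W1(1) W2(1) _ W1(3)])
    show "G1 e1 q p = f" "G3 q e2 p = g" by (simp_all add: fun_eq_iff G1_def G3_def e1_def e2_def)
    show "G4 T q p = yT" by (simp add: G4_def W1(2) W2(2))
  qed
qed

text \<open>The a priori estimate for the difference, whose data vanish.\<close>

lemma solution_unique:
  assumes T: "0 < T" and W: "WE T w1 e1" "WE T w2 e2" "WE T w1' e1'" "WE T w2' e2'"
    and eq: "AE t in MT T. G1 e1 w1 w2 t = G1 e1' w1' w2' t" "hval \<iota> T w1 0 = hval \<iota> T w1' 0"
      "AE t in MT T. G3 w1 e2 w2 t = G3 w1' e2' w2' t" "G4 T w1 w2 = G4 T w1' w2'"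
  shows "AE t in MT T. w1 t = w1' t" "AE t in MT T. w2 t = w2' t"
proof -
  let ?d = "\<lambda>f g t. 1 *\<^sub>R f t + (-1) *\<^sub>R g t"
  have Wd: "WE T (?d w1 w1') (?d e1 e1')" "WE T (?d w2 w2') (?d e2 e2')" by (intro WE_lincomb W)+
  have "L2nrm T (G1 (?d e1 e1') (?d w1 w1') (?d w2 w2')) = L2nrm T (\<lambda>_. 0 :: 'v)"
    by (rule L2nrm_cong_AE) (use eq(1) in \<open>auto simp only: G1_lincomb elim!: eventually_mono\<close>, simp)
  moreover have "L2nrm T (G3 (?d w1 w1') (?d e2 e2') (?d w2 w2')) = L2nrm T (\<lambda>_. 0 :: 'v)"
    by (rule L2nrm_cong_AE) (use eq(3) in \<open>auto simp only: G3_lincomb elim!: eventually_mono\<close>, simp)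
  moreover have "L2nrm T (\<lambda>_. 0 :: 'v) = 0" by (simp add: L2nrm_def)
  moreover have "hval \<iota> T (?d w1 w1') 0 = 0" using hval_lincomb[OF T W(1,3), of 0 1 "-1"] eq(2) T by simp
  moreover have "G4 T (?d w1 w1') (?d w2 w2') = 0" using G4_lincomb[OF T W(1,3,2,4), of 1 "-1"] eq(4) by simp
  ultimately have "Dsq T (?d w1 w1') (?d e1 e1') (?d w2 w2') (?d e2 e2') = 0" unfolding Dsq_def by simp
  with apriori[OF T Wd] have "Ysq T (?d w1 w1') (?d e1 e1') (?d w2 w2') (?d e2 e2') \<le> 0" by simp
  then have z: "(L2nrm T (?d w1 w1'))\<^sup>2 \<le> 0" "(L2nrm T (?d w2 w2'))\<^sup>2 \<le> 0"
    unfolding Ysq_def by (smt (verit) zero_le_power2)+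
  have AE0: "AE t in MT T. h t = 0" if "h \<in> L2sp T" "(L2nrm T h)\<^sup>2 \<le> 0" for h :: "real \<Rightarrow> 'v"
  proof -
    have "(\<integral>t. (norm (h t))\<^sup>2 \<partial>MT T) = 0"
      using that(2) zero_le_power2[of "L2nrm T h"] unfolding L2nrm_sq[OF that(1), symmetric] by linarith
    then have "AE t in MT T. (norm (h t))\<^sup>2 = 0"
      by (subst (asm) integral_nonneg_eq_0_iff_AE[OF L2spD(2)[OF that(1)]]) auto
    then show ?thesis by simp
  qed
  show "AE t in MT T. w1 t = w1' t" "AE t in MT T. w2 t = w2' t"
    using AE0[OF WE_L2(1)[OF Wd(1)] z(1)] AE0[OF WE_L2(1)[OF Wd(2)] z(2)] by simp_all
qed

end

section \<open>Passage from Riesz coordinates back to V'\<close>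

theorem theorem3p3:
  fixes \<iota> :: "'v::{real_inner,complete_space,second_countable_topology} \<Rightarrow> 'h::{real_inner,complete_space,second_countable_topology}"
    and B :: "'u::euclidean_space \<Rightarrow> 'h"
    and Q P :: "'h \<Rightarrow> 'h"
    and a :: "(nat \<Rightarrow> real) \<Rightarrow> 'v \<Rightarrow> 'v \<Rightarrow> real"
  assumes emb: "bounded_linear \<iota>" "inj \<iota>" "closure (range \<iota>) = UNIV"
    and ops: "bounded_linear B" "bounded_linear Q" "bounded_linear P"
    and bil: "\<forall>\<sigma>\<in>Sfrak. bilinear (a \<sigma>)"
    and A2: "\<exists>\<rho> \<theta>. \<theta> > 0 \<and> (\<forall>\<sigma>\<in>Sfrak. \<forall>v. a \<sigma> v v + \<rho> * (norm (\<iota> v))\<^sup>2 \<ge> \<theta> * (norm v)\<^sup>2)"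
    and A3: "\<exists>CA. \<forall>\<sigma>\<in>Sfrak. \<forall>v w. \<bar>a \<sigma> v w\<bar> \<le> CA * norm v * norm w"
  shows "\<exists>c::real \<Rightarrow> real. continuous_on {0<..} c \<and> mono_on {0<..} c \<and> (\<forall>T>0. c T > 0) \<and>
    (\<forall>T>0. \<forall>\<sigma>\<in>Sfrak.
       \<comment> \<open>G_sigma is a bounded operator W_T x W_T -> V'_T x H x V'_T x H\<close>
       (\<forall>w1\<in>WT \<iota> T. \<forall>w2\<in>WT \<iota> T.
          fst (Gop \<iota> B Q P a T \<sigma> w1 w2) \<in> L2sp T \<and> fst (snd (snd (Gop \<iota> B Q P a T \<sigma> w1 w2))) \<in> L2sp T) \<and>
       (\<exists>C. \<forall>w1\<in>WT \<iota> T. \<forall>w2\<in>WT \<iota> T.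
          Dnrm T (Gop \<iota> B Q P a T \<sigma> w1 w2) \<le> C * sqrt ((WTnrm \<iota> T w1)\<^sup>2 + (WTnrm \<iota> T w2)\<^sup>2)) \<and>
       \<comment> \<open>surjectivity\<close>
       (\<forall>f\<in>L2sp T. \<forall>y0. \<forall>g\<in>L2sp T. \<forall>yT.
          \<exists>w1\<in>WT \<iota> T. \<exists>w2\<in>WT \<iota> T. Geq T (Gop \<iota> B Q P a T \<sigma> w1 w2) (f, y0, g, yT)) \<and>
       \<comment> \<open>injectivity (up to a.e. equality)\<close>
       (\<forall>w1\<in>WT \<iota> T. \<forall>w2\<in>WT \<iota> T. \<forall>w1'\<in>WT \<iota> T. \<forall>w2'\<in>WT \<iota> T.
          Geq T (Gop \<iota> B Q P a T \<sigma> w1 w2) (Gop \<iota> B Q P a T \<sigma> w1' w2') \<longrightarrow>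
          (AE t in lebesgue_on {0..T}. w1 t = w1' t) \<and> (AE t in lebesgue_on {0..T}. w2 t = w2' t)) \<and>
       \<comment> \<open>norm bound of the inverse\<close>
       (\<forall>f\<in>L2sp T. \<forall>y0. \<forall>g\<in>L2sp T. \<forall>yT. \<forall>w1\<in>WT \<iota> T. \<forall>w2\<in>WT \<iota> T.
          Geq T (Gop \<iota> B Q P a T \<sigma> w1 w2) (f, y0, g, yT) \<longrightarrow>
          sqrt ((WTnrm \<iota> T w1)\<^sup>2 + (WTnrm \<iota> T w2)\<^sup>2) \<le> c T * Dnrm T (f, y0, g, yT)))"
proof -
  obtain \<rho>' \<theta> where \<theta>: "\<theta> > 0" and coer: "\<And>\<sigma> v. \<sigma> \<in> Sfrak \<Longrightarrow> a \<sigma> v v + \<rho>' * (norm (\<iota> v))\<^sup>2 \<ge> \<theta> * (norm v)\<^sup>2"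
    using A2 by blast
  obtain CA where CA: "\<And>\<sigma> v w. \<sigma> \<in> Sfrak \<Longrightarrow> \<bar>a \<sigma> v w\<bar> \<le> CA * norm v * norm w" using A3 by blast
  \<comment> \<open>(A2) allows negative \<rho>; raising it to 0 preserves coercivity and makes the
    exponential in \<open>cG\<close> increasing in T.\<close>
  define \<rho> where "\<rho> = max \<rho>' 0"
  define cA where "cA = \<bar>CA\<bar>"
  \<comment> \<open>The locale is stated for the adjoint of B, from which B is recovered by taking
    the adjoint again.\<close>
  define C where "C = adjoint B"
  have blC: "bounded_linear C" unfolding C_def by (rule bounded_linear_adjoint[OF ops(1)])
  have adjC: "adjoint C = B"
    by (rule adjoint_unique) (metis C_def adjoint_inner[OF ops(1)] inner_commute)
  obtain ci where ci: "0 \<le> ci" "\<And>v. norm (\<iota> v) \<le> ci * norm v" by (rule bounded_linear_nonneg_bound[OF emb(1)]) blast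
  obtain cC where cC: "0 \<le> cC" "\<And>h. norm (C h) \<le> cC * norm h" by (rule bounded_linear_nonneg_bound[OF blC]) blast
  obtain cQ where cQ: "0 \<le> cQ" "\<And>h. norm (Q h) \<le> cQ * norm h" by (rule bounded_linear_nonneg_bound[OF ops(2)]) blast
  obtain cP where cP: "0 \<le> cP" "\<And>h. norm (P h) \<le> cP * norm h" by (rule bounded_linear_nonneg_bound[OF ops(3)]) blast
  have ab: "\<bar>a \<sigma> v w\<bar> \<le> cA * norm v * norm w" if "\<sigma> \<in> Sfrak" for \<sigma> v w
  proof -
    have "CA * norm v * norm w \<le> cA * norm v * norm w" unfolding cA_def by (intro mult_right_mono) auto
    then show ?thesis using CA[OF that, of v w] by linarith
  qed
  have lin: "a \<sigma> (x + y) w = a \<sigma> x w + a \<sigma> y w" "a \<sigma> (r *\<^sub>R x) w = r * a \<sigma> x w"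
    "a \<sigma> w (x + y) = a \<sigma> w x + a \<sigma> w y" "a \<sigma> w (r *\<^sub>R x) = r * a \<sigma> w x" if "\<sigma> \<in> Sfrak" for \<sigma> x y w r
    using bil that by (simp_all add: bilinear_ladd bilinear_lmul bilinear_radd bilinear_rmul)
  have Aop: "blinfun_apply (Aop a \<sigma> v) w = - a \<sigma> v w" if "\<sigma> \<in> Sfrak" for \<sigma> v w
    unfolding Aop_def
  proof (subst bounded_linear_Blinfun_apply)
    show "bounded_linear (\<lambda>w. - a \<sigma> v w)"
      by (rule bounded_linear_intro[where K="cA * norm v"])
         (use ab[OF that, of v] in \<open>auto simp: lin[OF that] mult.commute\<close>)
  qed simp
  have Aadj: "blinfun_apply (Aadj a \<sigma> v) w = - a \<sigma> w v" if "\<sigma> \<in> Sfrak" for \<sigma> v w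
    unfolding Aadj_def
  proof (subst bounded_linear_Blinfun_apply)
    show "bounded_linear (\<lambda>w. - a \<sigma> w v)"
      by (rule bounded_linear_intro[where K="cA * norm v"])
         (use ab[OF that, of _ v] in \<open>auto simp: lin[OF that] mult_ac\<close>)
  qed simp
  define A where "A \<sigma> v = riesz (Aop a \<sigma> v)" for \<sigma> v
  have A_inner: "inner (A \<sigma> v) w = - a \<sigma> v w" if "\<sigma> \<in> Sfrak" for \<sigma> v w
    unfolding A_def by (simp add: inner_riesz Aop[OF that])
  have sad: "saddle \<iota> (A \<sigma>) C Q P \<rho> \<theta> cA ci cC cQ cP" if s: "\<sigma> \<in> Sfrak" for \<sigma>
  proof (intro saddle.intro gelfand.intro saddle_axioms.intro)
    have nA: "norm (A \<sigma> v) \<le> cA * norm v" for v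
    proof (rule norm_le_of_inner_le)
      show "inner x (A \<sigma> v) \<le> cA * norm v * norm x" for x
        using ab[OF s, of v x] A_inner[OF s, of v x] inner_commute[of x "A \<sigma> v"] by linarith
    qed (simp add: cA_def)
    then show "norm (A \<sigma> v) \<le> cA * norm v" for v .
    show "bounded_linear (A \<sigma>)"
    proof (rule bounded_linear_intro[where K=cA])
      show "A \<sigma> (x + y) = A \<sigma> x + A \<sigma> y" for x y
        by (rule vector_eq_rdot[THEN iffD1]) (simp add: inner_add_left A_inner[OF s] lin[OF s])
      show "A \<sigma> (r *\<^sub>R x) = r *\<^sub>R A \<sigma> x" for r x
        by (rule vector_eq_rdot[THEN iffD1]) (simp add: A_inner[OF s] lin[OF s])
      show "norm (A \<sigma> x) \<le> norm x * cA" for x using nA[of x] by (simp add: mult.commute)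
    qed
    show "inner (A \<sigma> v) v \<le> \<rho> * (norm (\<iota> v))\<^sup>2 - \<theta> * (norm v)\<^sup>2" for v
    proof -
      have "\<rho>' * (norm (\<iota> v))\<^sup>2 \<le> \<rho> * (norm (\<iota> v))\<^sup>2" unfolding \<rho>_def by (intro mult_right_mono) auto
      then show ?thesis using coer[OF s, of v] by (simp add: A_inner[OF s])
    qed
  qed (use emb ops blC \<theta> ci cC cQ cP in \<open>auto simp: \<rho>_def cA_def\<close>)
  interpret V: gelfand \<iota> by (rule gelfand.intro[OF emb])
  \<comment> \<open>Any parameter would do: the constant named through this instance contains only
    the common bounds and not the operator, so it is the same for every \<sigma>.\<close>
  have "(\<lambda>_. 0) \<in> Sfrak" unfolding Sfrak_def by auto
  then interpret S0: saddle \<iota> "A (\<lambda>_. 0)" C Q P \<rho> \<theta> cA ci cC cQ cP by (rule sad)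
  have riesz_hdual: "riesz (hdual \<iota> h) = V.istar h" for h
  proof (rule riesz_eqI)
    show "blinfun_apply (hdual \<iota> h) v = inner v (V.istar h)" for v
      unfolding hdual_def
      by (subst bounded_linear_Blinfun_apply)
         (auto simp: V.istar_inner inner_commute intro: bounded_linear_inner_right_comp emb(1))
  qed
  show ?thesis
  proof (rule exI[of _ S0.cG], intro conjI allI impI ballI)
    show "continuous_on {0<..} S0.cG" "mono_on {0<..} S0.cG" "0 < S0.cG T" for T by (rule S0.cG_props)+
    fix T :: real and \<sigma> assume T: "0 < T" and s: "\<sigma> \<in> Sfrak"
    interpret S: saddle \<iota> "A \<sigma>" C Q P \<rho> \<theta> cA ci cC cQ cP by (rule sad[OF s])
    let ?G = "Gop \<iota> B Q P a T \<sigma>"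
    let ?e = "\<lambda>w t. riesz (wderiv \<iota> T w t)"
    have W: "V.WE T w (?e w)" if "w \<in> WT \<iota> T" for w by (rule V.wderiv_WE(2)[OF T that])
    have adjA: "adjoint (A \<sigma>) v = riesz (Aadj a \<sigma> v)" for v
      by (rule riesz_eqI[symmetric])
         (simp add: Aadj[OF s] A_inner[OF s, symmetric] flip: adjoint_inner[OF S.blA])
    have G1: "riesz (fst (?G w1 w2) t) = S.G1 (?e w1) w1 w2 t" for w1 w2 t
      unfolding Gop_def S.G1_def S.CC_def adjC by (simp add: riesz_diff riesz_hdual A_def C_def)
    have G3: "riesz (fst (snd (snd (?G w1 w2))) t) = S.G3 w1 (?e w2) w2 t" for w1 w2 t
      unfolding Gop_def S.G3_def S.QQ_def adjA by (simp add: riesz_diff riesz_hdual)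
    have G24: "fst (snd (?G w1 w2)) = hval \<iota> T w1 0" "snd (snd (snd (?G w1 w2))) = S.G4 T w1 w2" for w1 w2
      unfolding Gop_def S.G4_def S.PP_def by simp_all
    have GL: "fst (?G w1 w2) \<in> L2sp T" "fst (snd (snd (?G w1 w2))) \<in> L2sp T" if w: "w1 \<in> WT \<iota> T" "w2 \<in> WT \<iota> T" for w1 w2
      using S.G1_L2[OF V.WE_L2(2,1)[OF W[OF w(1)]] V.WE_L2(1)[OF W[OF w(2)]]]
        S.G3_L2[OF V.WE_L2(1)[OF W[OF w(1)]] V.WE_L2(2,1)[OF W[OF w(2)]]]
      by (simp_all add: L2sp_riesz[symmetric] G1 G3)
    have Dn: "Dnrm T (?G w1 w2) = sqrt (S.Dsq T w1 (?e w1) w2 (?e w2))" for w1 w2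
    proof -
      have "L2nrm T (fst (?G w1 w2)) = L2nrm T (S.G1 (?e w1) w1 w2)"
        "L2nrm T (fst (snd (snd (?G w1 w2)))) = L2nrm T (S.G3 w1 (?e w2) w2)"
        by (simp_all add: L2nrm_riesz[symmetric] G1 G3)
      then show ?thesis unfolding Dnrm_def S.Dsq_def by (simp add: case_prod_beta G24)
    qed
    have Wn: "(WTnrm \<iota> T w)\<^sup>2 = (L2nrm T w)\<^sup>2 + (L2nrm T (?e w))\<^sup>2" for w
      unfolding WTnrm_def by (simp add: L2nrm_riesz)
    show "fst (?G w1 w2) \<in> L2sp T" "fst (snd (snd (?G w1 w2))) \<in> L2sp T" if "w1 \<in> WT \<iota> T" "w2 \<in> WT \<iota> T" for w1 w2
      by (rule GL[OF that])+
    show "\<exists>M. \<forall>w1\<in>WT \<iota> T. \<forall>w2\<in>WT \<iota> T. Dnrm T (?G w1 w2) \<le> M * sqrt ((WTnrm \<iota> T w1)\<^sup>2 + (WTnrm \<iota> T w2)\<^sup>2)"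
    proof -
      obtain M where M: "\<And>w1 e1 w2 e2. V.WE T w1 e1 \<Longrightarrow> V.WE T w2 e2 \<Longrightarrow>
        S.Dsq T w1 e1 w2 e2 \<le> M * ((L2nrm T w1)\<^sup>2 + (L2nrm T e1)\<^sup>2 + (L2nrm T w2)\<^sup>2 + (L2nrm T e2)\<^sup>2)"
        by (rule S.Dsq_bounded[OF T]) blast
      have "Dnrm T (?G w1 w2) \<le> sqrt M * sqrt ((WTnrm \<iota> T w1)\<^sup>2 + (WTnrm \<iota> T w2)\<^sup>2)"
        if "w1 \<in> WT \<iota> T" "w2 \<in> WT \<iota> T" for w1 w2
        unfolding Dn Wn real_sqrt_mult[symmetric] using M[OF W[OF that(1)] W[OF that(2)]] by (simp add: add.assoc)
      then show ?thesis by blast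
    qed
    show "\<exists>w1\<in>WT \<iota> T. \<exists>w2\<in>WT \<iota> T. Geq T (?G w1 w2) (f, y0, g, yT)"
      if fg: "f \<in> L2sp T" "g \<in> L2sp T" for f y0 g yT
    proof -
      have rf: "(\<lambda>t. riesz (f t)) \<in> L2sp T" "(\<lambda>t. riesz (g t)) \<in> L2sp T" using fg by (simp_all add: L2sp_riesz)
      obtain w1 e1 w2 e2 where w: "V.WE T w1 e1" "V.WE T w2 e2" "S.G1 e1 w1 w2 = (\<lambda>t. riesz (f t))" "hval \<iota> T w1 0 = y0"
        "S.G3 w1 e2 w2 = (\<lambda>t. riesz (g t))" "S.G4 T w1 w2 = yT"
        by (rule S.solution_exists[OF T rf, of y0 yT])
      have wT: "w1 \<in> WT \<iota> T" "w2 \<in> WT \<iota> T" using w(1,2) V.WT_iff[OF T] by blast+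
      \<comment> \<open>The derivative chosen by \<open>wderiv\<close> agrees with e1 only almost
        everywhere, which is all that \<open>Geq\<close> compares.\<close>
      have "AE t in MT T. fst (?G w1 w2) t = f t"
        using V.WE_unique[OF T W[OF wT(1)] w(1)]
      proof eventually_elim
        case (elim t)
        then have "riesz (fst (?G w1 w2) t) = S.G1 e1 w1 w2 t" unfolding G1 S.G1_def by simp
        then show ?case unfolding w(3) by (simp add: riesz_inj)
      qed
      moreover have "AE t in MT T. fst (snd (snd (?G w1 w2))) t = g t"
        using V.WE_unique[OF T W[OF wT(2)] w(2)]
      proof eventually_elim
        case (elim t)
        then have "riesz (fst (snd (snd (?G w1 w2))) t) = S.G3 w1 e2 w2 t" unfolding G3 S.G3_def by simp
        then show ?case unfolding w(5) by (simp add: riesz_inj)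
      qed
      ultimately have "Geq T (?G w1 w2) (f, y0, g, yT)"
        using w(4,6) unfolding Geq_def by (simp add: case_prod_beta G24)
      then show ?thesis using wT by blast
    qed
    show "AE t in MT T. w1 t = w1' t" "AE t in MT T. w2 t = w2' t"
      if wT: "w1 \<in> WT \<iota> T" "w2 \<in> WT \<iota> T" "w1' \<in> WT \<iota> T" "w2' \<in> WT \<iota> T"
        and eq: "Geq T (?G w1 w2) (?G w1' w2')" for w1 w2 w1' w2'
    proof -
      have "AE t in MT T. fst (?G w1 w2) t = fst (?G w1' w2') t" "fst (snd (?G w1 w2)) = fst (snd (?G w1' w2'))"
        "AE t in MT T. fst (snd (snd (?G w1 w2))) t = fst (snd (snd (?G w1' w2'))) t" "snd (snd (snd (?G w1 w2))) = snd (snd (snd (?G w1' w2')))"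
        using eq unfolding Geq_def by (simp_all add: case_prod_beta)
      then have e: "AE t in MT T. S.G1 (?e w1) w1 w2 t = S.G1 (?e w1') w1' w2' t" "hval \<iota> T w1 0 = hval \<iota> T w1' 0"
        "AE t in MT T. S.G3 w1 (?e w2) w2 t = S.G3 w1' (?e w2') w2' t" "S.G4 T w1 w2 = S.G4 T w1' w2'"
        unfolding G1[symmetric] G3[symmetric] riesz_inj by (simp_all add: G24)
      show "AE t in MT T. w1 t = w1' t" "AE t in MT T. w2 t = w2' t"
        by (rule S.solution_unique[OF T W[OF wT(1)] W[OF wT(2)] W[OF wT(3)] W[OF wT(4)] e])+
    qed
    show "sqrt ((WTnrm \<iota> T w1)\<^sup>2 + (WTnrm \<iota> T w2)\<^sup>2) \<le> S0.cG T * Dnrm T (f, y0, g, yT)"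
      if wT: "w1 \<in> WT \<iota> T" "w2 \<in> WT \<iota> T" and eq: "Geq T (?G w1 w2) (f, y0, g, yT)" for f y0 g yT w1 w2
    proof -
      have "AE t in MT T. norm (fst (?G w1 w2) t) = norm (f t)" "AE t in MT T. norm (fst (snd (snd (?G w1 w2))) t) = norm (g t)"
        "fst (snd (?G w1 w2)) = y0" "snd (snd (snd (?G w1 w2))) = yT"
        using eq unfolding Geq_def by (auto simp: case_prod_beta elim: eventually_mono)
      then have "Dnrm T (?G w1 w2) = Dnrm T (f, y0, g, yT)"
        unfolding Dnrm_def by (simp add: case_prod_beta L2nrm_cong_AE[of "fst (?G w1 w2)" f T] L2nrm_cong_AE[of "fst (snd (snd (?G w1 w2)))" g T])
      then have D: "sqrt (S.Dsq T w1 (?e w1) w2 (?e w2)) = Dnrm T (f, y0, g, yT)" by (simp add: Dn)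
      \<comment> \<open>The two squared traces in \<open>Ysq\<close> are dropped.\<close>
      have "sqrt ((WTnrm \<iota> T w1)\<^sup>2 + (WTnrm \<iota> T w2)\<^sup>2) \<le> sqrt (S.Ysq T w1 (?e w1) w2 (?e w2))"
        unfolding Wn S.Ysq_def by simp
      also have "\<dots> \<le> S.cG T * sqrt (S.Dsq T w1 (?e w1) w2 (?e w2))"
        by (rule S.apriori[OF T W[OF wT(1)] W[OF wT(2)]])
      finally show ?thesis unfolding D .
    qed
  qed
qed

end
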